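(* For all $N\geq 2$ and all $0\leq i\leq N$, the following identities hold in $\mathcal{O}$: $$\sigma_{q,Q}(i)=\sum_{J,K\in\binom{[N]}{i}}[DX]_{q,Q,J,K}\,[YD]_{q,Q,K,J}=\sum_{J,K\in\binom{[N]}{i}}[D'Y]_{q,Q,J,K}\,[XD']_{q,Q,K,J}.$$ In particular, with the factors arranged in either of these two orders (all minors expanded into words in the $X_{ab}$ and $Y_{ab}$), every coefficient is, up to sign, a product of integral powers of $q$ and of the $q_{ab}$ (hence, up to sign, an integral power of $q$ when $q_{ab}=q$ for all $a\neq b$), so that no term vanishes when $q\to1$.
   Context: Let $N\ge 1$ be an integer and $[N]=\{1,\dots,N\}$. Let $q$ and $q_{ij}$ ($i,j\in[N]$) be commuting invertible indeterminates subject only to $q_{ii}=1$ and $q_{ij}q_{ji}=q^2$ for $i\neq j$ (so $q$ and the $q_{ij}$ with $i<j$ are independent), and let $F$ be the field of rational functions over $\mathbb{C}$ in them; $Q=(q_{ij})$. With $e_{ij}$ the matrix units of size $N$, put $R=\sum_{i,j=1}^N q_{ij}e_{ii}\otimes e_{jj}+(1-q^2)\sum_{1\le i<j\le N}e_{ij}\otimes e_{ji}$, $\Sigma=\sum_{i,j}e_{ij}\otimes e_{ji}$ and $\hat R=\Sigma R$. For an $N\times N$ matrix $M$ over an $F$-algebra, $M_{0k}=\sum_{i,j}M_{ij}\otimes e_{ij}$ with $e_{ij}$ placed in the $k$-th leg of a tensor power of $M_N(F)$; $R_{12}$ is $R$ in legs 1,2 and $\hat R_{k,k+1}$ is $\hat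 R$ in legs $k,k+1$. $\mathcal{O}=\mathcal{O}_{q,Q}^{\mathbb R}(M_N(\mathbb C))$ is the unital associative $F$-algebra generated by the entries of $X=(X_{ij})$ and $Y=(Y_{ij})$ ($i,j\in[N]$) with relations $R_{12}X_{01}X_{02}=X_{02}X_{01}R_{12}$, $R_{12}Y_{02}Y_{01}=Y_{01}Y_{02}R_{12}$, $X_{01}R_{12}Y_{02}=Y_{02}R_{12}X_{01}$. It carries the involutive anti-automorphism $^*$ (complex conjugation on $\mathbb C$) with $q^*=q$, $q_{ij}^*=q_{ji}$, $X_{ij}^*=Y_{ji}$. For a function $\sigma:I\to\mathbb N$ with $I\subset\mathbb N$ finite, put $(-q)_{\sigma,r}=\prod_{i<j,\ \sigma(i)>\sigma(j)}(-q_{\sigma(i)\sigma(j)})$ and $(-q)_{\sigma,c}=\prod_{i<j,\ \sigma(i)>\sigma(j)}(-q_{\sigma(j)\sigma(i)})$ (products over $i,j\in I$). Coefficients: let $[n]=1+q^2+\dots+q^{2(n-1)}$, $[n]!=[1]\cdots[n]$, $[0]!=1$. Let $u=\sum_{\sigma\in S_N}(-q)_{\sigma,c}\,e_{\sigma(1)}\otimes\dots\otimes e_{\sigma(N)}\in (F^N)^{\otimes N}$ (column vector), $v=u^*$ the row vector $\sum_{\sigma\in S_N}(-q)_{\sigma,r}\,e_{\sigma(1)}^T\otimes\dots\otimes e_{\sigma(N)}^T$, and $\alpha_i=\frac{1}{[N]!}\frac{[N]!}{[i]!\,[N-i]!}$. Then $\sigma_{q,Q}(0)=1$ and for $1\le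 i\le N$ $$\sigma_{q,Q}(i)=q^{-(i-1)i}\alpha_i\,v\,\big((XY)_{01}\hat R_{12}\hat R_{23}\cdots\hat R_{i-1,i}\big)^i u\in\mathcal{O}.$$ Minors: $\binom{[N]}{i}$ is the set of $i$-element subsets $J=\{j_1<\dots<j_i\}$ of $[N]$. For $J,K\in\binom{[N]}{i}$ and $M\in\{X,DX,XD'\}$, $[M]_{q,Q,J,K}=\sum_{\tau:[i]\to K\text{ bijective}}(-q)_{\tau,c}M_{j_1\tau(1)}\cdots M_{j_i\tau(i)}$, with value $1$ for $J=K=\emptyset$. Here $D=\mathrm{diag}(1,q,\dots,q^{N-1})$ and $D'=\mathrm{diag}(q^{N-1},\dots,q,1)$. Also $[Y]_{q,Q,J,K}=[X]_{q,Q,K,J}^*$, $[YD]_{q,Q,J,K}=[DX]_{q,Q,K,J}^*$ and $[D'Y]_{q,Q,J,K}=[XD']_{q,Q,K,J}^*$. *)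

theory Defs
  imports
    Complex_Main
    "HOL-Library.Cardinality"
    "HOL-Library.FuncSet"
    "HOL-Library.Poly_Mapping"
    "HOL-Computational_Algebra.Fraction_Field"
begin

text \<open>
  The index set \<open>[N]\<close> is a finite linearly ordered type \<open>'n\<close> with \<open>N = CARD('n)\<close>.
\<close>

section \<open>Linear extension from a basis\<close>

definition lin_ext :: "('k \<Rightarrow> 'c \<Rightarrow> 'b) \<Rightarrow> ('k \<Rightarrow>\<^sub>0 'c::zero) \<Rightarrow> 'b::comm_monoid_add" where
  "lin_ext h p = (\<Sum>k\<in>Poly_Mapping.keys p. h k (Poly_Mapping.lookup p k))"

lemma lin_ext_zero [simp]: "lin_ext h 0 = 0"
  by (simp add: lin_ext_def)

lemma lin_ext_single:
  assumes "\<And>k. h k 0 = 0"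
  shows "lin_ext h (Poly_Mapping.single k c) = h k c"
  using assms by (cases "c = 0") (auto simp: lin_ext_def)

lemma lin_ext_add:
  fixes p r :: "'k \<Rightarrow>\<^sub>0 'c::monoid_add"
  assumes "\<And>k. h k 0 = 0" and "\<And>k a b. h k (a + b) = h k a + h k b"
  shows "lin_ext h (p + r) = lin_ext h p + lin_ext h r"
  unfolding lin_ext_def using assms by (rule setsum_keys_plus_distrib)

lemma lin_ext_sum:
  fixes f :: "'i \<Rightarrow> 'k \<Rightarrow>\<^sub>0 'c::comm_monoid_add"
  assumes "\<And>k. h k 0 = 0" and "\<And>k a b. h k (a + b) = h k a + h k b"
  shows "lin_ext h (sum f A) = (\<Sum>x\<in>A. lin_ext h (f x))"
  by (induction A rule: infinite_finite_induct) (simp_all add: lin_ext_add[of h, OF assms])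

lemma sum_singles:
  fixes p :: "'k \<Rightarrow>\<^sub>0 'c::comm_monoid_add"
  shows "(\<Sum>k\<in>Poly_Mapping.keys p. Poly_Mapping.single k (Poly_Mapping.lookup p k)) = p"
  by (rule poly_mapping_eqI)
    (simp add: lookup_sum lookup_single when_def in_keys_iff)

lemma mult_singles:
  fixes p r :: "'k::monoid_add \<Rightarrow>\<^sub>0 'c::semiring_0"
  shows "p * r = (\<Sum>k\<in>Poly_Mapping.keys p. \<Sum>l\<in>Poly_Mapping.keys r.
    Poly_Mapping.single (k + l) (Poly_Mapping.lookup p k * Poly_Mapping.lookup r l))"
proof -
  have "p * r = (\<Sum>k\<in>Poly_Mapping.keys p. Poly_Mapping.single k (Poly_Mapping.lookup p k))
    * (\<Sum>k\<in>Poly_Mapping.keys r. Poly_Mapping.single k (Poly_Mapping.lookup r k))"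
    by (simp only: sum_singles)
  then show ?thesis
    by (simp add: sum_product mult_single)
qed

lemma lin_ext_mult:
  fixes p r :: "'k::monoid_add \<Rightarrow>\<^sub>0 'c::semiring_0" and h :: "'k \<Rightarrow> 'c \<Rightarrow> 'b::semiring_0"
  assumes "\<And>k. h k 0 = 0" and "\<And>k a b. h k (a + b) = h k a + h k b"
    and "\<And>k l a b. h (k + l) (a * b) = h k a * h l b"
  shows "lin_ext h (p * r) = lin_ext h p * lin_ext h r"
  unfolding mult_singles[of p r]
  by (simp add: lin_ext_sum[of h, OF assms(1,2)] lin_ext_single[of h, OF assms(1)] assms(3))
    (simp add: lin_ext_def sum_product)

lemma lin_ext_mult_anti:
  fixes p r :: "'k::monoid_add \<Rightarrow>\<^sub>0 'c::semiring_0" and h :: "'k \<Rightarrow> 'c \<Rightarrow> 'b::semiring_0"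
  assumes "\<And>k. h k 0 = 0" and "\<And>k a b. h k (a + b) = h k a + h k b"
    and "\<And>k l a b. h (k + l) (a * b) = h l b * h k a"
  shows "lin_ext h (p * r) = lin_ext h r * lin_ext h p"
proof -
  have "lin_ext h (p * r) = (\<Sum>k\<in>Poly_Mapping.keys p. \<Sum>l\<in>Poly_Mapping.keys r.
      h l (Poly_Mapping.lookup r l) * h k (Poly_Mapping.lookup p k))"
    unfolding mult_singles[of p r]
    by (simp add: lin_ext_sum[of h, OF assms(1,2)] lin_ext_single[of h, OF assms(1)] assms(3))
  also have "\<dots> = lin_ext h r * lin_ext h p"
    unfolding lin_ext_def sum_product by (rule sum.swap)
  finally show ?thesis .
qed

section \<open>The field of rational functions\<close>

text \<open>
  Independent indeterminates: \<open>None\<close> stands for \<open>q\<close> and \<open>Some (i, j)\<close> with \<open>i < j\<close> for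
  \<open>q\<^sub>i\<^sub>j\<close>.
\<close>

typedef (overloaded) ('n::linorder) qvar =
  "{p :: ('n \<times> 'n) option. \<forall>i j. p = Some (i, j) \<longrightarrow> i < j}"
  by (rule exI[of _ None]) simp

definition qvar_q :: "'n::linorder qvar" where
  "qvar_q = Abs_qvar None"

definition qvar_ij :: "'n::linorder \<Rightarrow> 'n \<Rightarrow> 'n qvar" where
  "qvar_ij i j = Abs_qvar (Some (i, j))"

text \<open>The order on indeterminates only serves to obtain integral domains below.\<close>

instantiation qvar :: (linorder) linorder
begin

definition less_eq_qvar :: "'a qvar \<Rightarrow> 'a qvar \<Rightarrow> bool" where
  "less_eq_qvar x y = (case Rep_qvar x of None \<Rightarrow> True
    | Some (a, b) \<Rightarrow> (case Rep_qvar y of None \<Rightarrow> False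
        | Some (c, d) \<Rightarrow> a < c \<or> (a = c \<and> b \<le> d)))"

definition less_qvar :: "'a qvar \<Rightarrow> 'a qvar \<Rightarrow> bool" where
  "less_qvar x y \<longleftrightarrow> x \<le> y \<and> \<not> y \<le> x"

instance
proof
  fix x y z :: "'a qvar"
  show "x < y \<longleftrightarrow> x \<le> y \<and> \<not> y \<le> x" by (rule less_qvar_def)
  show "x \<le> x" by (auto simp: less_eq_qvar_def split: option.splits)
  show "x \<le> z" if "x \<le> y" "y \<le> z"
    using that by (auto simp: less_eq_qvar_def split: option.splits prod.splits)
  show "x = y" if "x \<le> y" "y \<le> x"
    using that
    by (auto simp: less_eq_qvar_def Rep_qvar_inject[symmetric] split: option.splits prod.splits)
  show "x \<le> y \<or> y \<le> x"
    by (auto simp: less_eq_qvar_def split: option.splits prod.splits)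
qed

end

instance qvar :: ("{finite, linorder}") finite
proof
  have "finite (range (Rep_qvar :: 'a qvar \<Rightarrow> _))" by simp
  then show "finite (UNIV :: 'a qvar set)"
    by (rule finite_imageD) (simp add: Rep_qvar_inject inj_on_def)
qed

text \<open>
  A Laurent polynomial is a finitely supported function on exponent vectors in
  \<open>'n qvar \<Rightarrow>\<^sub>0 int\<close>; the fraction field of the ring of Laurent polynomials is the field of
  rational functions.
\<close>

type_synonym 'n laurent = "('n qvar \<Rightarrow>\<^sub>0 int) \<Rightarrow>\<^sub>0 complex"

type_synonym 'n ratfun = "'n laurent fract"

definition rf_const :: "complex \<Rightarrow> 'n::{finite,linorder} ratfun" where
  "rf_const c = Fract (Poly_Mapping.single 0 c) 1"

definition rf_var :: "'n::{finite,linorder} qvar \<Rightarrow> 'n ratfun" where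
  "rf_var x = Fract (Poly_Mapping.single (frag_of x) 1) 1"

definition qq :: "'n::{finite,linorder} ratfun" where
  "qq = rf_var qvar_q"

definition qij :: "'n::{finite,linorder} \<Rightarrow> 'n \<Rightarrow> 'n ratfun" where
  "qij i j = (if i = j then 1 else if i < j then rf_var (qvar_ij i j)
    else qq ^ 2 / rf_var (qvar_ij j i))"

subsection \<open>Involution\<close>

text \<open>On exponents: \<open>q\<close> is fixed and \<open>q\<^sub>i\<^sub>j\<close> goes to \<open>q\<^sup>2 q\<^sub>i\<^sub>j\<^sup>-\<^sup>1\<close>.\<close>

definition exp_star :: "('n::linorder qvar \<Rightarrow>\<^sub>0 int) \<Rightarrow> ('n qvar \<Rightarrow>\<^sub>0 int)" where
  "exp_star = frag_extend (\<lambda>x. if x = qvar_q then frag_of qvar_q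
    else frag_cmul 2 (frag_of qvar_q) - frag_of x)"

definition laurent_star :: "'n::{finite,linorder} laurent \<Rightarrow> 'n laurent" where
  "laurent_star = lin_ext (\<lambda>m c. Poly_Mapping.single (exp_star m) (cnj c))"

lemma exp_star_zero [simp]: "exp_star 0 = 0"
  by (simp add: exp_star_def)

lemma exp_star_add: "exp_star (m + k) = exp_star m + exp_star k"
  by (simp add: exp_star_def frag_extend_add)

lemma exp_star_exp_star [simp]: "exp_star (exp_star m) = m"
proof -
  let ?g = "\<lambda>x::'a qvar. if x = qvar_q then frag_of qvar_q
    else frag_cmul 2 (frag_of qvar_q) - frag_of x"
  have add: "frag_extend ?g (a - b) = frag_extend ?g a - frag_extend ?g b" for a b
    by (rule frag_extend_diff)
  show ?thesis
    unfolding exp_star_def using subset_UNIV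
  proof (induction m rule: frag_induction)
    case (one x)
    show ?case
      by (simp only: frag_extend_of) (simp add: add frag_extend_cmul)
  next
    case (diff a b)
    then show ?case by (simp only: add)
  qed simp
qed

lemma laurent_star_single [simp]:
  "laurent_star (Poly_Mapping.single m c) = Poly_Mapping.single (exp_star m) (cnj c)"
  unfolding laurent_star_def by (rule lin_ext_single) simp

lemma laurent_star_zero [simp]: "laurent_star 0 = 0"
  by (simp add: laurent_star_def)

lemma laurent_star_add: "laurent_star (a + b) = laurent_star a + laurent_star b"
  unfolding laurent_star_def by (rule lin_ext_add) (simp_all add: single_add)

lemma laurent_star_mult: "laurent_star (a * b) = laurent_star a * laurent_star b"
  unfolding laurent_star_def
  by (rule lin_ext_mult) (simp_all add: single_add mult_single exp_star_add)

lemma laurent_star_one [simp]: "laurent_star 1 = 1"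
proof -
  have "laurent_star (Poly_Mapping.single 0 1) = Poly_Mapping.single 0 1"
    unfolding laurent_star_single by simp
  then show ?thesis by simp
qed

lemma laurent_star_laurent_star [simp]:
  fixes a :: "'n::{finite,linorder} laurent"
  shows "laurent_star (laurent_star a) = a"
proof -
  have "laurent_star (sum f A) = (\<Sum>x\<in>A. laurent_star (f x))" for f :: "'x \<Rightarrow> 'n laurent" and A
    unfolding laurent_star_def by (rule lin_ext_sum) (simp_all add: single_add)
  note laurent_star_sum = this
  have "laurent_star (laurent_star (\<Sum>k\<in>Poly_Mapping.keys a.
      Poly_Mapping.single k (Poly_Mapping.lookup a k))) = a"
    unfolding laurent_star_sum laurent_star_single by (simp add: sum_singles)
  then show ?thesis by (simp add: sum_singles)
qed

lemma laurent_star_eq_0_iff [simp]: "laurent_star a = 0 \<longleftrightarrow> a = 0"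
  by (metis laurent_star_laurent_star laurent_star_zero)

lift_definition rf_star :: "'n::{finite,linorder} ratfun \<Rightarrow> 'n ratfun"
  is "\<lambda>(a, b). (laurent_star a, laurent_star b)"
  by (auto simp flip: laurent_star_mult)

lemma rf_star_Fract: "rf_star (Fract a b) = Fract (laurent_star a) (laurent_star b)"
  by transfer (auto split: if_splits)

lemma rf_star_0 [simp]: "rf_star 0 = 0" and rf_star_1 [simp]: "rf_star 1 = 1"
  by (simp_all add: Zero_fract_def One_fract_def rf_star_Fract)

lemma rf_star_add: "rf_star (a + b) = rf_star a + rf_star b"
  by (cases a; cases b) (simp add: rf_star_Fract laurent_star_add laurent_star_mult)

lemma rf_star_mult: "rf_star (a * b) = rf_star a * rf_star b"
  by (cases a; cases b) (simp add: rf_star_Fract laurent_star_mult)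

lemma rf_star_rf_star [simp]: "rf_star (rf_star a) = a"
  by (cases a) (simp add: rf_star_Fract)

lemma rf_star_minus: "rf_star (- a) = - rf_star a"
  using rf_star_add[of a "- a"] by (simp add: eq_neg_iff_add_eq_0 add.commute)

lemma rf_star_diff: "rf_star (a - b) = rf_star a - rf_star b"
  using rf_star_add[of a "- b"] by (simp add: rf_star_minus)

lemma rf_star_const: "rf_star (rf_const c) = rf_const (cnj c)"
  by (simp add: rf_const_def rf_star_Fract)

lemma rf_star_qq [simp]: "rf_star qq = qq"
  by (simp add: qq_def rf_var_def rf_star_Fract exp_star_def)

lemma rf_var_nonzero [simp]: "rf_var x \<noteq> 0"
  by (simp add: rf_var_def Zero_fract_def eq_fract) (metis lookup_single_eq lookup_zero one_neq_zero)

lemma rf_star_var: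
  assumes "x \<noteq> qvar_q"
  shows "rf_star (rf_var x) = qq ^ 2 / rf_var x"
proof -
  have "rf_star (rf_var x) * rf_var x = qq ^ 2"
    using assms
    by (simp add: qq_def rf_var_def rf_star_Fract exp_star_def power2_eq_square mult_single)
      (metis (no_types) frag_cmul_one frag_cmul_distrib one_add_one)
  then show ?thesis by (simp add: field_simps)
qed

lemma qvar_ij_neq_q: "i < j \<Longrightarrow> qvar_ij i j \<noteq> qvar_q"
  by (simp add: qvar_ij_def qvar_q_def Abs_qvar_inject)

lemma qq_nonzero [simp]: "qq \<noteq> 0"
  by (simp add: qq_def)

lemma qij_mult_qij: "i \<noteq> j \<Longrightarrow> qij i j * qij j i = qq ^ 2"
  by (auto simp: qij_def)

lemma qij_nonzero [simp]: "qij i j \<noteq> 0"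
  by (auto simp: qij_def)

lemma rf_star_qij: "rf_star (qij i j) = qij j i"
proof -
  have *: "rf_star (qij i j) = qij j i" if "i < j" for i j :: 'a
    using that rf_star_var[OF qvar_ij_neq_q[OF that]] by (auto simp: qij_def)
  consider "i = j" | "i < j" | "j < i" by (rule linorder_cases)
  then show ?thesis
  proof cases
    case 1
    then show ?thesis by (simp add: qij_def)
  next
    case 2
    then show ?thesis by (rule *)
  next
    case 3
    then show ?thesis using *[OF 3] rf_star_rf_star[of "qij j i"] by simp
  qed
qed

subsection \<open>Specialisation\<close>

text \<open>
  Substitution of values \<open>\<rho>\<close> for the indeterminates, with \<open>h\<close> applied to the complex
  coefficients.  The value of a rational function is unspecified unless it can be written with
  a denominator that does not vanish under the substitution.
\<close>

definition laurent_eval ::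
    "(complex \<Rightarrow> 'b::field) \<Rightarrow> ('n::{finite,linorder} qvar \<Rightarrow> 'b) \<Rightarrow> 'n laurent \<Rightarrow> 'b" where
  "laurent_eval h \<rho> =
    lin_ext (\<lambda>m c. h c * (\<Prod>x\<in>UNIV. \<rho> x powi Poly_Mapping.lookup m x))"

definition rf_subst ::
    "(complex \<Rightarrow> 'b::field) \<Rightarrow> ('n::{finite,linorder} qvar \<Rightarrow> 'b) \<Rightarrow> 'n ratfun \<Rightarrow> 'b" where
  "rf_subst h \<rho> f = (THE y. \<exists>a b. f = Fract a b \<and> laurent_eval h \<rho> b \<noteq> 0
    \<and> y = laurent_eval h \<rho> a / laurent_eval h \<rho> b)"

lemma rf_subst_Fract:
  assumes h: "h 0 = 0" "\<And>a b. h (a + b) = h a + h b" "\<And>a b. h (a * b) = h a * h b"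
    and \<rho>: "\<And>x. \<rho> x \<noteq> 0" and b: "laurent_eval h \<rho> b \<noteq> 0"
  shows "rf_subst h \<rho> (Fract a b) = laurent_eval h \<rho> a / laurent_eval h \<rho> b"
proof -
  have mult: "laurent_eval h \<rho> (c * d) = laurent_eval h \<rho> c * laurent_eval h \<rho> d" for c d
    unfolding laurent_eval_def
    by (rule lin_ext_mult)
      (simp_all add: h \<rho> algebra_simps lookup_add power_int_add prod.distrib)
  have nz: "d \<noteq> 0" if "laurent_eval h \<rho> d \<noteq> 0" for d
    using that by (auto simp: laurent_eval_def)
  show ?thesis
    unfolding rf_subst_def
  proof (rule the_equality)
    show "\<exists>a' b'. Fract a b = Fract a' b' \<and> laurent_eval h \<rho> b' \<noteq> 0
        \<and> laurent_eval h \<rho> a / laurent_eval h \<rho> b = laurent_eval h \<rho> a' / laurent_eval h \<rho> b'"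
      using b by blast
  next
    fix y
    assume "\<exists>a' b'. Fract a b = Fract a' b' \<and> laurent_eval h \<rho> b' \<noteq> 0
        \<and> y = laurent_eval h \<rho> a' / laurent_eval h \<rho> b'"
    then obtain a' b' where *: "Fract a b = Fract a' b'" "laurent_eval h \<rho> b' \<noteq> 0"
      and y: "y = laurent_eval h \<rho> a' / laurent_eval h \<rho> b'" by blast
    have "a * b' = a' * b"
      using * nz b by (simp add: eq_fract)
    then have "laurent_eval h \<rho> a * laurent_eval h \<rho> b' = laurent_eval h \<rho> a' * laurent_eval h \<rho> b"
      by (metis mult)
    then show "y = laurent_eval h \<rho> a / laurent_eval h \<rho> b"
      using y b *(2) by (simp add: frac_eq_eq)
  qed
qed

section \<open>The free algebra\<close>

datatype 'a fmon = FMon (letters: "'a list")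

instantiation fmon :: (type) monoid_add
begin

definition zero_fmon :: "'a fmon" where
  "zero_fmon = FMon []"

definition plus_fmon :: "'a fmon \<Rightarrow> 'a fmon \<Rightarrow> 'a fmon" where
  "plus_fmon v w = FMon (letters v @ letters w)"

instance
  by standard (simp_all add: zero_fmon_def plus_fmon_def)

end

datatype 'n gen = GX 'n 'n | GY 'n 'n

fun gen_star :: "'n gen \<Rightarrow> 'n gen" where
  "gen_star (GX i j) = GY j i"
| "gen_star (GY i j) = GX j i"

lemma gen_star_gen_star [simp]: "gen_star (gen_star g) = g"
  by (cases g) auto

type_synonym 'n free = "'n gen fmon \<Rightarrow>\<^sub>0 'n ratfun"

definition free_scal :: "'n::{finite,linorder} ratfun \<Rightarrow> 'n free" where
  "free_scal c = Poly_Mapping.single 0 c"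

definition free_X :: "'n::{finite,linorder} \<Rightarrow> 'n \<Rightarrow> 'n free" where
  "free_X i j = Poly_Mapping.single (FMon [GX i j]) 1"

definition free_Y :: "'n::{finite,linorder} \<Rightarrow> 'n \<Rightarrow> 'n free" where
  "free_Y i j = Poly_Mapping.single (FMon [GY i j]) 1"

definition free_star :: "'n::{finite,linorder} free \<Rightarrow> 'n free" where
  "free_star = lin_ext (\<lambda>w c.
    Poly_Mapping.single (FMon (rev (map gen_star (letters w)))) (rf_star c))"

lemma free_star_single [simp]: "free_star (Poly_Mapping.single w c) =
    Poly_Mapping.single (FMon (rev (map gen_star (letters w)))) (rf_star c)"
  unfolding free_star_def by (rule lin_ext_single) simp

lemma free_star_0 [simp]: "free_star 0 = 0"
  by (simp add: free_star_def)

lemma free_star_add: "free_star (a + b) = free_star a + free_star b"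
  unfolding free_star_def by (rule lin_ext_add) (simp_all add: single_add rf_star_add)

lemma free_star_minus: "free_star (- a) = - free_star a"
  using free_star_add[of a "- a"] by (simp add: eq_neg_iff_add_eq_0 add.commute)

lemma free_star_diff: "free_star (a - b) = free_star a - free_star b"
  using free_star_add[of a "- b"] by (simp add: free_star_minus)

lemma free_star_sum: "free_star (sum f A) = (\<Sum>x\<in>A. free_star (f x))"
  unfolding free_star_def by (rule lin_ext_sum) (simp_all add: single_add rf_star_add)

lemma free_star_mult: "free_star (a * b) = free_star b * free_star a"
  unfolding free_star_def
  by (rule lin_ext_mult_anti)
    (simp_all add: single_add mult_single rf_star_add rf_star_mult plus_fmon_def mult.commute)

lemma free_star_free_star [simp]: "free_star (free_star a) = a"
proof -
  have "free_star (free_star (\<Sum>k\<in>Poly_Mapping.keys a.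
      Poly_Mapping.single k (Poly_Mapping.lookup a k))) = a"
    unfolding free_star_sum free_star_single by (simp add: rev_map comp_def sum_singles)
  then show ?thesis by (simp add: sum_singles)
qed

lemma free_star_scal: "free_star (free_scal c) = free_scal (rf_star c)"
  by (simp add: free_scal_def zero_fmon_def)

lemma free_star_X: "free_star (free_X i j) = free_Y j i"
  and free_star_Y: "free_star (free_Y i j) = free_X j i"
  by (simp_all add: free_X_def free_Y_def)

section \<open>Matrices on tensor powers\<close>

text \<open>
  A matrix acting on the \<open>n\<close>-th tensor power is a function of two lists of length \<open>n\<close>, its row
  and column multi-indices.  Legs are numbered from 1, list positions from 0.
\<close>

type_synonym ('n, 'a) tmat = "'n list \<Rightarrow> 'n list \<Rightarrow> 'a"

definition tmul :: "nat \<Rightarrow> ('n::finite, 'a::semiring_0) tmat \<Rightarrow> ('n, 'a) tmat \<Rightarrow> ('n, 'a) tmat" where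
  "tmul n A B = (\<lambda>u w. \<Sum>v | length v = n. A u v * B v w)"

definition tone :: "('n, 'a::zero_neq_one) tmat" where
  "tone = (\<lambda>u w. if u = w then 1 else 0)"

definition tpow :: "nat \<Rightarrow> nat \<Rightarrow> ('n::finite, 'a::semiring_1) tmat \<Rightarrow> ('n, 'a) tmat" where
  "tpow n k A = (tmul n A ^^ k) tone"

definition leg :: "nat \<Rightarrow> ('n \<Rightarrow> 'n \<Rightarrow> 'a::zero) \<Rightarrow> ('n, 'a) tmat" where
  "leg k M = (\<lambda>u w. if \<forall>l < length u. l \<noteq> k - 1 \<longrightarrow> u ! l = w ! l
    then M (u ! (k - 1)) (w ! (k - 1)) else 0)"

definition leg2 :: "nat \<Rightarrow> ('n, 'a::zero) tmat \<Rightarrow> ('n, 'a) tmat" where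
  "leg2 k T = (\<lambda>u w. if \<forall>l < length u. l \<noteq> k - 1 \<and> l \<noteq> k \<longrightarrow> u ! l = w ! l
    then T [u ! (k - 1), u ! k] [w ! (k - 1), w ! k] else 0)"

text \<open>\<open>unit2 i j k l\<close> is \<open>e\<^sub>i\<^sub>j \<otimes> e\<^sub>k\<^sub>l\<close>.\<close>

definition unit2 :: "'n \<Rightarrow> 'n \<Rightarrow> 'n \<Rightarrow> 'n \<Rightarrow> ('n, 'a::zero_neq_one) tmat" where
  "unit2 i j k l = (\<lambda>u w. if u = [i, k] \<and> w = [j, l] then 1 else 0)"

definition Rmat :: "('n::{finite,linorder}, 'n ratfun) tmat" where
  "Rmat = (\<lambda>u w. (\<Sum>i\<in>UNIV. \<Sum>j\<in>UNIV. qij i j * unit2 i i j j u w)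
    + (1 - qq ^ 2) * (\<Sum>(i, j) | i < j. unit2 i j j i u w))"

definition flip_mat :: "('n::{finite,linorder}, 'n ratfun) tmat" where
  "flip_mat = (\<lambda>u w. \<Sum>i\<in>UNIV. \<Sum>j\<in>UNIV. unit2 i j j i u w)"

definition Rhat :: "('n::{finite,linorder}, 'n ratfun) tmat" where
  "Rhat = tmul 2 flip_mat Rmat"

definition tmap :: "('b \<Rightarrow> 'a) \<Rightarrow> ('n, 'b) tmat \<Rightarrow> ('n, 'a) tmat" where
  "tmap f A = (\<lambda>u w. f (A u w))"

lemma finite_lists_length [simp]: "finite {v :: 'n::finite list. length v = n}"
  using finite_lists_length_eq[of "UNIV :: 'n set" n] by simp

lemma tmul_assoc: "tmul n (tmul n A B) C = tmul n A (tmul n B C)"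
proof (intro ext)
  fix u w
  show "tmul n (tmul n A B) C u w = tmul n A (tmul n B C) u w"
    unfolding tmul_def
    by (simp add: sum_distrib_left sum_distrib_right mult.assoc) (rule sum.swap)
qed

lemma tmul_rev: "tmul n A B (rev u) (rev w) =
    tmul n (\<lambda>u w. A (rev u) (rev w)) (\<lambda>u w. B (rev u) (rev w)) u w"
  unfolding tmul_def
  by (rule sum.reindex_bij_witness[of _ rev rev]) auto

lemma tmul_cong:
  assumes "\<And>v. length v = n \<Longrightarrow> A u v = A' u v" "\<And>v. length v = n \<Longrightarrow> B v w = B' v w"
  shows "tmul n A B u w = tmul n A' B' u w"
  unfolding tmul_def using assms by simp

lemma Rmat_entry: "Rmat [a, b] [c, d] = (if a = c \<and> b = d then qij a b else 0)
    + (if a < b \<and> c = b \<and> d = a then 1 - qq ^ 2 else 0)"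
proof -
  have 1: "(\<Sum>i\<in>UNIV. \<Sum>j\<in>UNIV. qij i j * unit2 i i j j [a, b] [c, d])
      = (\<Sum>i\<in>UNIV. \<Sum>j\<in>UNIV. if i = a then if j = b then
          (if a = c \<and> b = d then qij a b else 0) else 0 else 0)"
    by (intro sum.cong) (auto simp: unit2_def)
  have "(\<Sum>j\<in>UNIV. if i = a then if j = b then z else 0 else 0) = (if i = a then z else 0)"
    for i and z :: "'a ratfun"
    by simp
  note 2 = 1[unfolded this]
  have 3: "(\<Sum>(i, j) | i < j. unit2 i j j i [a, b] [c, d]) =
      (\<Sum>p | fst p < snd p. if p = (a, b) then (if c = b \<and> d = a then 1 else 0) else 0 :: 'a ratfun)"
    by (rule sum.cong) (auto simp: unit2_def split: if_splits)
  show ?thesis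
    unfolding Rmat_def 2 3 by simp
qed

section \<open>The algebra\<close>

text \<open>
  The entries of the three defining matrix relations, for matrices \<open>X\<close> and \<open>Y\<close> over an algebra
  with scalars embedded by \<open>sc\<close>.
\<close>

definition rel_XX :: "('n::{finite,linorder} ratfun \<Rightarrow> 'a::ring_1) \<Rightarrow> ('n \<Rightarrow> 'n \<Rightarrow> 'a) \<Rightarrow> ('n, 'a) tmat" where
  "rel_XX sc X = (\<lambda>u w. tmul 2 (tmul 2 (tmap sc Rmat) (leg 1 X)) (leg 2 X) u w
    - tmul 2 (tmul 2 (leg 2 X) (leg 1 X)) (tmap sc Rmat) u w)"

definition rel_YY :: "('n::{finite,linorder} ratfun \<Rightarrow> 'a::ring_1) \<Rightarrow> ('n \<Rightarrow> 'n \<Rightarrow> 'a) \<Rightarrow> ('n, 'a) tmat" where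
  "rel_YY sc Y = (\<lambda>u w. tmul 2 (tmul 2 (tmap sc Rmat) (leg 2 Y)) (leg 1 Y) u w
    - tmul 2 (tmul 2 (leg 1 Y) (leg 2 Y)) (tmap sc Rmat) u w)"

definition rel_XY :: "('n::{finite,linorder} ratfun \<Rightarrow> 'a::ring_1) \<Rightarrow> ('n \<Rightarrow> 'n \<Rightarrow> 'a) \<Rightarrow> ('n \<Rightarrow> 'n \<Rightarrow> 'a)
    \<Rightarrow> ('n, 'a) tmat" where
  "rel_XY sc X Y = (\<lambda>u w. tmul 2 (tmul 2 (leg 1 X) (tmap sc Rmat)) (leg 2 Y) u w
    - tmul 2 (tmul 2 (leg 2 Y) (tmap sc Rmat)) (leg 1 X) u w)"

inductive_set rel_ideal :: "'n::{finite,linorder} free set" where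
  zero: "0 \<in> rel_ideal"
| add: "a \<in> rel_ideal \<Longrightarrow> b \<in> rel_ideal \<Longrightarrow> a + b \<in> rel_ideal"
| XX: "length u = 2 \<Longrightarrow> length w = 2 \<Longrightarrow> a * rel_XX free_scal free_X u w * b \<in> rel_ideal"
| YY: "length u = 2 \<Longrightarrow> length w = 2 \<Longrightarrow> a * rel_YY free_scal free_Y u w * b \<in> rel_ideal"
| XY: "length u = 2 \<Longrightarrow> length w = 2 \<Longrightarrow> a * rel_XY free_scal free_X free_Y u w * b \<in> rel_ideal"

lemma rel_ideal_lmult: "a \<in> rel_ideal \<Longrightarrow> c * a \<in> rel_ideal"
  by (induction rule: rel_ideal.induct)
    (auto simp: distrib_left mult.assoc[symmetric] intro: rel_ideal.intros)

lemma rel_ideal_rmult: "a \<in> rel_ideal \<Longrightarrow> a * c \<in> rel_ideal"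
proof (induction rule: rel_ideal.induct)
  case (XX u w a b)
  then show ?case using rel_ideal.XX[of u w a "b * c"] by (simp add: mult.assoc)
next
  case (YY u w a b)
  then show ?case using rel_ideal.YY[of u w a "b * c"] by (simp add: mult.assoc)
next
  case (XY u w a b)
  then show ?case using rel_ideal.XY[of u w a "b * c"] by (simp add: mult.assoc)
qed (auto simp: distrib_right intro: rel_ideal.intros)

lemma rel_ideal_minus: "a \<in> rel_ideal \<Longrightarrow> - a \<in> rel_ideal"
  using rel_ideal_lmult[of a "- 1"] by simp

lemma rel_ideal_diff: "a \<in> rel_ideal \<Longrightarrow> b \<in> rel_ideal \<Longrightarrow> a - b \<in> rel_ideal"
  using rel_ideal.add[of a "- b"] rel_ideal_minus[of b] by simp

subsection \<open>Stability of the ideal under the involution\<close>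

lemma length_2_cases:
  assumes "length u = 2"
  obtains a b where "u = [a, b]"
  using assms by (auto simp: numeral_2_eq_2 length_Suc_conv)

lemma leg_12_entry:
  "leg (Suc 0) M [a, b] [c, d] = (if b = d then M a c else 0)"
  "leg 2 M [a, b] [c, d] = (if a = c then M b d else 0)"
  by (auto simp: leg_def less_Suc_eq numeral_2_eq_2)

lemma free_star_tmul3:
  fixes A A' B B' C C' :: "('n::{finite,linorder}, 'n free) tmat"
  assumes A: "\<And>u w. length u = 2 \<Longrightarrow> length w = 2 \<Longrightarrow> free_star (A (rev w) (rev u)) = A' u w"
    and B: "\<And>u w. length u = 2 \<Longrightarrow> length w = 2 \<Longrightarrow> free_star (B (rev w) (rev u)) = B' u w"
    and C: "\<And>u w. length u = 2 \<Longrightarrow> length w = 2 \<Longrightarrow> free_star (C (rev w) (rev u)) = C' u w"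
    and uw: "length u = 2" "length w = 2"
  shows "free_star (tmul 2 (tmul 2 A B) C u w) = tmul 2 (tmul 2 C' B') A' (rev w) (rev u)"
proof -
  have eq: "free_star (tmul 2 D E (rev w) (rev u)) = tmul 2 E' D' u w"
    if "\<And>u w. length u = 2 \<Longrightarrow> length w = 2 \<Longrightarrow> free_star (D (rev w) (rev u)) = D' u w"
      "\<And>u w. length u = 2 \<Longrightarrow> length w = 2 \<Longrightarrow> free_star (E (rev w) (rev u)) = E' u w"
      "length u = 2" "length w = 2" for D D' E E' :: "('n, 'n free) tmat" and u w
  proof -
    have "free_star (tmul 2 D E (rev w) (rev u)) =
        (\<Sum>v | length v = 2. free_star (E (rev v) (rev u)) * free_star (D (rev w) (rev v)))"
      unfolding tmul_rev by (simp add: tmul_def free_star_sum free_star_mult)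
    also have "\<dots> = tmul 2 E' D' u w"
      unfolding tmul_def
      by (rule sum.cong[OF refl]) (simp only: mem_Collect_eq that)
    finally show ?thesis .
  qed
  have "free_star (tmul 2 (tmul 2 A B) C (rev (rev u)) (rev (rev w))) =
      tmul 2 C' (tmul 2 B' A') (rev w) (rev u)"
  proof (rule eq[where D = "tmul 2 A B" and E = C])
    show "free_star (tmul 2 A B (rev w) (rev u)) = tmul 2 B' A' u w"
      if "length u = 2" "length w = 2" for u w
      by (rule eq[where D = A and D' = A' and E = B and E' = B', OF A B that])
    show "free_star (C (rev w) (rev u)) = C' u w"
      if "length u = 2" "length w = 2" for u w
      by (rule C[OF that])
    show "length (rev w) = 2" "length (rev u) = 2"
      using uw by simp_all
  qed
  then show ?thesis unfolding rev_rev_ident tmul_assoc .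
qed

lemma free_star_Rmat:
  fixes u w :: "'a::{finite,linorder} list"
  assumes "length u = 2" "length w = 2"
  shows "free_star (tmap free_scal Rmat (rev w) (rev u)) = tmap free_scal Rmat u w"
proof -
  obtain a b c d where "u = [a, b]" "w = [c, d]"
    using assms length_2_cases by metis
  moreover have "rf_star (Rmat [d, c] [b, a]) = Rmat [a, b] [c, d]"
  proof -
    have "rf_star (1 - qq ^ 2) = (1 - qq ^ 2 :: 'a ratfun)"
      by (simp only: rf_star_diff rf_star_1 power2_eq_square rf_star_mult rf_star_qq)
    moreover have "rf_star (if P then x else 0) = (if P then rf_star x else 0)" for P and x :: "'a ratfun"
      by simp
    ultimately show ?thesis
      unfolding Rmat_entry rf_star_add by (intro arg_cong2[where f = "(+)"]) (auto simp: rf_star_qij)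
  qed
  ultimately show ?thesis
    by (simp add: tmap_def free_star_scal)
qed

lemma free_star_leg:
  assumes "\<And>i j. free_star (M i j) = M' j i" and "length u = 2" "length w = 2"
  shows "free_star (leg 1 M (rev w) (rev u)) = leg 2 M' u w"
    and "free_star (leg 2 M (rev w) (rev u)) = leg 1 M' u w"
proof -
  obtain a b c d where "u = [a, b]" "w = [c, d]"
    using assms length_2_cases by metis
  then show "free_star (leg 1 M (rev w) (rev u)) = leg 2 M' u w"
    and "free_star (leg 2 M (rev w) (rev u)) = leg 1 M' u w"
    by (auto simp: leg_12_entry assms(1))
qed

lemma free_star_rel:
  fixes u w :: "'n::{finite,linorder} list"
  assumes "length u = 2" "length w = 2"
  shows "free_star (rel_XX free_scal free_X u w) = - rel_YY free_scal free_Y (rev w) (rev u)"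
    and "free_star (rel_YY free_scal free_Y u w) = - rel_XX free_scal free_X (rev w) (rev u)"
    and "free_star (rel_XY free_scal free_X free_Y u w) = rel_XY free_scal free_X free_Y (rev w) (rev u)"
proof -
  note legX = free_star_leg[of free_X free_Y, OF free_star_X]
  note legY = free_star_leg[of free_Y free_X, OF free_star_Y]
  note facts = legX legY free_star_Rmat
  let ?R = "tmap free_scal Rmat :: ('n, 'n free) tmat"
  have "free_star (tmul 2 (tmul 2 ?R (leg 1 free_X)) (leg 2 free_X) u w)
      = tmul 2 (tmul 2 (leg 1 free_Y) (leg 2 free_Y)) ?R (rev w) (rev u)"
    by (rule free_star_tmul3; (rule facts, assumption, assumption | rule assms))
  moreover have "free_star (tmul 2 (tmul 2 (leg 2 free_X) (leg 1 free_X)) ?R u w)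
      = tmul 2 (tmul 2 ?R (leg 2 free_Y)) (leg 1 free_Y) (rev w) (rev u)"
    by (rule free_star_tmul3; (rule facts, assumption, assumption | rule assms))
  ultimately show "free_star (rel_XX free_scal free_X u w) = - rel_YY free_scal free_Y (rev w) (rev u)"
    by (simp add: rel_XX_def rel_YY_def free_star_diff)
  have "free_star (tmul 2 (tmul 2 ?R (leg 2 free_Y)) (leg 1 free_Y) u w)
      = tmul 2 (tmul 2 (leg 2 free_X) (leg 1 free_X)) ?R (rev w) (rev u)"
    by (rule free_star_tmul3; (rule facts, assumption, assumption | rule assms))
  moreover have "free_star (tmul 2 (tmul 2 (leg 1 free_Y) (leg 2 free_Y)) ?R u w)
      = tmul 2 (tmul 2 ?R (leg 1 free_X)) (leg 2 free_X) (rev w) (rev u)"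
    by (rule free_star_tmul3; (rule facts, assumption, assumption | rule assms))
  ultimately show "free_star (rel_YY free_scal free_Y u w) = - rel_XX free_scal free_X (rev w) (rev u)"
    by (simp add: rel_XX_def rel_YY_def free_star_diff)
  have "free_star (tmul 2 (tmul 2 (leg 1 free_X) ?R) (leg 2 free_Y) u w)
      = tmul 2 (tmul 2 (leg 1 free_X) ?R) (leg 2 free_Y) (rev w) (rev u)"
    by (rule free_star_tmul3; (rule facts, assumption, assumption | rule assms))
  moreover have "free_star (tmul 2 (tmul 2 (leg 2 free_Y) ?R) (leg 1 free_X) u w)
      = tmul 2 (tmul 2 (leg 2 free_Y) ?R) (leg 1 free_X) (rev w) (rev u)"
    by (rule free_star_tmul3; (rule facts, assumption, assumption | rule assms))
  ultimately show "free_star (rel_XY free_scal free_X free_Y u w)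
      = rel_XY free_scal free_X free_Y (rev w) (rev u)"
    by (simp add: rel_XY_def free_star_diff)
qed

lemma rel_ideal_star: "a \<in> rel_ideal \<Longrightarrow> free_star a \<in> rel_ideal"
proof (induction rule: rel_ideal.induct)
  case (XX u w a b)
  then show ?case
    using rel_ideal_minus[OF rel_ideal.YY[of "rev w" "rev u" "free_star b" "free_star a"]]
    by (simp add: free_star_mult free_star_rel mult.assoc)
next
  case (YY u w a b)
  then show ?case
    using rel_ideal_minus[OF rel_ideal.XX[of "rev w" "rev u" "free_star b" "free_star a"]]
    by (simp add: free_star_mult free_star_rel mult.assoc)
next
  case (XY u w a b)
  then show ?case
    using rel_ideal.XY[of "rev w" "rev u" "free_star b" "free_star a"]
    by (simp add: free_star_mult free_star_rel mult.assoc)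
qed (simp_all add: free_star_add rel_ideal.zero rel_ideal.add)

subsection \<open>The quotient\<close>

quotient_type (overloaded) 'n qalg = "'n::{finite,linorder} free" / "\<lambda>a b. a - b \<in> rel_ideal"
proof (rule equivpI)
  show "reflp (\<lambda>a b. a - b \<in> (rel_ideal :: 'n free set))"
    by (rule reflpI) (simp add: rel_ideal.zero)
  show "symp (\<lambda>a b. a - b \<in> (rel_ideal :: 'n free set))"
    by (rule sympI) (metis minus_diff_eq rel_ideal_minus)
  show "transp (\<lambda>a b. a - b \<in> (rel_ideal :: 'n free set))"
  proof (rule transpI)
    fix a b c :: "'n free"
    assume "a - b \<in> rel_ideal" "b - c \<in> rel_ideal"
    then show "a - c \<in> rel_ideal"
      using rel_ideal.add[of "a - b" "b - c"] by simp
  qed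
qed

text \<open>The ideal is proper: its elements have constant term zero.\<close>

lemma lookup_mult_zero:
  "Poly_Mapping.lookup (a * b) 0 = Poly_Mapping.lookup a 0 * Poly_Mapping.lookup (b :: 'n::{finite,linorder} free) 0"
proof -
  let ?h = "\<lambda>(w :: 'n gen fmon) (c :: 'n ratfun). if w = 0 then c else 0"
  have zero_iff: "v + w = 0 \<longleftrightarrow> v = 0 \<and> w = 0" for v w :: "'n gen fmon"
    by (cases v; cases w) (simp add: plus_fmon_def zero_fmon_def)
  have eq: "Poly_Mapping.lookup p 0 = lin_ext ?h p" for p
    by (simp add: lin_ext_def in_keys_iff)
  show ?thesis
    unfolding eq by (rule lin_ext_mult) (auto simp: zero_iff)
qed

lemma lookup_leg_zero:
  "Poly_Mapping.lookup (leg k free_X u w) 0 = 0" "Poly_Mapping.lookup (leg k free_Y u w) 0 = 0"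
  by (simp_all add: leg_def free_X_def free_Y_def lookup_single zero_fmon_def)

lemma rel_ideal_lookup_zero: "a \<in> rel_ideal \<Longrightarrow> Poly_Mapping.lookup a 0 = 0"
  by (induction rule: rel_ideal.induct)
    (simp_all add: lookup_add lookup_minus lookup_sum lookup_mult_zero lookup_leg_zero
      rel_XX_def rel_YY_def rel_XY_def tmul_def)

instantiation qalg :: ("{finite, linorder}") ring_1
begin

lift_definition zero_qalg :: "'a qalg" is 0 .

lift_definition one_qalg :: "'a qalg" is 1 .

lift_definition plus_qalg :: "'a qalg \<Rightarrow> 'a qalg \<Rightarrow> 'a qalg" is "(+)"
proof -
  fix a b c d :: "'a free"
  assume "a - b \<in> rel_ideal" "c - d \<in> rel_ideal"
  then have "(a - b) + (c - d) \<in> rel_ideal" by (rule rel_ideal.add)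
  then show "(a + c) - (b + d) \<in> rel_ideal" by (simp only: add_diff_add)
qed

lift_definition uminus_qalg :: "'a qalg \<Rightarrow> 'a qalg" is uminus
proof -
  fix a b :: "'a free"
  assume "a - b \<in> rel_ideal"
  then show "- a - - b \<in> rel_ideal"
    unfolding minus_diff_minus by (rule rel_ideal_minus)
qed

lift_definition minus_qalg :: "'a qalg \<Rightarrow> 'a qalg \<Rightarrow> 'a qalg" is "(-)"
proof -
  fix a b c d :: "'a free"
  assume "a - b \<in> rel_ideal" "c - d \<in> rel_ideal"
  then have "(a - b) - (c - d) \<in> rel_ideal" by (rule rel_ideal_diff)
  then show "(a - c) - (b - d) \<in> rel_ideal" by (simp add: algebra_simps)
qed

lift_definition times_qalg :: "'a qalg \<Rightarrow> 'a qalg \<Rightarrow> 'a qalg" is "(*)"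
proof -
  fix a b c d :: "'a free"
  assume "a - b \<in> rel_ideal" "c - d \<in> rel_ideal"
  then have "(a - b) * c + b * (c - d) \<in> rel_ideal"
    by (intro rel_ideal.add rel_ideal_lmult rel_ideal_rmult)
  then show "a * c - b * d \<in> rel_ideal"
    by (simp add: algebra_simps)
qed

instance
proof
  show "(0 :: 'a qalg) \<noteq> 1"
    by transfer (use rel_ideal_lookup_zero in \<open>fastforce simp: lookup_minus lookup_one\<close>)
qed (transfer, simp add: add_ac mult.assoc distrib_left distrib_right rel_ideal.zero)+

end

lift_definition qalg_scal :: "'n::{finite,linorder} ratfun \<Rightarrow> 'n qalg" is free_scal .

lift_definition qalg_X :: "'n::{finite,linorder} \<Rightarrow> 'n \<Rightarrow> 'n qalg" is free_X .

lift_definition qalg_Y :: "'n::{finite,linorder} \<Rightarrow> 'n \<Rightarrow> 'n qalg" is free_Y .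

lift_definition qalg_star :: "'n::{finite,linorder} qalg \<Rightarrow> 'n qalg" is free_star
  using rel_ideal_star by (metis free_star_diff)

lemma free_scal_hom:
  "free_scal 0 = 0" "free_scal 1 = 1" "free_scal (a + b) = free_scal a + free_scal b"
  "free_scal (a * b) = free_scal a * free_scal b"
  by (simp_all add: free_scal_def single_add mult_single)

lemma free_scal_commute: "free_scal c * a = a * free_scal c"
proof -
  have "free_scal c * (\<Sum>k\<in>Poly_Mapping.keys a. Poly_Mapping.single k (Poly_Mapping.lookup a k))
    = (\<Sum>k\<in>Poly_Mapping.keys a. Poly_Mapping.single k (Poly_Mapping.lookup a k)) * free_scal c"
    unfolding free_scal_def sum_distrib_left sum_distrib_right mult_single
    by (simp add: mult.commute)
  then show ?thesis by (simp add: sum_singles)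
qed

lemma qalg_scal_hom:
  "qalg_scal 0 = 0" "qalg_scal 1 = 1" "qalg_scal (a + b) = qalg_scal a + qalg_scal b"
  "qalg_scal (a * b) = qalg_scal a * qalg_scal b"
  by (simp_all add: qalg_scal.abs_eq zero_qalg_def one_qalg_def plus_qalg.abs_eq times_qalg.abs_eq
      free_scal_hom)

lemma qalg_scal_commute: "qalg_scal c * a = a * qalg_scal c"
  by transfer (simp add: free_scal_commute rel_ideal.zero)

lemma qalg_star_star [simp]: "qalg_star (qalg_star a) = a"
  by transfer (simp add: rel_ideal.zero)

lemma qalg_star_add: "qalg_star (a + b) = qalg_star a + qalg_star b"
  by transfer (simp add: free_star_add rel_ideal.zero)

lemma qalg_star_mult: "qalg_star (a * b) = qalg_star b * qalg_star a"
  by transfer (simp add: free_star_mult rel_ideal.zero)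

lemma qalg_star_scal: "qalg_star (qalg_scal c) = qalg_scal (rf_star c)"
  by transfer (simp add: free_star_scal rel_ideal.zero)

lemma qalg_star_X: "qalg_star (qalg_X i j) = qalg_Y j i"
  by transfer (simp add: free_star_X rel_ideal.zero)

lemma abs_qalg_eq_0_iff: "abs_qalg a = 0 \<longleftrightarrow> a \<in> rel_ideal"
  unfolding zero_qalg_def using qalg.abs_eq_iff[of a 0] by simp

lemma abs_qalg_sum: "abs_qalg (sum f A) = (\<Sum>x\<in>A. abs_qalg (f x))"
  by (induction A rule: infinite_finite_induct)
    (simp_all add: zero_qalg_def plus_qalg.abs_eq[symmetric])

lemma abs_qalg_tmul:
  "abs_qalg (tmul n A B u w) = tmul n (tmap abs_qalg A) (tmap abs_qalg B) u w"
  by (simp add: tmul_def tmap_def abs_qalg_sum times_qalg.abs_eq[symmetric])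

lemma tmap_abs_qalg:
  "tmap abs_qalg (tmul n A B) = tmul n (tmap abs_qalg A) (tmap abs_qalg B)"
  "tmap abs_qalg (leg k free_X) = leg k qalg_X"
  "tmap abs_qalg (leg k free_Y) = leg k qalg_Y"
  "tmap abs_qalg (tmap free_scal T) = tmap qalg_scal T"
  by (auto simp: fun_eq_iff tmap_def abs_qalg_tmul leg_def qalg_X.abs_eq qalg_Y.abs_eq
      qalg_scal.abs_eq zero_qalg_def[symmetric] abs_qalg_tmul[unfolded tmap_def])

lemma qalg_relations:
  assumes "length u = 2" "length w = 2"
  shows "rel_XX qalg_scal qalg_X u w = 0"
    and "rel_YY qalg_scal qalg_Y u w = 0"
    and "rel_XY qalg_scal qalg_X qalg_Y u w = 0"
proof -
  have "abs_qalg (rel_XX free_scal free_X u w) = 0"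
    using rel_ideal.XX[OF assms, of 1 1] by (simp add: abs_qalg_eq_0_iff)
  then show "rel_XX qalg_scal qalg_X u w = 0"
    by (simp add: rel_XX_def minus_qalg.abs_eq[symmetric] abs_qalg_tmul tmap_abs_qalg)
  have "abs_qalg (rel_YY free_scal free_Y u w) = 0"
    using rel_ideal.YY[OF assms, of 1 1] by (simp add: abs_qalg_eq_0_iff)
  then show "rel_YY qalg_scal qalg_Y u w = 0"
    by (simp add: rel_YY_def minus_qalg.abs_eq[symmetric] abs_qalg_tmul tmap_abs_qalg)
  have "abs_qalg (rel_XY free_scal free_X free_Y u w) = 0"
    using rel_ideal.XY[OF assms, of 1 1] by (simp add: abs_qalg_eq_0_iff)
  then show "rel_XY qalg_scal qalg_X qalg_Y u w = 0"
    by (simp add: rel_XY_def minus_qalg.abs_eq[symmetric] abs_qalg_tmul tmap_abs_qalg)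
qed

section \<open>The elements \<open>\<sigma>(i)\<close>\<close>

definition neg_q_r :: "nat set \<Rightarrow> (nat \<Rightarrow> 'n) \<Rightarrow> 'n::{finite,linorder} ratfun" where
  "neg_q_r I \<sigma> = (\<Prod>(i, j)\<in>{(i, j). i \<in> I \<and> j \<in> I \<and> i < j \<and> \<sigma> i > \<sigma> j}. - qij (\<sigma> i) (\<sigma> j))"

definition neg_q_c :: "nat set \<Rightarrow> (nat \<Rightarrow> 'n) \<Rightarrow> 'n::{finite,linorder} ratfun" where
  "neg_q_c I \<sigma> = (\<Prod>(i, j)\<in>{(i, j). i \<in> I \<and> j \<in> I \<and> i < j \<and> \<sigma> i > \<sigma> j}. - qij (\<sigma> j) (\<sigma> i))"

text \<open>The bijections \<open>[i] \<rightarrow> K\<close>; for \<open>i = N\<close> and \<open>K = UNIV\<close> these are the permutations.\<close>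

definition bijections :: "nat \<Rightarrow> 'n set \<Rightarrow> (nat \<Rightarrow> 'n) set" where
  "bijections i K = {\<tau> \<in> {1..i} \<rightarrow>\<^sub>E K. bij_betw \<tau> {1..i} K}"

definition q_int :: "nat \<Rightarrow> 'n::{finite,linorder} ratfun" where
  "q_int n = (\<Sum>k<n. qq ^ (2 * k))"

definition q_fact :: "nat \<Rightarrow> 'n::{finite,linorder} ratfun" where
  "q_fact n = (\<Prod>k=1..n. q_int k)"

definition alpha :: "nat \<Rightarrow> 'n::{finite,linorder} ratfun" where
  "alpha i = 1 / q_fact CARD('n) * (q_fact CARD('n) / (q_fact i * q_fact (CARD('n) - i)))"

text \<open>
  The basis vector \<open>e\<^bsub>\<sigma>(1)\<^esub> \<otimes> \<dots> \<otimes> e\<^bsub>\<sigma>(N)\<^esub>\<close> has the multi-index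
  \<open>map \<sigma> [1..<Suc N]\<close>.
\<close>

definition u_col :: "'n::{finite,linorder} list \<Rightarrow> 'n ratfun" where
  "u_col a = (\<Sum>\<sigma>\<in>bijections CARD('n) UNIV.
    neg_q_c {1..CARD('n)} \<sigma> * (if a = map \<sigma> [1..<Suc CARD('n)] then 1 else 0))"

definition v_row :: "'n::{finite,linorder} list \<Rightarrow> 'n ratfun" where
  "v_row a = (\<Sum>\<sigma>\<in>bijections CARD('n) UNIV.
    neg_q_r {1..CARD('n)} \<sigma> * (if a = map \<sigma> [1..<Suc CARD('n)] then 1 else 0))"

lemma v_row_eq_star: "v_row a = rf_star (u_col a)"
proof -
  have sum: "rf_star (sum f A) = (\<Sum>x\<in>A. rf_star (f x))" for f :: "'b \<Rightarrow> 'a ratfun" and A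
    by (induction A rule: infinite_finite_induct) (simp_all add: rf_star_add)
  have prod: "rf_star (prod f A) = (\<Prod>x\<in>A. rf_star (f x))" for f :: "'b \<Rightarrow> 'a ratfun" and A
    by (induction A rule: infinite_finite_induct) (simp_all add: rf_star_mult)
  show ?thesis
    unfolding v_row_def u_col_def sum rf_star_mult neg_q_c_def neg_q_r_def prod
    by (intro sum.cong arg_cong2[where f = "(*)"] prod.cong refl)
      (auto simp: rf_star_minus rf_star_qij)
qed

definition XY_mat :: "'n::{finite,linorder} \<Rightarrow> 'n \<Rightarrow> 'n qalg" where
  "XY_mat i j = (\<Sum>k\<in>UNIV. qalg_X i k * qalg_Y k j)"

text \<open>\<open>sigma_factor i\<close> is \<open>(XY)\<^sub>0\<^sub>1 R\<^sub>1\<^sub>2 \<cdots> R\<^bsub>i-1,i\<^esub>\<close> on \<open>N\<close> legs, with \<open>R\<close> here denoting \<open>Rhat\<close>.\<close>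

definition sigma_factor :: "nat \<Rightarrow> ('n::{finite,linorder}, 'n qalg) tmat" where
  "sigma_factor i = foldl (tmul CARD('n)) (leg 1 XY_mat)
    (map (\<lambda>k. leg2 k (tmap qalg_scal Rhat)) [1..<i])"

definition sigma_qQ :: "nat \<Rightarrow> 'n::{finite,linorder} qalg" where
  "sigma_qQ i = (if i = 0 then 1 else
    qalg_scal (qq powi (- ((int i - 1) * int i)) * alpha i) *
    (\<Sum>a | length a = CARD('n). \<Sum>b | length b = CARD('n).
      qalg_scal (v_row a) * tpow CARD('n) i (sigma_factor i) a b * qalg_scal (u_col b)))"

section \<open>Minors\<close>

text \<open>
  The minors are defined over any algebra with scalar embedding \<open>sc\<close>, so that they can be
  formed both in the quotient and, for their expansion into words, in the free algebra.
\<close>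

definition qminor ::
    "('n ratfun \<Rightarrow> 'a::ring_1) \<Rightarrow> ('n \<Rightarrow> 'n \<Rightarrow> 'a) \<Rightarrow> 'n::{finite,linorder} set \<Rightarrow> 'n set \<Rightarrow> 'a" where
  "qminor sc M J K = (\<Sum>\<tau>\<in>bijections (card J) K. sc (neg_q_c {1..card J} \<tau>) *
    prod_list (map (\<lambda>k. M (sorted_list_of_set J ! (k - 1)) (\<tau> k)) [1..<Suc (card J)]))"

definition D_entry :: "'n::{finite,linorder} \<Rightarrow> 'n ratfun" where
  "D_entry i = qq ^ card {j. j < i}"

definition D'_entry :: "'n::{finite,linorder} \<Rightarrow> 'n ratfun" where
  "D'_entry i = qq ^ card {j. i < j}"

definition minor_DX :: "('n ratfun \<Rightarrow> 'a::ring_1) \<Rightarrow> ('n \<Rightarrow> 'n \<Rightarrow> 'a)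
    \<Rightarrow> 'n::{finite,linorder} set \<Rightarrow> 'n set \<Rightarrow> 'a" where
  "minor_DX sc X = qminor sc (\<lambda>i j. sc (D_entry i) * X i j)"

definition minor_XD' :: "('n ratfun \<Rightarrow> 'a::ring_1) \<Rightarrow> ('n \<Rightarrow> 'n \<Rightarrow> 'a)
    \<Rightarrow> 'n::{finite,linorder} set \<Rightarrow> 'n set \<Rightarrow> 'a" where
  "minor_XD' sc X = qminor sc (\<lambda>i j. X i j * sc (D'_entry j))"

definition minor_YD :: "('n ratfun \<Rightarrow> 'a::ring_1) \<Rightarrow> ('n \<Rightarrow> 'n \<Rightarrow> 'a) \<Rightarrow> ('a \<Rightarrow> 'a)
    \<Rightarrow> 'n::{finite,linorder} set \<Rightarrow> 'n set \<Rightarrow> 'a" where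
  "minor_YD sc X st J K = st (minor_DX sc X K J)"

definition minor_D'Y :: "('n ratfun \<Rightarrow> 'a::ring_1) \<Rightarrow> ('n \<Rightarrow> 'n \<Rightarrow> 'a) \<Rightarrow> ('a \<Rightarrow> 'a)
    \<Rightarrow> 'n::{finite,linorder} set \<Rightarrow> 'n set \<Rightarrow> 'a" where
  "minor_D'Y sc X st J K = st (minor_XD' sc X K J)"

definition subsets_of_card :: "nat \<Rightarrow> 'n set set" where
  "subsets_of_card i = {J. card J = i}"

section \<open>Coefficients\<close>

definition signed_monomial :: "'n::{finite,linorder} ratfun \<Rightarrow> bool" where
  "signed_monomial c \<longleftrightarrow> (\<exists>s\<in>{1, - 1}. \<exists>(m :: int) (e :: 'n \<Rightarrow> 'n \<Rightarrow> int).
    c = s * qq powi m * (\<Prod>a\<in>UNIV. \<Prod>b\<in>UNIV. qij a b powi e a b))"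

text \<open>The result of setting \<open>q\<^sub>a\<^sub>b = q\<close> for all \<open>a \<noteq> b\<close>.\<close>

definition one_parameter :: "'n::{finite,linorder} ratfun \<Rightarrow> 'n ratfun" where
  "one_parameter = rf_subst rf_const (\<lambda>_. qq)"

text \<open>
  \<open>c\<close> tends to a nonzero limit when \<open>q\<close> runs through the complex numbers to \<open>1\<close> and each
  \<open>q\<^sub>i\<^sub>j\<close>, \<open>i < j\<close>, to some nonzero complex number; in particular when \<open>q\<^sub>i\<^sub>j\<close> is constant or
  equal to \<open>q\<close>.
\<close>

definition nonvanishing_at_q_1 :: "'n::{finite,linorder} ratfun \<Rightarrow> bool" where
  "nonvanishing_at_q_1 c \<longleftrightarrow> (\<forall>(\<rho> :: complex \<Rightarrow> 'n qvar \<Rightarrow> complex) t.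
    (\<forall>z. \<rho> z qvar_q = z) \<and> (\<forall>x. ((\<lambda>z. \<rho> z x) \<longlongrightarrow> t x) (at 1) \<and> t x \<noteq> 0) \<longrightarrow>
    (\<exists>L. L \<noteq> 0 \<and> ((\<lambda>z. rf_subst (\<lambda>a. a) (\<rho> z) c) \<longlongrightarrow> L) (at 1)))"

end

theory Submission
  imports Defs "HOL-Library.Multiset"
begin

text \<open>
  Write \<open>R\<^sub>k\<close> for \<open>Rhat\<close> on the legs \<open>k, k+1\<close>, and \<open>X\<^sub>k\<close>, \<open>Y\<^sub>k\<close> for the generating matrices on
  leg \<open>k\<close>.  The defining relations say that \<open>R\<^sub>k\<close> commutes with \<open>X\<^sub>k X\<^sub>k\<^sub>+\<^sub>1\<close> and with
  \<open>Y\<^sub>k\<^sub>+\<^sub>1 Y\<^sub>k\<close>, and that \<open>X\<^sub>k\<^sub>+\<^sub>1 R\<^sub>k Y\<^sub>k\<^sub>+\<^sub>1 = Y\<^sub>k R\<^sub>k X\<^sub>k\<close>.  The last relation moves \<open>Y\<close> from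
  the right of \<open>X\<close> to its left at the price of a change of leg.

  First identity.  Together with the braid relations this gives
  \<open>(X\<^sub>1 Y\<^sub>1 R\<^sub>1 \<cdots> R\<^bsub>i-1\<^esub>)\<^sup>i = X\<^sub>1 \<cdots> X\<^sub>i (R\<^sub>1 \<cdots> R\<^bsub>i-1\<^esub>)\<^sup>i Y\<^sub>i \<cdots> Y\<^sub>1\<close>
  (\<open>power_factorization\<close>).  The \<open>R\<^sub>k\<close> also commute with \<open>Y\<^sub>i \<cdots> Y\<^sub>1\<close>, and the column vector \<open>u\<close> is
  an eigenvector of each of them for the eigenvalue \<open>-q\<^sup>2\<close>, so the braid word in the middle
  contributes the scalar \<open>q\<^bsup>2i(i-1)\<^esup>\<close>.  The remaining
  \<open>v X\<^sub>1 \<cdots> X\<^sub>i Y\<^sub>i \<cdots> Y\<^sub>1 u\<close> involves only the first \<open>i\<close> legs; splitting the other legs off \<open>v\<close> and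
  \<open>u\<close> (\<open>laplace_expansion\<close>) turns it into a sum over \<open>J\<close> of the same expression for the
  antisymmetric vectors \<open>v\<^sub>J\<close> and \<open>u\<^sub>J\<close> of order \<open>i\<close>.  Since \<open>X\<^sub>1 \<cdots> X\<^sub>i\<close> commutes with the
  \<open>R\<^sub>k\<close>, it maps such vectors to combinations of such vectors, and its matrix in this basis is the
  matrix of minors (\<open>X_eps_u\<close>, \<open>eps_v_X\<close>); the involution gives the same for \<open>Y\<^sub>i \<cdots> Y\<^sub>1\<close>.  The
  powers of \<open>q\<close> that have accumulated are exactly the entries of \<open>D\<^sup>2\<close> (\<open>prod_D_entry\<close>).

  Second identity.  Let \<open>P\<close> be the sum of the \<open>u\<^sub>J v\<^sub>J\<close>.  Up to the factor \<open>[i]!\<close>, the first sum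
  over minors is the trace of \<open>P X\<^sub>1 \<cdots> X\<^sub>i Y\<^sub>i \<cdots> Y\<^sub>1\<close> with weight \<open>D\<^sup>2\<close> on each leg, and the second
  sum is the trace of \<open>Y\<^sub>i \<cdots> Y\<^sub>1 P X\<^sub>1 \<cdots> X\<^sub>i\<close> with weight \<open>D'\<^sup>2\<close> on each leg.  One passes from
  the first to the second by moving one \<open>Y\<close> at a time (\<open>mixed_trace_Suc\<close>).  A new leg with weight
  \<open>D'\<^sup>2\<close> is added on the left; this is harmless because the partial trace of \<open>R\<close> over its first
  leg with this weight is \<open>1\<close>.  On the enlarged space the relation between \<open>X\<close> and \<open>Y\<close> moves
  \<open>Y\<^sub>i\<close> to the new leg.  Afterwards nothing but one \<open>R\<close> acts on the last leg, whose
  weight is \<open>D\<^sup>2\<close>, and the partial trace of \<open>R\<close> over its second leg with that weight is again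
  \<open>1\<close>, so the last leg can be dropped.

  Coefficients.  In the free algebra a word that occurs in a sum of products of minors determines the index
  sets and the two bijections from which it came (\<open>inj_on_words\<close>).  Hence no two terms are
  collected, and every coefficient is a product of powers of \<open>q\<close> and of factors \<open>-q\<^sub>a\<^sub>b\<close>.
\<close>

section \<open>Matrices acting on tensor powers of all orders at once\<close>

text \<open>
  One matrix on each tensor power, stored as a single function that vanishes when the two
  multi-indices differ in length.  The gain over matrices on a fixed power is that all of them
  together form a monoid, so that words in operators can be treated by algebra in a type class.
\<close>

typedef (overloaded) ('n, 'a) lmat =
  "{A :: ('n::finite, 'a::ring_1) tmat. \<forall>u w. length u \<noteq> length w \<longrightarrow> A u w = 0}"
  morphisms entry Abs_lmat
  by (rule exI[of _ "\<lambda>u w. 0"]) simp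

setup_lifting type_definition_lmat

lemma entry_diff_length: "length u \<noteq> length w \<Longrightarrow> entry A u w = 0"
  using entry[of A] by simp

instantiation lmat :: (finite, ring_1) monoid_mult
begin

lift_definition one_lmat :: "('a, 'b) lmat" is tone
  by (auto simp: tone_def)

lift_definition times_lmat :: "('a, 'b) lmat \<Rightarrow> ('a, 'b) lmat \<Rightarrow> ('a, 'b) lmat"
  is "\<lambda>A B u w. tmul (length u) A B u w"
  by (auto simp: tmul_def intro!: sum.neutral)

instance
proof
  fix A B C :: "('a, 'b) lmat"
  show "A * B * C = A * (B * C)"
  proof (transfer, intro ext)
    fix A B C :: "('a, 'b) tmat" and u w :: "'a list"
    have "tmul (length u) (\<lambda>u. tmul (length u) A B u) C u w =
        tmul (length u) (tmul (length u) A B) C u w"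
      by (rule tmul_cong) simp_all
    moreover have "tmul (length u) A (\<lambda>u. tmul (length u) B C u) u w =
        tmul (length u) A (tmul (length u) B C) u w"
      by (rule tmul_cong) simp_all
    ultimately show "tmul (length u) (\<lambda>u. tmul (length u) A B u) C u w =
        tmul (length u) A (\<lambda>u. tmul (length u) B C u) u w"
      by (simp add: tmul_assoc)
  qed
  show "1 * A = A" "A * 1 = A"
    by (transfer, auto simp: tmul_def tone_def fun_eq_iff if_distrib[of "\<lambda>x. _ * x"]
        if_distrib[of "\<lambda>x. x * _"] cong: if_cong)+
qed

end

lemma entry_one: "entry 1 u w = (if u = w then 1 else 0)"
  by transfer (simp add: tone_def)

lemma entry_mult: "length u = n \<Longrightarrow> entry (A * B) u w = tmul n (entry A) (entry B) u w"
  by transfer simp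

lemma entry_power: "length u = n \<Longrightarrow> entry (A ^ k) u w = tpow n k (entry A) u w"
proof (induction k arbitrary: u w)
  case 0
  then show ?case by (simp add: tpow_def entry_one tone_def)
next
  case (Suc k)
  have "entry (A ^ Suc k) u w = tmul n (entry A) (entry (A ^ k)) u w"
    using Suc.prems by (simp add: entry_mult)
  also have "\<dots> = tmul n (entry A) (tpow n k (entry A)) u w"
    by (rule tmul_cong) (simp_all add: Suc.IH)
  finally show ?case by (simp add: tpow_def)
qed

text \<open>
  Application to a column vector from the left and to a row vector from the right, on every
  tensor power.
\<close>

definition act :: "('n, 'a) lmat \<Rightarrow> ('n::finite list \<Rightarrow> 'a::ring_1) \<Rightarrow> 'n list \<Rightarrow> 'a" where
  "act A f u = (\<Sum>v | length v = length u. entry A u v * f v)"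

definition ract :: "('n::finite list \<Rightarrow> 'a::ring_1) \<Rightarrow> ('n, 'a) lmat \<Rightarrow> 'n list \<Rightarrow> 'a" where
  "ract f A w = (\<Sum>v | length v = length w. f v * entry A v w)"

lemma entry_mult_act: "entry (A * B) u w = act A (\<lambda>v. entry B v w) u"
  by (simp add: act_def entry_mult[OF refl] tmul_def)

lemma entry_mult_ract: "entry (A * B) u w = ract (entry A u) B w"
proof (cases "length u = length w")
  case True
  then show ?thesis by (simp add: ract_def entry_mult[OF refl] tmul_def)
next
  case False
  then show ?thesis by (simp add: ract_def entry_diff_length)
qed

lemma act_cong: "(\<And>v. length v = length u \<Longrightarrow> f v = g v) \<Longrightarrow> act A f u = act A g u"
  by (simp add: act_def)

lemma act_mult: "act (A * B) f u = act A (act B f) u"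
  by (simp add: act_def entry_mult[OF refl] tmul_def sum_distrib_left sum_distrib_right mult.assoc)
    (rule sum.swap)

subsection \<open>Placing a matrix on consecutive legs\<close>

text \<open>
  The operator \<open>1 \<otimes> A \<otimes> 1\<close> with \<open>A\<close> on \<open>m\<close> legs after the first \<open>k\<close>.  It is zero on tensor
  powers with fewer than \<open>k + m\<close> legs.  In particular \<open>on_legs k m 1\<close> is not the identity but the
  projection to the powers on which there is enough room.
\<close>

lift_definition on_legs :: "nat \<Rightarrow> nat \<Rightarrow> ('n::finite, 'a::ring_1) lmat \<Rightarrow> ('n, 'a) lmat"
  is "\<lambda>k m A u w. if length u = length w \<and> k + m \<le> length u \<and> take k u = take k w
    \<and> drop (k + m) u = drop (k + m) w then A (take m (drop k u)) (take m (drop k w)) else 0"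
  by auto

lemma entry_on_legs:
  assumes "length x = k" "length y = m" "length x' = k" "length y' = m"
  shows "entry (on_legs k m A) (x @ y @ z) (x' @ y' @ z') =
    (if x = x' \<and> z = z' then entry A y y' else 0)"
  using assms by transfer auto

lemma entry_on_legs_short: "length u < k + m \<Longrightarrow> entry (on_legs k m A) u w = 0"
  by transfer auto

lemma split_list_lengths:
  assumes "k + m \<le> length u"
  obtains x y z where "u = x @ y @ z" "length x = k" "length y = m"
proof
  show "u = take k u @ take m (drop k u) @ drop (k + m) u"
    by (metis add.commute append_take_drop_id drop_drop)
qed (use assms in auto)

lemma sum_legs:
  fixes g :: "'n::finite list \<Rightarrow> 'b::comm_monoid_add"
  assumes "length x = k" "length y = m"
    and "\<And>v. length v = k + m + length z \<Longrightarrow> take k v \<noteq> x \<or> drop (k + m) v \<noteq> z \<Longrightarrow> g v = 0"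
  shows "(\<Sum>v | length v = length (x @ y @ z). g v) = (\<Sum>y' | length y' = m. g (x @ y' @ z))"
proof -
  have "(\<Sum>y' | length y' = m. g (x @ y' @ z)) = sum g ((\<lambda>y'. x @ y' @ z) ` {y'. length y' = m})"
    by (subst sum.reindex) (auto simp: inj_on_def)
  also have "\<dots> = (\<Sum>v | length v = length (x @ y @ z). g v)"
  proof (rule sum.mono_neutral_left)
    show "\<forall>v\<in>{v. length v = length (x @ y @ z)} - (\<lambda>y'. x @ y' @ z) ` {y'. length y' = m}. g v = 0"
    proof
      fix v assume v: "v \<in> {v. length v = length (x @ y @ z)} - (\<lambda>y'. x @ y' @ z) ` {y'. length y' = m}"
      then have len: "length v = k + m + length z" using assms by simp
      then obtain x' y' z' where "v = x' @ y' @ z'" "length x' = k" "length y' = m"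
        using split_list_lengths[of k m v] by (metis le_add1)
      then show "g v = 0" using v len by (intro assms(3)) auto
    qed
  qed (use assms in \<open>auto intro: finite_imageI\<close>)
  finally show ?thesis ..
qed

lemma act_on_legs:
  assumes "length x = k" "length y = m"
  shows "act (on_legs k m A) f (x @ y @ z) = act A (\<lambda>y'. f (x @ y' @ z)) y"
proof -
  have "entry (on_legs k m A) (x @ y @ z) v = 0"
    if v: "length v = k + m + length z" "take k v \<noteq> x \<or> drop (k + m) v \<noteq> z" for v
  proof -
    obtain x' y' z' where "v = x' @ y' @ z'" "length x' = k" "length y' = m"
      using split_list_lengths[of k m v] v(1) by (metis le_add1)
    then show ?thesis using v assms by (auto simp: entry_on_legs)
  qed
  then show ?thesis
    unfolding act_def using assms
    by (subst sum_legs[of x k y m z]) (simp_all add: entry_on_legs)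
qed

lemma ract_on_legs:
  assumes "length x = k" "length y = m"
  shows "ract f (on_legs k m A) (x @ y @ z) = ract (\<lambda>y'. f (x @ y' @ z)) A y"
proof -
  have "entry (on_legs k m A) v (x @ y @ z) = 0"
    if v: "length v = k + m + length z" "take k v \<noteq> x \<or> drop (k + m) v \<noteq> z" for v
  proof -
    obtain x' y' z' where "v = x' @ y' @ z'" "length x' = k" "length y' = m"
      using split_list_lengths[of k m v] v(1) by (metis le_add1)
    then show ?thesis using v assms by (auto simp: entry_on_legs)
  qed
  then show ?thesis
    unfolding ract_def using assms
    by (subst sum_legs[of x k y m z]) (simp_all add: entry_on_legs)
qed

lemma act_on_legs_short: "length u < k + m \<Longrightarrow> act (on_legs k m A) f u = 0"
  by (simp add: act_def entry_on_legs_short)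

lemma lmat_eqI: "(\<And>u w. length u = length w \<Longrightarrow> entry A u w = entry B u w) \<Longrightarrow> A = B"
proof -
  assume *: "\<And>u w. length u = length w \<Longrightarrow> entry A u w = entry B u w"
  have "entry A u w = entry B u w" for u w
    by (cases "length u = length w") (simp_all add: * entry_diff_length)
  then show ?thesis by (simp add: entry_inject[symmetric] fun_eq_iff)
qed

lemma on_legs_cong:
  assumes "\<And>u w. length u = m \<Longrightarrow> length w = m \<Longrightarrow> entry A u w = entry B u w"
  shows "on_legs k m A = on_legs k m B"
  using assms by transfer (auto simp: fun_eq_iff)

lemma on_legs_mult: "on_legs k m (A * B) = on_legs k m A * on_legs k m B"
proof (rule lmat_eqI)
  fix u w :: "'a list"
  assume len: "length u = length w"
  show "entry (on_legs k m (A * B)) u w = entry (on_legs k m A * on_legs k m B) u w"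
  proof (cases "k + m \<le> length u")
    case True
    then obtain x y z x' y' z' where u: "u = x @ y @ z" "length x = k" "length y = m"
      and w: "w = x' @ y' @ z'" "length x' = k" "length y' = m"
      using split_list_lengths len by metis
    have "entry (on_legs k m A * on_legs k m B) u w =
        act A (\<lambda>v. entry (on_legs k m B) (x @ v @ z) w) y"
      unfolding entry_mult_act u(1) using u(2,3) by (rule act_on_legs)
    also have "\<dots> = act A (\<lambda>v. if x = x' \<and> z = z' then entry B v y' else 0) y"
      unfolding w(1) using u w by (intro act_cong) (simp add: entry_on_legs)
    also have "\<dots> = entry (on_legs k m (A * B)) u w"
      using u w by (auto simp: entry_on_legs entry_mult_act act_def)
    finally show ?thesis ..
  next
    case False
    then show ?thesis by (simp add: entry_mult_act act_on_legs_short entry_on_legs_short)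
  qed
qed

lemma entry_on_legs_one:
  "entry (on_legs k m 1) u w = (if u = w \<and> k + m \<le> length u then 1 else 0)"
  by transfer (auto simp: tone_def, metis add.commute append_take_drop_id drop_drop)

lemma on_legs_one_mult:
  assumes "k' + m' \<le> k + m"
  shows "on_legs k' m' 1 * on_legs k m A = on_legs k m A"
    and "on_legs k m A * on_legs k' m' 1 = on_legs k m A"
proof -
  have short: "entry (on_legs k m A) u w = 0" if "\<not> k' + m' \<le> length u" for u w
    using that assms by (simp add: entry_on_legs_short)
  show "on_legs k' m' 1 * on_legs k m A = on_legs k m A"
  proof (rule lmat_eqI)
    fix u w :: "'a list"
    assume "length u = length w"
    then show "entry (on_legs k' m' 1 * on_legs k m A) u w = entry (on_legs k m A) u w"
      by (cases "k' + m' \<le> length u")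
        (simp_all add: entry_on_legs_one entry_mult_act act_def short if_distrib[of "\<lambda>x. x * _"] cong: if_cong)
  qed
  show "on_legs k m A * on_legs k' m' 1 = on_legs k m A"
  proof (rule lmat_eqI)
    fix u w :: "'a list"
    assume "length u = length w"
    then show "entry (on_legs k m A * on_legs k' m' 1) u w = entry (on_legs k m A) u w"
      by (cases "k' + m' \<le> length u")
        (simp_all add: entry_on_legs_one entry_mult_ract ract_def short if_distrib[of "\<lambda>x. _ * x"] cong: if_cong)
  qed
qed

text \<open>
  An operator inside a block of legs keeps the cut-off of the block, which the extra factor
  records.
\<close>

lemma on_legs_on_legs:
  assumes "l + p \<le> m"
  shows "on_legs k m (on_legs l p A) = on_legs (k + l) p A * on_legs k m 1"
    and "on_legs k m (on_legs l p A) = on_legs k m 1 * on_legs (k + l) p A"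
proof -
  have eq: "entry (on_legs k m (on_legs l p A)) u w =
    (if k + m \<le> length u then entry (on_legs (k + l) p A) u w else 0)" for u w
  proof (cases "length u = length w \<and> k + m \<le> length u")
    case True
    then obtain x y z x' y' z' where u: "u = x @ y @ z" "length x = k" "length y = m"
      and w: "w = x' @ y' @ z'" "length x' = k" "length y' = m"
      using split_list_lengths by metis
    from u w assms obtain a b c a' b' c' where y: "y = a @ b @ c" "length a = l" "length b = p"
      and y': "y' = a' @ b' @ c'" "length a' = l" "length b' = p"
      using split_list_lengths by metis
    have "entry (on_legs (k + l) p A) ((x @ a) @ b @ (c @ z)) ((x' @ a') @ b' @ (c' @ z')) =
      (if x @ a = x' @ a' \<and> c @ z = c' @ z' then entry A b b' else 0)"
      using u w y y' by (subst entry_on_legs) auto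
    moreover have "length c = length c'" using u w y y' by auto
    ultimately show ?thesis
      using u w y y' True by (auto simp: entry_on_legs entry_on_legs[of x k "a @ b @ c" m x' "a' @ b' @ c'", simplified])
  next
    case False
    then show ?thesis by (auto simp: entry_diff_length entry_on_legs_short)
  qed
  show "on_legs k m (on_legs l p A) = on_legs (k + l) p A * on_legs k m 1"
    by (rule lmat_eqI) (simp add: eq entry_on_legs_one entry_mult_ract ract_def if_distrib[of "\<lambda>x. _ * x"] cong: if_cong)
  show "on_legs k m (on_legs l p A) = on_legs k m 1 * on_legs (k + l) p A"
    by (rule lmat_eqI) (simp add: eq entry_on_legs_one entry_mult_act act_def if_distrib[of "\<lambda>x. x * _"] cong: if_cong)
qed

lemma on_legs_one_central: "on_legs k m 1 * A = A * on_legs k m 1"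
proof (rule lmat_eqI)
  fix u w :: "'a list"
  assume "length u = length w"
  then show "entry (on_legs k m 1 * A) u w = entry (A * on_legs k m 1) u w"
    by (cases "k + m \<le> length u") (simp_all add: entry_mult_act[of "on_legs k m 1"]
      entry_mult_ract[of A] act_def ract_def entry_on_legs_one if_distrib[of "\<lambda>x. _ * x"] if_distrib[of "\<lambda>x. x * _"] cong: if_cong)
qed

text \<open>
  Next to a factor that occupies the larger block, the cut-off is automatic.  With
  \<open>on_legs_cong\<close> this reduces an identity between words to the smallest power on which it makes
  sense.
\<close>

lemma on_legs_absorb:
  assumes "l + p \<le> m"
  shows "on_legs (k + l) p A * on_legs k m B = on_legs k m (on_legs l p A * B)"
    and "on_legs k m B * on_legs (k + l) p A = on_legs k m (B * on_legs l p A)"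
  unfolding on_legs_mult
  by (simp add: on_legs_on_legs(1)[OF assms] mult.assoc on_legs_one_mult)
    (simp add: on_legs_on_legs(2)[OF assms] on_legs_one_mult flip: mult.assoc)

lemma on_legs_on_legs_end:
  "l + p = m \<Longrightarrow> on_legs k m (on_legs l p A) = on_legs (k + l) p A"
  by (simp add: on_legs_on_legs on_legs_one_mult)

lemma entry_mult_beside:
  assumes "length a = m" "length c = m" "length b = p" "length d = p"
  shows "entry (on_legs 0 m A * on_legs m p B) (a @ b) (c @ d) = entry A a c * entry B b d"
    and "entry (on_legs m p B * on_legs 0 m A) (a @ b) (c @ d) = entry B b d * entry A a c"
proof -
  have B: "entry (on_legs m p B) (v @ b) (c @ d) = (if v = c then entry B b d else 0)"
    if "length v = m" for v
    using entry_on_legs[of v m b p c d B "[]" "[]"] assms that by simp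
  have A: "entry (on_legs 0 m A) (a @ v) (c @ d) = (if v = d then entry A a c else 0)"
    for v
    using entry_on_legs[of "[]" 0 a m "[]" c A v d] assms by simp
  have "entry (on_legs 0 m A * on_legs m p B) ([] @ a @ b) (c @ d) = entry A a c * entry B b d"
    unfolding entry_mult_act using assms
    by (subst act_on_legs) (simp_all add: act_def B if_distrib[of "\<lambda>x. _ * x"] cong: if_cong)
  then show "entry (on_legs 0 m A * on_legs m p B) (a @ b) (c @ d) = entry A a c * entry B b d"
    by simp
  have "entry (on_legs m p B * on_legs 0 m A) (a @ b @ []) (c @ d) = entry B b d * entry A a c"
    unfolding entry_mult_act using assms
    by (subst act_on_legs) (simp_all add: act_def A if_distrib[of "\<lambda>x. _ * x"] cong: if_cong)
  then show "entry (on_legs m p B * on_legs 0 m A) (a @ b) (c @ d) = entry B b d * entry A a c"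
    by simp
qed

text \<open>
  Only entries have to commute here, since the legs are disjoint.  The entries themselves need
  not lie in a commutative ring, so this is an assumption.
\<close>

lemma on_legs_commute:
  assumes "k + m \<le> l" and "\<And>u w u' w'. entry A u w * entry B u' w' = entry B u' w' * entry A u w"
  shows "on_legs k m A * on_legs l p B = on_legs l p B * on_legs k m A"
proof -
  define r where "r = l - k"
  define A' where "A' = on_legs 0 m A"
  have r: "m \<le> r" "l = k + r" using assms(1) by (simp_all add: r_def)
  have A': "entry A' u w * entry B u' w' = entry B u' w' * entry A' u w" for u w u' w'
    using assms(2) unfolding A'_def by transfer auto
  have "on_legs k (r + p) (on_legs 0 r A' * on_legs r p B) = on_legs k (r + p) (on_legs r p B * on_legs 0 r A')"
  proof (rule on_legs_cong)
    fix u w :: "'a list"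
    assume "length u = r + p" "length w = r + p"
    then obtain a b c d where "u = a @ b" "length a = r" "length b = p" "w = c @ d" "length c = r" "length d = p"
      by (metis append_take_drop_id length_drop length_take add_diff_cancel_left' le_add1 min.absorb2)
    then show "entry (on_legs 0 r A' * on_legs r p B) u w = entry (on_legs r p B * on_legs 0 r A') u w"
      by (simp add: entry_mult_beside A')
  qed
  then have eq: "on_legs k r A' * on_legs (k + r) p B = on_legs (k + r) p B * on_legs k r A'"
    using on_legs_absorb(1)[of 0 r "r + p" k A' "on_legs r p B"]
      on_legs_absorb(2)[of 0 r "r + p" k "on_legs r p B" A']
    by (simp only: on_legs_on_legs_end[OF refl] add_0_right le_add1 simp_thms)
  have A'1: "on_legs k r A' = on_legs k m A * on_legs k r 1" "on_legs k r A' = on_legs k r 1 * on_legs k m A"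
    unfolding A'_def using on_legs_on_legs[of 0 m r k A] r by simp_all
  have B1: "on_legs k r 1 * on_legs (k + r) p B = on_legs (k + r) p B"
    "on_legs (k + r) p B * on_legs k r 1 = on_legs (k + r) p B"
    by (simp_all add: on_legs_one_mult)
  have "on_legs k m A * on_legs l p B = on_legs k m A * (on_legs k r 1 * on_legs (k + r) p B)"
    unfolding B1 r ..
  also have "\<dots> = on_legs (k + r) p B * (on_legs k r 1 * on_legs k m A)"
    using eq A'1 by (simp add: mult.assoc[symmetric])
  also have "\<dots> = on_legs l p B * on_legs k m A"
    unfolding mult.assoc[symmetric] B1 r ..
  finally show ?thesis .
qed

section \<open>Words in the braid generators and the leg operators\<close>

lemma commute_mult:
  fixes z :: "'a::semigroup_mult"
  assumes "z * x = x * z" "z * y = y * z"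
  shows "z * (x * y) = x * y * z"
proof -
  have "z * (x * y) = x * (z * y)"
    unfolding mult.assoc[symmetric] assms(1) ..
  then show ?thesis
    unfolding assms(2) mult.assoc .
qed

lemma prod_list_commute:
  fixes z :: "'a::monoid_mult"
  assumes "\<And>x. x \<in> set xs \<Longrightarrow> z * x = x * z"
  shows "z * prod_list xs = prod_list xs * z"
  using assms
  by (induction xs) (simp_all only: prod_list.Nil prod_list.Cons mult_1_left mult_1_right
      list.set_intros commute_mult simp_thms)

text \<open>
  The defining relations as seen by the operators on the legs.  The two factorizations below
  depend on nothing else and hold in any monoid.
\<close>

locale braid_relations =
  fixes R X Y :: "nat \<Rightarrow> 'a::monoid_mult"
  assumes RXX: "R k * (X k * X (Suc k)) = X k * X (Suc k) * R k"
    and RYY: "R k * (Y (Suc k) * Y k) = Y (Suc k) * Y k * R k"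
    and XRY: "X (Suc k) * R k * Y (Suc k) = Y k * R k * X k"
    and RRR: "R k * R (Suc k) * R k = R (Suc k) * R k * R (Suc k)"
    and RR: "Suc k < l \<Longrightarrow> R k * R l = R l * R k"
    and RX: "l \<noteq> k \<Longrightarrow> l \<noteq> Suc k \<Longrightarrow> R k * X l = X l * R k"
    and RY: "l \<noteq> k \<Longrightarrow> l \<noteq> Suc k \<Longrightarrow> R k * Y l = Y l * R k"
begin

definition Xs :: "nat \<Rightarrow> nat \<Rightarrow> 'a" where
  "Xs k l = prod_list (map X [k..<l])"

definition Ys :: "nat \<Rightarrow> nat \<Rightarrow> 'a" where
  "Ys k l = prod_list (map Y (rev [k..<l]))"

definition Rs :: "nat \<Rightarrow> nat \<Rightarrow> 'a" where
  "Rs k l = prod_list (map R [k..<l])"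

lemma Xs_empty [simp]: "Xs k k = 1" and Ys_empty [simp]: "Ys k k = 1" and Rs_empty [simp]: "Rs k k = 1"
  by (simp_all add: Xs_def Ys_def Rs_def)

lemma Xs_Suc: "k \<le> l \<Longrightarrow> Xs k (Suc l) = Xs k l * X l"
  and Ys_Suc: "k \<le> l \<Longrightarrow> Ys k (Suc l) = Y l * Ys k l"
  and Rs_Suc: "k \<le> l \<Longrightarrow> Rs k (Suc l) = Rs k l * R l"
  by (simp_all add: Xs_def Ys_def Rs_def)

lemma Xs_Cons: "k < l \<Longrightarrow> Xs k l = X k * Xs (Suc k) l"
  and Ys_Cons: "k < l \<Longrightarrow> Ys k l = Ys (Suc k) l * Y k"
  and Rs_Cons: "k < l \<Longrightarrow> Rs k l = R k * Rs (Suc k) l"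
  by (simp_all add: Xs_def Ys_def Rs_def upt_conv_Cons)

lemma Rs_append: "k \<le> l \<Longrightarrow> l \<le> m \<Longrightarrow> Rs k m = Rs k l * Rs l m"
  and Xs_append: "k \<le> l \<Longrightarrow> l \<le> m \<Longrightarrow> Xs k m = Xs k l * Xs l m"
  and Ys_append: "k \<le> l \<Longrightarrow> l \<le> m \<Longrightarrow> Ys k m = Ys l m * Ys k l"
  using upt_add_eq_append[of k l "m - l"] by (simp_all add: Xs_def Ys_def Rs_def)

lemma R_Xs:
  assumes "k \<le> j" "Suc j < l"
  shows "R j * Xs k l = Xs k l * R j"
proof -
  have "Xs k l = Xs k j * ((X j * X (Suc j)) * Xs (Suc (Suc j)) l)"
    using assms by (simp add: Xs_append[of k j l] Xs_Cons[of j l] Xs_Cons[of "Suc j" l] mult.assoc)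
  moreover have "R j * Xs k j = Xs k j * R j"
    unfolding Xs_def by (rule prod_list_commute) (auto simp: RX)
  moreover have "R j * Xs (Suc (Suc j)) l = Xs (Suc (Suc j)) l * R j"
    unfolding Xs_def by (rule prod_list_commute) (auto simp: RX)
  ultimately show ?thesis
    by (simp only: commute_mult RXX)
qed

lemma R_Ys:
  assumes "k \<le> j" "Suc j < l"
  shows "R j * Ys k l = Ys k l * R j"
proof -
  have "Ys k l = Ys (Suc (Suc j)) l * ((Y (Suc j) * Y j) * Ys k j)"
    using assms by (simp add: Ys_append[of k j l] Ys_Cons[of j l] Ys_Cons[of "Suc j" l] mult.assoc)
  moreover have "R j * Ys k j = Ys k j * R j"
    unfolding Ys_def by (rule prod_list_commute) (auto simp: RY)
  moreover have "R j * Ys (Suc (Suc j)) l = Ys (Suc (Suc j)) l * R j"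
    unfolding Ys_def by (rule prod_list_commute) (auto simp: RY)
  ultimately show ?thesis
    by (simp only: commute_mult RYY)
qed

lemma Rs_Ys:
  assumes "k \<le> a" "b < l"
  shows "Rs a b * Ys k l = Ys k l * Rs a b"
  unfolding Rs_def using assms
  by (intro prod_list_commute[symmetric]) (auto simp: R_Ys)

lemma Rs_Xs:
  assumes "k \<le> a" "b < l"
  shows "Rs a b * Xs k l = Xs k l * Rs a b"
  unfolding Rs_def using assms
  by (intro prod_list_commute[symmetric]) (auto simp: R_Xs)

lemma Rs_Ys_far:
  assumes "b < k"
  shows "Rs a b * Ys k l = Ys k l * Rs a b"
proof -
  have "R j * Ys k l = Ys k l * R j" if "j < b" for j
    unfolding Ys_def using assms that by (intro prod_list_commute) (auto simp: RY)
  then show ?thesis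
    unfolding Rs_def by (intro prod_list_commute[symmetric]) auto
qed

text \<open>
  A crossing slides along a strand that passes all the others, and its position is shifted by
  one on the way.
\<close>

lemma Rs_shift:
  assumes "a \<le> k" "Suc k < b"
  shows "R (Suc k) * Rs a b = Rs a b * R k"
proof -
  have eq: "Rs a b = Rs a k * (R k * R (Suc k) * Rs (Suc (Suc k)) b)"
    using assms by (simp add: Rs_append[of a k b] Rs_Cons[of k b] Rs_Cons[of "Suc k" b] mult.assoc)
  have 1: "R (Suc k) * Rs a k = Rs a k * R (Suc k)"
    unfolding Rs_def by (rule prod_list_commute) (auto simp: RR[symmetric])
  have 2: "R k * Rs (Suc (Suc k)) b = Rs (Suc (Suc k)) b * R k"
    unfolding Rs_def by (rule prod_list_commute) (auto simp: RR)
  have "R (Suc k) * Rs a b = Rs a k * (R (Suc k) * R k * R (Suc k)) * Rs (Suc (Suc k)) b"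
    unfolding eq mult.assoc[symmetric] 1 ..
  also have "\<dots> = Rs a k * (R k * R (Suc k)) * (R k * Rs (Suc (Suc k)) b)"
    unfolding RRR[symmetric] by (simp only: mult.assoc)
  also have "\<dots> = Rs a b * R k"
    unfolding eq 2 by (simp only: mult.assoc)
  finally show ?thesis .
qed

text \<open>A strand carried across \<open>m\<close> others turns \<open>Y\<close> on its far end into \<open>Y\<close> on its near end.\<close>

lemma Xs_Rs_Y: "Xs 1 (Suc m) * Rs 0 m * Y m = Y 0 * Rs 0 m * Xs 0 m"
proof (induction m)
  case (Suc m)
  have 1: "X (Suc m) * Rs 0 m = Rs 0 m * X (Suc m)"
    unfolding Rs_def by (intro prod_list_commute) (auto simp: RX)
  have 2: "Xs 0 m * R m = R m * Xs 0 m"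
    unfolding Xs_def by (intro prod_list_commute[symmetric]) (auto simp: RX)
  have "Xs 1 (Suc (Suc m)) * Rs 0 (Suc m) * Y (Suc m) =
      Xs 1 (Suc m) * (X (Suc m) * Rs 0 m) * R m * Y (Suc m)"
    by (simp add: Xs_Suc Rs_Suc mult.assoc)
  also have "\<dots> = Xs 1 (Suc m) * Rs 0 m * (X (Suc m) * R m * Y (Suc m))"
    unfolding 1 by (simp add: mult.assoc)
  also have "\<dots> = (Xs 1 (Suc m) * Rs 0 m * Y m) * R m * X m"
    unfolding XRY by (simp add: mult.assoc)
  also have "\<dots> = Y 0 * Rs 0 m * (Xs 0 m * R m) * X m"
    unfolding Suc by (simp add: mult.assoc)
  also have "\<dots> = Y 0 * Rs 0 (Suc m) * Xs 0 (Suc m)"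
    unfolding 2 by (simp add: Xs_Suc Rs_Suc mult.assoc)
  finally show ?case .
qed simp

text \<open>
  Multiplying \<open>Xs 0 j\<close> by one more factor from the left produces \<open>Xs 0 (Suc j)\<close>, because
  \<open>Xs_Rs_Y\<close> carries the \<open>Y\<close> of that factor through.  What is left behind is a mixed word in \<open>R\<close>
  and \<open>Y\<close>; there the \<open>R\<close> can be moved to the left, since each meets either all or none of the
  legs of the \<open>Y\<close> that it has to pass.
\<close>

lemma power_factorization:
  "(X 0 * Y 0 * Rs 0 m) ^ Suc m = Xs 0 (Suc m) * Rs 0 m ^ Suc m * Ys 0 (Suc m)"
proof -
  let ?A = "X 0 * Y 0 * Rs 0 m"
  \<comment> \<open>\<open>W j\<close> is what remains to the right of \<open>Xs 0 j\<close> in the \<open>j\<close>-th power.\<close>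
  define W where "W = rec_nat 1 (\<lambda>j w. Rs 0 j * Y j * Rs j m * w)"
  have W_0: "W 0 = 1" and W_Suc: "W (Suc j) = Rs 0 j * Y j * Rs j m * W j" for j
    by (simp_all add: W_def)
  have move: "?A * Xs 0 j = Xs 0 (Suc j) * (Rs 0 j * Y j * Rs j m)" if "j \<le> m" for j
  proof -
    have 1: "Rs j m * Xs 0 j = Xs 0 j * Rs j m"
    proof -
      have "R k * Xs 0 j = Xs 0 j * R k" if "k \<ge> j" for k
        unfolding Xs_def using that by (intro prod_list_commute) (auto simp: RX)
      then show ?thesis unfolding Rs_def by (intro prod_list_commute[symmetric]) auto
    qed
    have "?A * Xs 0 j = X 0 * Y 0 * Rs 0 j * (Rs j m * Xs 0 j)"
      using that by (simp add: Rs_append[of 0 j m] mult.assoc)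
    also have "\<dots> = X 0 * (Y 0 * Rs 0 j * Xs 0 j) * Rs j m"
      unfolding 1 by (simp add: mult.assoc)
    also have "\<dots> = Xs 0 (Suc j) * (Rs 0 j * Y j * Rs j m)"
      unfolding Xs_Rs_Y[symmetric] by (simp add: Xs_Cons[of 0 "Suc j"] mult.assoc)
    finally show ?thesis .
  qed
  have 1: "?A ^ j = Xs 0 j * W j" if "j \<le> Suc m" for j
    using that
  proof (induction j)
    case (Suc j)
    have "?A ^ Suc j = ?A * Xs 0 j * W j"
      using Suc by (simp add: mult.assoc)
    also have "\<dots> = Xs 0 (Suc j) * W (Suc j)"
      using Suc.prems move[of j] by (simp add: W_Suc mult.assoc[symmetric])
    finally show ?case .
  qed (simp add: W_0)
  \<comment> \<open>Replacing \<open>j\<close> by \<open>Suc j\<close> lets one more \<open>Y\<close> emerge from \<open>W\<close>; its \<open>R\<close> make up one \<open>Rs 0 m\<close>.\<close>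
  have 2: "Rs 0 m ^ (Suc m - j) * Ys j (Suc m) * W j = Rs 0 m ^ Suc m * Ys 0 (Suc m)"
    if "j \<le> Suc m" for j
    using that
  proof (induction j)
    case (Suc j)
    then have j: "j \<le> m" by simp
    have c1: "Ys (Suc j) (Suc m) * Rs 0 j = Rs 0 j * Ys (Suc j) (Suc m)"
      by (rule Rs_Ys_far[symmetric]) simp
    have c2: "Ys j (Suc m) * Rs j m = Rs j m * Ys j (Suc m)"
      by (rule Rs_Ys[symmetric]) simp_all
    have "Rs 0 m ^ (Suc m - Suc j) * Ys (Suc j) (Suc m) * W (Suc j) =
        Rs 0 m ^ (m - j) * (Ys (Suc j) (Suc m) * Rs 0 j) * Y j * Rs j m * W j"
      by (simp add: W_Suc mult.assoc)
    also have "\<dots> = Rs 0 m ^ (m - j) * Rs 0 j * (Ys j (Suc m) * Rs j m) * W j"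
      unfolding c1 using j by (simp add: Ys_Cons[of j] mult.assoc)
    also have "\<dots> = Rs 0 m ^ (m - j) * (Rs 0 j * Rs j m) * Ys j (Suc m) * W j"
      unfolding c2 by (simp add: mult.assoc)
    also have "\<dots> = Rs 0 m ^ (Suc m - j) * Ys j (Suc m) * W j"
      using j by (simp only: Rs_append[of 0 j m, symmetric] Suc_diff_le power_Suc2 le0)
    finally show ?case using Suc by simp
  qed (simp add: W_0)
  show ?thesis
    unfolding 1[OF order_refl] using 2[of "Suc m"] by (simp add: mult.assoc)
qed

end

section \<open>The coefficients of the antisymmetric tensors\<close>

text \<open>
  The coefficient of \<open>e\<^bsub>u(1)\<^esub> \<otimes> e\<^bsub>u(2)\<^esub> \<otimes> \<cdots>\<close> in an antisymmetric tensor: the product of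
  \<open>- Q x y\<close> over the inversions \<open>x > y\<close> of \<open>u\<close>, and zero if an entry is repeated.  Row vectors
  have \<open>Q x y = q\<^sub>x\<^sub>y\<close> and column vectors \<open>Q x y = q\<^sub>y\<^sub>x\<close>.
\<close>

fun eps :: "('n::linorder \<Rightarrow> 'n \<Rightarrow> 'c::comm_ring_1) \<Rightarrow> 'n list \<Rightarrow> 'c" where
  "eps Q [] = 1"
| "eps Q (x # xs) = (if x \<in> set xs then 0 else (\<Prod>y\<in>{y \<in> set xs. y < x}. - Q x y) * eps Q xs)"

lemma eps_not_distinct: "\<not> distinct u \<Longrightarrow> eps Q u = 0"
  by (induction u) auto

lemma eps_sorted: "sorted u \<Longrightarrow> distinct u \<Longrightarrow> eps Q u = 1"
proof (induction u)
  case (Cons x u)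
  then have "(\<Prod>y\<in>{y \<in> set u. y < x}. - Q x y) = 1"
    by (intro prod.neutral) auto
  then show ?case using Cons by simp
qed simp

lemma eps_swap: "a < b \<Longrightarrow> eps Q (xs @ b # a # ys) = - Q b a * eps Q (xs @ a # b # ys)"
proof (induction xs)
  case Nil
  have 1: "{y \<in> insert a (set ys). y < b} = insert a {y \<in> set ys. y < b}"
    and 2: "{y \<in> insert b (set ys). y < a} = {y \<in> set ys. y < a}"
    using Nil by auto
  show ?case
  proof (cases "a \<in> set ys \<or> b \<in> set ys")
    case False
    then have "(\<Prod>y\<in>{y \<in> set (a # ys). y < b}. - Q b y) = - Q b a * (\<Prod>y\<in>{y \<in> set ys. y < b}. - Q b y)"
      by (simp only: list.set 1) simp
    moreover have "(\<Prod>y\<in>{y \<in> set (b # ys). y < a}. - Q a y) = (\<Prod>y\<in>{y \<in> set ys. y < a}. - Q a y)"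
      by (simp only: list.set 2)
    ultimately show ?thesis using Nil False by (simp only: append_Nil eps.simps) simp
  qed auto
next
  case (Cons x xs)
  have "set (xs @ b # a # ys) = set (xs @ a # b # ys)" by auto
  then show ?case using Cons by (simp only: append_Cons eps.simps) simp
qed

text \<open>
  The first factor collects the inversions between the two parts, which depend only on the sets
  of their entries.
\<close>

lemma eps_append:
  assumes "set u \<inter> set v = {}"
  shows "eps Q (u @ v) = (\<Prod>x\<in>set u. \<Prod>y\<in>{y \<in> set v. y < x}. - Q x y) * (eps Q u * eps Q v)"
  using assms
proof (induction u)
  case (Cons x u)
  show ?case
  proof (cases "x \<in> set u")
    case False
    have "{y \<in> set u \<union> set v. y < x} = {y \<in> set u. y < x} \<union> {y \<in> set v. y < x}" by auto
    moreover have "{y \<in> set u. y < x} \<inter> {y \<in> set v. y < x} = {}" using Cons.prems by auto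
    ultimately show ?thesis using Cons False by (simp add: prod.union_disjoint)
  qed simp
qed simp

text \<open>
  Insertion sort, read backwards.
\<close>

lemma adjacent_swap_induct:
  fixes u :: "'n::linorder list"
  assumes sorted: "\<And>u. sorted u \<Longrightarrow> length u = n \<Longrightarrow> P u"
    and swap: "\<And>xs a b ys. a < b \<Longrightarrow> length (xs @ a # b # ys) = n \<Longrightarrow> P (xs @ a # b # ys) \<Longrightarrow> P (xs @ b # a # ys)"
    and "length u = n"
  shows "P u"
proof -
  have insort: "P (xs @ insort x ys) \<Longrightarrow> length (xs @ x # ys) = n \<Longrightarrow> P (xs @ x # ys)" for xs x ys
  proof (induction ys arbitrary: xs)
    case (Cons y ys)
    show ?case
    proof (cases "x \<le> y")
      case False
      have "P (xs @ y # x # ys)"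
        using Cons.IH[of "xs @ [y]"] Cons.prems False by simp
      then show ?thesis using swap[of y x xs ys] False Cons.prems by simp
    qed (use Cons in simp)
  qed simp
  have "P (xs @ sort ys) \<Longrightarrow> length (xs @ ys) = n \<Longrightarrow> P (xs @ ys)" for xs ys
  proof (induction ys arbitrary: xs)
    case (Cons y ys)
    then have "P ((xs @ [y]) @ sort ys)" using insort[of xs y "sort ys"] by simp
    then show ?case using Cons.IH[of "xs @ [y]"] Cons.prems by simp
  qed simp
  from this[of "[]" u] show ?thesis using sorted[of "sort u"] assms(3) by simp
qed

lemma sorted_not_distinct:
  "sorted u \<Longrightarrow> \<not> distinct u \<Longrightarrow> \<exists>xs a ys. u = xs @ a # a # ys"
proof (induction u)
  case (Cons x u)
  show ?case
  proof (cases "distinct u")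
    case True
    then have "x \<in> set u" using Cons by simp
    then obtain y u' where "u = y # u'" by (cases u) auto
    moreover from this have "x = y" using Cons.prems \<open>x \<in> set u\<close> by (auto intro: antisym)
    ultimately show ?thesis by (metis append_Nil)
  next
    case False
    then obtain xs a ys where "u = xs @ a # a # ys" using Cons by auto
    then show ?thesis by (metis append_Cons)
  qed
qed simp

text \<open>
  The function \<open>eps Q\<close> obeys the same rule for adjacent swaps, and on sorted lists it is \<open>1\<close> or
  \<open>0\<close> according to whether two neighbours are equal.
\<close>

lemma antisymmetric_eq_eps:
  fixes f :: "'n::linorder list \<Rightarrow> 'a::ring_1" and sc :: "'c::comm_ring_1 \<Rightarrow> 'a"
  assumes sc: "sc 0 = 0" "sc 1 = 1" "\<And>a b. sc (a * b) = sc a * sc b"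
    and swap: "\<And>xs a b ys. a < b \<Longrightarrow> length (xs @ a # b # ys) = n \<Longrightarrow>
      f (xs @ b # a # ys) = sc (- Q b a) * f (xs @ a # b # ys)"
    and eq: "\<And>xs a ys. length (xs @ a # a # ys) = n \<Longrightarrow> f (xs @ a # a # ys) = 0"
    and "length u = n"
  shows "f u = sc (eps Q u) * f (sort u)"
proof (rule adjacent_swap_induct[OF _ _ assms(6)])
  fix u :: "'n list"
  assume 1: "sorted u" "length u = n"
  then show "f u = sc (eps Q u) * f (sort u)"
    using sorted_not_distinct[OF 1(1)] eq
    by (cases "distinct u") (auto simp: eps_sorted eps_not_distinct sc sort_key_id_if_sorted)
next
  fix xs a b ys
  assume 2: "a < b" "length (xs @ a # b # ys) = n"
    "f (xs @ a # b # ys) = sc (eps Q (xs @ a # b # ys)) * f (sort (xs @ a # b # ys))"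
  have "mset (xs @ b # a # ys) = mset (xs @ a # b # ys)" by simp
  then have "sort (xs @ b # a # ys) = sort (xs @ a # b # ys)"
    by (metis properties_for_sort mset_sort sorted_sort)
  then show "f (xs @ b # a # ys) = sc (eps Q (xs @ b # a # ys)) * f (sort (xs @ b # a # ys))"
    unfolding eps_swap[OF 2(1)] swap[OF 2(1,2)] 2(3) sc(3) by (simp add: mult.assoc)
qed

subsection \<open>Arrangements of a finite set\<close>

definition arrangements :: "'n set \<Rightarrow> 'n list set" where
  "arrangements J = {u. distinct u \<and> set u = J}"

lemma length_arrangements: "u \<in> arrangements J \<Longrightarrow> length u = card J"
  by (auto simp: arrangements_def distinct_card)

lemma finite_arrangements [simp]: "finite J \<Longrightarrow> finite (arrangements J)"
  by (auto simp: arrangements_def distinct_card intro!: finite_subset[OF _ finite_lists_length_eq[of J "card J"]])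

lemma arrangements_empty [simp]: "arrangements {} = {[]}"
  by (auto simp: arrangements_def)

lemma sum_arrangements:
  fixes g :: "'n list \<Rightarrow> 'b::comm_monoid_add"
  assumes "finite J" "J \<noteq> {}"
  shows "(\<Sum>u\<in>arrangements J. g u) = (\<Sum>x\<in>J. \<Sum>u\<in>arrangements (J - {x}). g (x # u))"
proof -
  have "(\<Sum>x\<in>J. \<Sum>u\<in>arrangements (J - {x}). g (x # u)) =
      (\<Sum>(x, u)\<in>Sigma J (\<lambda>x. arrangements (J - {x})). g (x # u))"
    using assms by (simp add: sum.Sigma)
  also have "\<dots> = (\<Sum>u\<in>arrangements J. g u)"
  proof (rule sum.reindex_bij_witness[of _ "\<lambda>u. (hd u, tl u)" "\<lambda>(x, u). x # u"])
    fix u assume "u \<in> arrangements J"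
    then show "(hd u, tl u) \<in> Sigma J (\<lambda>x. arrangements (J - {x}))"
      "(case (hd u, tl u) of (x, u) \<Rightarrow> x # u) = u"
      using assms by (cases u; auto simp: arrangements_def)+
  next
    fix p assume "p \<in> Sigma J (\<lambda>x. arrangements (J - {x}))"
    then obtain x u where "p = (x, u)" "x \<in> J" "distinct u" "set u = J - {x}"
      by (auto simp: arrangements_def)
    then show "(case p of (x, u) \<Rightarrow> x # u) \<in> arrangements J"
      "(hd (case p of (x, u) \<Rightarrow> x # u), tl (case p of (x, u) \<Rightarrow> x # u)) = p"
      "g (case p of (x, u) \<Rightarrow> x # u) = (case p of (x, u) \<Rightarrow> g (x # u))"
      by (auto simp: arrangements_def)
  qed
  finally show ?thesis ..
qed

text \<open>
  The ranks of the elements of \<open>J\<close> are \<open>0, 1, \<dots>\<close>, each taken once.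
\<close>

lemma sum_power_rank:
  fixes t :: "'c::comm_semiring_1"
  assumes "finite (J :: 'n::linorder set)"
  shows "(\<Sum>x\<in>J. t ^ card {y \<in> J. y < x}) = (\<Sum>k<card J. t ^ k)"
  using assms
proof (induction J rule: finite_linorder_max_induct)
  case (insert b A)
  have "{y \<in> insert b A. y < b} = A" using insert by auto
  moreover have "{y \<in> insert b A. y < x} = {y \<in> A. y < x}" if "x \<in> A" for x
    using that insert by force
  moreover have "b \<notin> A" using insert by auto
  ultimately show ?case using insert by (simp add: add.commute)
qed simp

lemma q_fact_Suc: "q_fact (Suc n) = q_fact n * q_int (Suc n)"
  by (simp add: q_fact_def)

text \<open>
  Each inversion contributes \<open>q\<^sup>2\<close>.  If \<open>x\<close> comes first, its inversions are as many as the
  elements of \<open>J\<close> below \<open>x\<close>; summing over \<open>x\<close> gives the factor \<open>[card J]\<close>, and one continues with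
  \<open>J - {x}\<close>.
\<close>

lemma sum_eps_eps:
  fixes Q Q' :: "'n::{finite,linorder} \<Rightarrow> 'n \<Rightarrow> 'n ratfun"
  assumes "\<And>x y. y < x \<Longrightarrow> Q x y * Q' x y = qq ^ 2"
  shows "(\<Sum>u\<in>arrangements J. eps Q u * eps Q' u) = q_fact (card J)"
proof (induction "card J" arbitrary: J)
  case 0
  then show ?case by (simp add: q_fact_def)
next
  case (Suc n)
  then have ne: "J \<noteq> {}" by auto
  have "(\<Sum>u\<in>arrangements (J - {x}). eps Q (x # u) * eps Q' (x # u)) =
      (qq ^ 2) ^ card {y \<in> J. y < x} * q_fact n" if "x \<in> J" for x
  proof -
    have "eps Q (x # u) * eps Q' (x # u) = (qq ^ 2) ^ card {y \<in> J. y < x} * (eps Q u * eps Q' u)"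
      if u: "u \<in> arrangements (J - {x})" for u
    proof -
      have "{y \<in> set u. y < x} = {y \<in> J. y < x}" "x \<notin> set u"
        using u by (auto simp: arrangements_def)
      moreover have "(\<Prod>y\<in>{y \<in> J. y < x}. - Q x y) * (\<Prod>y\<in>{y \<in> J. y < x}. - Q' x y) =
          (\<Prod>y\<in>{y \<in> J. y < x}. qq ^ 2)"
        unfolding prod.distrib[symmetric] by (rule prod.cong) (simp_all add: assms)
      ultimately show ?thesis
        by (simp add: mult.assoc[symmetric])
    qed
    then show ?thesis
      using Suc(1)[of "J - {x}"] Suc(2)[symmetric] that by (simp add: sum_distrib_left[symmetric] del: eps.simps)
  qed
  then have "(\<Sum>u\<in>arrangements J. eps Q u * eps Q' u) = (\<Sum>x\<in>J. (qq ^ 2) ^ card {y \<in> J. y < x}) * q_fact n"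
    using ne by (simp add: sum_arrangements sum_distrib_right)
  also have "\<dots> = q_fact (card J)"
    unfolding sum_power_rank[OF finite] Suc(2)[symmetric] q_fact_Suc q_int_def
    by (simp only: power_mult mult.commute[of "q_fact n"])
  finally show ?case .
qed

section \<open>Monomials and nonvanishing scalars\<close>

definition monomial_frac :: "('n::{finite,linorder} qvar \<Rightarrow>\<^sub>0 int) \<Rightarrow> complex \<Rightarrow> 'n ratfun" where
  "monomial_frac m c = Fract (Poly_Mapping.single m c) 1"

lemma monomial_frac_mult: "monomial_frac m c * monomial_frac m' c' = monomial_frac (m + m') (c * c')"
  by (simp add: monomial_frac_def mult_single)

lemma monomial_frac_0_1 [simp]: "monomial_frac 0 1 = 1"
  by (simp add: monomial_frac_def One_fract_def)

lemma monomial_frac_inverse: "inverse (monomial_frac m 1) = monomial_frac (- m) 1"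
  by (rule inverse_unique) (simp add: monomial_frac_mult)

lemma monomial_frac_power: "monomial_frac m 1 ^ k = monomial_frac (frag_cmul (int k) m) 1"
proof (induction k)
  case (Suc k)
  then show ?case by (simp add: monomial_frac_mult frag_cmul_distrib add.commute)
qed simp

lemma qq_monomial: "qq = monomial_frac (frag_of qvar_q) 1"
  by (simp add: qq_def rf_var_def monomial_frac_def)

text \<open>
  As a Laurent polynomial it has constant term \<open>1\<close>, because the exponents \<open>0, 2, 4, \<dots>\<close> of \<open>q\<close> are
  distinct.
\<close>

lemma q_int_nonzero:
  assumes "n > 0"
  shows "(q_int n :: 'n::{finite,linorder} ratfun) \<noteq> 0"
proof -
  define p :: "nat \<Rightarrow> 'n laurent" where
    "p n = (\<Sum>k<n. Poly_Mapping.single (frag_cmul (int (2 * k)) (frag_of qvar_q)) 1)" for n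
  have "q_int n = Fract (p n) 1" for n
    by (induction n) (simp_all add: q_int_def p_def Zero_fract_def qq_monomial monomial_frac_power,
      simp add: monomial_frac_def)
  moreover have "frag_cmul k (frag_of (qvar_q :: 'n qvar)) = 0 \<longleftrightarrow> k = 0" for k
  proof
    assume "frag_cmul k (frag_of (qvar_q :: 'n qvar)) = 0"
    then have "Poly_Mapping.lookup (frag_cmul k (frag_of (qvar_q :: 'n qvar))) qvar_q = 0" by simp
    then show "k = 0" by simp
  qed simp
  then have "Poly_Mapping.lookup (p n) 0 = 1"
    using assms by (simp add: p_def lookup_sum lookup_single when_def)
  then have "p n \<noteq> 0" by auto
  ultimately show ?thesis by (simp add: Zero_fract_def eq_fract)
qed

lemma q_fact_nonzero [simp]: "q_fact n \<noteq> 0"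
  by (simp add: q_fact_def q_int_nonzero)

section \<open>Scalar matrices\<close>

lift_definition map_lmat :: "('b::ring_1 \<Rightarrow> 'a::ring_1) \<Rightarrow> ('n::finite, 'b) lmat \<Rightarrow> ('n, 'a) lmat"
  is "\<lambda>h A u w. if length u = length w then h (A u w) else 0"
  by auto

lift_definition diag_lmat :: "'a::ring_1 \<Rightarrow> ('n::finite, 'a) lmat"
  is "\<lambda>c u w. if u = w then c else 0"
  by auto

lemma entry_map_lmat: "entry (map_lmat h A) u w = (if length u = length w then h (entry A u w) else 0)"
  by transfer simp

lemma entry_diag_mult [simp]: "entry (diag_lmat c * A) u w = c * entry A u w"
proof (cases "length u = length w")
  case True
  then show ?thesis
    by (simp add: diag_lmat.rep_eq entry_mult_act act_def if_distrib[of "\<lambda>x. x * _"] cong: if_cong)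
next
  case False
  then show ?thesis by (simp add: entry_diff_length)
qed

lemma entry_mult_diag [simp]: "entry (A * diag_lmat c) u w = entry A u w * c"
proof (cases "length u = length w")
  case True
  then show ?thesis
    by (simp add: diag_lmat.rep_eq entry_mult_ract ract_def if_distrib[of "\<lambda>x. _ * x"] cong: if_cong)
next
  case False
  then show ?thesis by (simp add: entry_diff_length)
qed

lemma diag_lmat_1 [simp]: "diag_lmat 1 = 1"
  by transfer (simp add: tone_def)

lemma on_legs_diag_mult: "on_legs k m (diag_lmat c * A) = diag_lmat c * on_legs k m A"
  by (rule lmat_eqI) (simp add: on_legs.rep_eq)

text \<open>
  Three instances are used: the field of rational functions itself, the algebra, and the free
  algebra.  Identities between scalar matrices are proved in the first, where one can divide, and
  carried over to the second.
\<close>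

locale scalar_hom =
  fixes sc :: "'n::{finite,linorder} ratfun \<Rightarrow> 'a::ring_1"
  assumes sc_0: "sc 0 = 0" and sc_1: "sc 1 = 1"
    and sc_add: "sc (a + b) = sc a + sc b" and sc_mult: "sc (a * b) = sc a * sc b"
    and sc_commute: "sc c * x = x * sc c"
begin

lemma sc_sum: "sc (sum f A) = (\<Sum>x\<in>A. sc (f x))"
  by (induction A rule: infinite_finite_induct) (simp_all add: sc_add sc_0)

lemma sc_cancel:
  assumes "sc c * x = sc c * y" "c \<noteq> 0"
  shows "x = y"
proof -
  have "sc (inverse c) * (sc c * x) = sc (inverse c) * (sc c * y)"
    using assms by simp
  then show ?thesis
    using assms(2) by (simp add: mult.assoc[symmetric] sc_1 flip: sc_mult)
qed

lemma map_lmat_mult: "map_lmat sc (A * B) = map_lmat sc A * (map_lmat sc B :: ('k::finite, 'a) lmat)"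
  by (rule lmat_eqI)
    (simp add: entry_map_lmat entry_mult_act act_def sc_sum sc_mult sc_0)

lemma map_lmat_1: "map_lmat sc 1 = 1"
  by (rule lmat_eqI) (simp add: entry_map_lmat entry_one sc_0 sc_1)

lemma map_lmat_on_legs: "map_lmat sc (on_legs k m A) = on_legs k m (map_lmat sc A)"
  by (rule lmat_eqI) (simp add: on_legs.rep_eq map_lmat.rep_eq sc_0)

lemma map_lmat_diag: "map_lmat sc (diag_lmat c) = diag_lmat (sc c)"
  by (rule lmat_eqI) (simp add: diag_lmat.rep_eq map_lmat.rep_eq sc_0)

lemma map_lmat_prod_list: "map_lmat sc (prod_list As) = prod_list (map (map_lmat sc) As)"
  by (induction As) (simp_all add: map_lmat_mult map_lmat_1)

lemma diag_commute: "diag_lmat (sc c) * A = A * diag_lmat (sc c)"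
  by (rule lmat_eqI) (simp add: sc_commute)

lemma on_legs_scalar_commute:
  assumes "k + m \<le> l \<or> l + p \<le> k"
  shows "on_legs k m (map_lmat sc A) * on_legs l p B = on_legs l p B * on_legs k m (map_lmat sc A)"
proof -
  have 1: "entry (map_lmat sc A) u w * b = b * entry (map_lmat sc A) u w" for u w b
    by (simp add: entry_map_lmat sc_commute)
  then show ?thesis
    using assms on_legs_commute[of k m l "map_lmat sc A" B p]
      on_legs_commute[of l p k B "map_lmat sc A" m] by metis
qed

end

section \<open>The braid generator and the Yang-Baxter equation\<close>

lift_definition Rhat_lmat :: "('n::{finite,linorder}, 'n ratfun) lmat"
  is "\<lambda>u w. if length u = 2 \<and> length w = 2 then Rhat u w else 0"
  by auto

lemma sum_lists_2: "(\<Sum>v | length v = 2. g v) = (\<Sum>c\<in>UNIV. \<Sum>d\<in>UNIV. g [c, d :: 'n::finite])"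
proof -
  have "(\<Sum>c\<in>UNIV. \<Sum>d\<in>UNIV. g [c, d]) = (\<Sum>(c, d)\<in>UNIV. g [c, d])"
    by (simp add: sum.cartesian_product)
  also have "\<dots> = (\<Sum>v | length v = 2. g v)"
    by (rule sum.reindex_bij_witness[of _ "\<lambda>v. (v ! 0, v ! 1)" "\<lambda>(c, d). [c, d]"])
      (auto elim!: length_2_cases)
  finally show ?thesis ..
qed

lemma Rhat_entry: "Rhat [a, b] w = Rmat [b, a] w"
proof -
  have flip: "flip_mat [a, b] v = (if v = [b, a] then 1 else 0)" for v
  proof -
    have "unit2 i j j i [a, b] v = (if i = a then if j = b then if v = [b, a] then 1 else 0 else 0 else 0 :: 'a ratfun)"
      for i j
      by (auto simp: unit2_def)
    moreover have "(\<Sum>j\<in>UNIV. if i = a then if j = b then z else 0 else 0) = (if i = a then z else 0)"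
      for i and z :: "'a ratfun"
      by simp
    ultimately show ?thesis by (simp add: flip_mat_def)
  qed
  show ?thesis
    unfolding Rhat_def tmul_def flip by (simp add: if_distrib[of "\<lambda>x. x * _"] cong: if_cong)
qed

lemma entry_Rhat_lmat:
  "entry Rhat_lmat [a, b] v = (if v = [b, a] then qij b a else 0)
    + (if v = [a, b] then if b < a then 1 - qq ^ 2 else 0 else 0)"
  "entry Rhat_lmat v [a, b] = (if v = [b, a] then qij a b else 0)
    + (if v = [a, b] then if b < a then 1 - qq ^ 2 else 0 else 0)"
proof -
  have *: "entry Rhat_lmat [a, b] [c, d] = (if c = b \<and> d = a then qij b a else 0)
    + (if c = a \<and> d = b then if b < a then 1 - qq ^ 2 else 0 else 0)" for a b c d :: 'a
  proof -
    have "entry Rhat_lmat [a, b] [c, d] = Rmat [b, a] [c, d]"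
      by (simp add: Rhat_lmat.rep_eq Rhat_entry)
    moreover have "(if b < a \<and> c = a \<and> d = b then x else 0) =
        (if c = a \<and> d = b then if b < a then x else 0 else 0)" for x :: "'a ratfun"
      by simp
    ultimately show ?thesis by (simp add: Rmat_entry eq_commute[of a] eq_commute[of b] split del: if_split)
  qed
  have len: "entry Rhat_lmat u v = 0" if "length u \<noteq> 2 \<or> length v \<noteq> 2" for u v :: "'a list"
    using that by (auto simp: Rhat_lmat.rep_eq)
  show "entry Rhat_lmat [a, b] v = (if v = [b, a] then qij b a else 0)
    + (if v = [a, b] then if b < a then 1 - qq ^ 2 else 0 else 0)"
  proof (cases "length v = 2")
    case True
    then obtain c d where v: "v = [c, d]" by (rule length_2_cases)
    show ?thesis unfolding v * by (simp only: list.inject simp_thms)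
  next
    case False
    then have "v \<noteq> [b, a]" "v \<noteq> [a, b]" by auto
    then show ?thesis using False by (simp add: len)
  qed
  show "entry Rhat_lmat v [a, b] = (if v = [b, a] then qij a b else 0)
    + (if v = [a, b] then if b < a then 1 - qq ^ 2 else 0 else 0)"
  proof (cases "length v = 2")
    case True
    then obtain c d where v: "v = [c, d]" by (rule length_2_cases)
    have "(if a = d \<and> b = c then qij d c else 0) = (if c = b \<and> d = a then qij a b else 0)"
      "(if a = c \<and> b = d then if d < c then x else 0 else 0) = (if c = a \<and> d = b then if b < a then x else 0 else 0)"
      for x :: "'a ratfun"
      by (simp_all only: eq_commute[of a] eq_commute[of b] conj_commute cong: if_cong)
    then show ?thesis unfolding v * by (simp only: list.inject simp_thms)
  next
    case False
    then have "v \<noteq> [b, a]" "v \<noteq> [a, b]" by auto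
    then show ?thesis using False by (simp add: len)
  qed
qed

context scalar_hom
begin

text \<open>
  The operator \<open>Rhat\<close> on the legs in positions \<open>k\<close> and \<open>Suc k\<close>, counted from \<open>0\<close>, with its entries
  mapped into the ring.
\<close>

definition Rop :: "nat \<Rightarrow> ('n, 'a) lmat" where
  "Rop k = on_legs k 2 (map_lmat sc Rhat_lmat)"

lemma act_Rop:
  assumes "length x = k"
  shows "act (Rop k) f (x @ a # b # z) = sc (qij b a) * f (x @ b # a # z)
    + (if b < a then sc (1 - qq ^ 2) * f (x @ a # b # z) else 0)"
proof -
  have "act (Rop k) f (x @ [a, b] @ z) = act (map_lmat sc Rhat_lmat) (\<lambda>y. f (x @ y @ z)) [a, b]"
    unfolding Rop_def using assms by (intro act_on_legs) simp_all
  also have "\<dots> = (\<Sum>v | length v = length [a, b].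
      (if v = [b, a] then sc (qij b a) * f (x @ v @ z) else 0)
      + (if v = [a, b] then (if b < a then sc (1 - qq ^ 2) * f (x @ v @ z) else 0) else 0))"
    unfolding act_def by (intro sum.cong refl) (simp add: entry_map_lmat entry_Rhat_lmat(1) sc_0 sc_add distrib_right
        if_distrib[of sc] if_distrib[of "\<lambda>x. x * _"] split del: if_split cong: if_cong)
  also have "\<dots> = sc (qij b a) * f (x @ b # a # z)
      + (if b < a then sc (1 - qq ^ 2) * f (x @ a # b # z) else 0)"
    by (simp only: sum.distrib sum.delta finite_lists_length) simp
  finally show ?thesis by simp
qed

end

interpretation id_hom: scalar_hom "\<lambda>x :: 'n::{finite,linorder} ratfun. x"
  by unfold_locales (auto simp only: mult.commute)

interpretation qalg_hom: scalar_hom "qalg_scal :: 'n::{finite,linorder} ratfun \<Rightarrow> 'n qalg"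
  by unfold_locales (rule qalg_scal_hom qalg_scal_commute)+

text \<open>
  The Yang-Baxter equation on three legs.  Applied to a function of three indices, both sides are
  combinations of its values at the rearrangements of \<open>a, b, c\<close>, and the coefficients are compared
  separately for each way in which the three indices can coincide.
\<close>

lemma braid_3:
  fixes f :: "'n::{finite,linorder} list \<Rightarrow> 'n ratfun"
  assumes "length u = 3"
  shows "act (id_hom.Rop 0) (act (id_hom.Rop 1) (act (id_hom.Rop 0) f)) u =
    act (id_hom.Rop 1) (act (id_hom.Rop 0) (act (id_hom.Rop 1) f)) u"
proof -
  obtain a b c where u: "u = [a, b, c]"
    using assms by (auto simp: numeral_3_eq_3 length_Suc_conv)
  \<comment> \<open>The coefficient of the term of \<open>Rhat\<close> that leaves the indices in place.\<close>
  define g :: "'n \<Rightarrow> 'n \<Rightarrow> 'n ratfun" where "g x y = (if y < x then 1 - qq ^ 2 else 0)" for x y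
  have R0: "act (id_hom.Rop 0) g' [a, b, c] = qij b a * g' [b, a, c] + g a b * g' [a, b, c]"
    for g' and a b c :: 'n
    using id_hom.act_Rop[of "[]" 0 g' a b "[c]"] unfolding g_def
    by (cases "b < a") (simp_all only: append_Nil list.size if_True if_False mult_zero_left simp_thms)
  have R1: "act (id_hom.Rop 1) g' [a, b, c] = qij c b * g' [a, c, b] + g b c * g' [a, b, c]"
    for g' and a b c :: 'n
    using id_hom.act_Rop[of "[a]" 1 g' b c "[]"] unfolding g_def
    by (cases "c < b") (simp_all only: append_Cons append_Nil list.size One_nat_def add_0_left add_Suc_right add_0_right if_True if_False mult_zero_left simp_thms)
  have q: "qij x y * qij y x = qq ^ 2" if "x \<noteq> y" for x y :: 'n
    using qij_mult_qij[OF that] .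
  have q1: "qij x x = 1" for x :: 'n by (simp add: qij_def)
  have gg: "g x x = 0" "g x y * g y x = 0" "g x y * g x y = g x y * (1 - qq ^ 2)" for x y
    by (auto simp: g_def)
  consider "a = b" "b = c" | "a = b" "b \<noteq> c" | "b = c" "a \<noteq> b" | "a = c" "a \<noteq> b" | "a \<noteq> b" "b \<noteq> c" "a \<noteq> c"
    by blast
  then show ?thesis
  proof cases
    case 1
    then show ?thesis unfolding u R0 R1 by (simp add: gg q1)
  next
    case 2
    have k: "g a c * (qij c a * qij a c) + g a c * g a c = g a c"
      unfolding gg(3) q[OF 2(2)[symmetric, folded 2(1)]] by (simp add: algebra_simps)
    have k2: "g a c * (g c a * t) = 0" for t
      using gg(2)[of a c] by (simp add: mult.assoc[symmetric])
    show ?thesis unfolding u R0 R1 2(1)[symmetric] gg(1) q1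
      using arg_cong[OF k, of "\<lambda>t. t * f [a, a, c]"] by (simp add: algebra_simps k2)
  next
    case 3
    have k: "g a b * (qij b a * qij a b) + g a b * g a b = g a b"
      unfolding gg(3) q[OF 3(2)[symmetric]] by (simp add: algebra_simps)
    have k2: "g a b * (g b a * t) = 0" for t
      using gg(2)[of a b] by (simp add: mult.assoc[symmetric])
    show ?thesis unfolding u R0 R1 3(1)[symmetric] gg(1) q1
      using arg_cong[OF k, of "\<lambda>t. t * f [a, b, b]"] by (simp add: algebra_simps k2)
  next
    case 4
    have k2: "g a b * (g b a * t) = 0" for t
      using gg(2)[of a b] by (simp add: mult.assoc[symmetric])
    show ?thesis unfolding u R0 R1 4(1)[symmetric] gg(1) q1 by (simp add: algebra_simps k2)
  next
    case 5
    \<comment> \<open>For distinct indices, these are the coefficients of \<open>f [a, b, c]\<close>, \<open>f [b, a, c]\<close> and \<open>f [a, c, b]\<close>.\<close>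
    have 1: "qij b a * qij a b * g a c + g a b * g a b * g b c = qij c b * qij b c * g a c + g b c * g b c * g a b"
      and 2: "g a c * g b a + g a b * g b c = g b c * g a c"
      and 3: "g a b * g a c = g a c * g c b + g b c * g a b"
      using 5 by (auto simp: q g_def)
    have "qij b a * qij c a * qij c b * f [c, b, a] + qij b a * qij c a * g b c * f [b, c, a]
      + (qij b a * qij a b * g a c + g a b * g a b * g b c) * f [a, b, c]
      + qij b a * (g a c * g b a + g a b * g b c) * f [b, a, c]
      + g a b * qij c b * qij c a * f [c, a, b] + qij c b * (g a b * g a c) * f [a, c, b] =
      qij b a * qij c a * qij c b * f [c, b, a] + qij b a * qij c a * g b c * f [b, c, a]
      + (qij c b * qij b c * g a c + g b c * g b c * g a b) * f [a, b, c]
      + qij b a * (g b c * g a c) * f [b, a, c]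
      + g a b * qij c b * qij c a * f [c, a, b] + qij c b * (g a c * g c b + g b c * g a b) * f [a, c, b]"
      unfolding 1 2 3 ..
    then show ?thesis unfolding u R0 R1 by (simp add: algebra_simps)
  qed
qed

lemma entry_eq_act: "entry A u w = act A (\<lambda>v. entry 1 v w) u"
  using entry_mult_act[of A 1] by simp

lemma act_mult_fun: "act (A * B) f = act A (act B f)"
  by (rule ext) (rule act_mult)

lemma map_lmat_id: "map_lmat (\<lambda>x. x) A = A"
  by (rule lmat_eqI) (simp add: entry_map_lmat)

lemma Rop_braid_id: "id_hom.Rop k * id_hom.Rop (Suc k) * id_hom.Rop k =
  id_hom.Rop (Suc k) * id_hom.Rop k * id_hom.Rop (Suc k)"
proof -
  let ?A = "id_hom.Rop 0 :: ('a, 'a ratfun) lmat" and ?B = "id_hom.Rop 1 :: ('a, 'a ratfun) lmat"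
  have A: "on_legs k 2 Rhat_lmat * on_legs k 3 Z = on_legs k 3 (?A * Z)"
    "on_legs k 3 Z * on_legs k 2 Rhat_lmat = on_legs k 3 (Z * ?A)" for Z
    using on_legs_absorb[of 0 2 3 k] by (simp_all add: id_hom.Rop_def map_lmat_id)
  have B: "on_legs (Suc k) 2 Rhat_lmat = on_legs k 3 ?B"
    by (simp add: id_hom.Rop_def map_lmat_id on_legs_on_legs_end)
  have "on_legs k 3 (?A * ?B * ?A) = on_legs k 3 (?B * ?A * ?B)"
  proof (rule on_legs_cong)
    fix u w :: "'a list"
    assume "length u = 3"
    then show "entry (?A * ?B * ?A) u w = entry (?B * ?A * ?B) u w"
      using braid_3[of u] by (simp add: entry_eq_act[of _ u] act_mult_fun)
  qed
  then show ?thesis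
    unfolding id_hom.Rop_def[of k] id_hom.Rop_def[of "Suc k"] map_lmat_id B A
    by (simp add: A flip: on_legs_mult)
qed

context scalar_hom
begin

lemma Rop_eq_map: "Rop k = map_lmat sc (id_hom.Rop k)"
  by (simp add: Rop_def id_hom.Rop_def map_lmat_on_legs map_lmat_id)

lemma Rop_braid: "Rop k * Rop (Suc k) * Rop k = Rop (Suc k) * Rop k * Rop (Suc k)"
  by (simp add: Rop_eq_map Rop_braid_id flip: map_lmat_mult)

lemma Rop_far: "Suc k < l \<Longrightarrow> Rop k * Rop l = Rop l * Rop k"
  unfolding Rop_def by (rule on_legs_scalar_commute) simp

end

text \<open>
  Over the field of scalars there is no \<open>X\<close> and no \<open>Y\<close>.  Trivial ones satisfy the relations and
  leave the calculus of words in the \<open>R\<^sub>k\<close>.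
\<close>

interpretation scalar_braid:
  braid_relations "id_hom.Rop :: nat \<Rightarrow> ('n::{finite,linorder}, 'n ratfun) lmat" "\<lambda>_. 1" "\<lambda>_. 1"
  by unfold_locales (auto simp: Rop_braid_id intro: id_hom.Rop_far)

section \<open>Antisymmetric vectors\<close>

abbreviation eps_u :: "'n::{finite,linorder} list \<Rightarrow> 'n ratfun" where
  "eps_u \<equiv> eps (\<lambda>x y. qij y x)"

abbreviation eps_v :: "'n::{finite,linorder} list \<Rightarrow> 'n ratfun" where
  "eps_v \<equiv> eps qij"

lemma one_plus_qq2_nonzero: "1 + qq ^ 2 \<noteq> (0 :: 'n::{finite,linorder} ratfun)"
  using q_int_nonzero[of 2, where 'n = 'n] by (simp add: q_int_def numeral_2_eq_2)

context scalar_hom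
begin

lemma sc_minus: "sc (- a) = - sc a"
proof -
  have "sc (- a) + sc a = 0" unfolding sc_add[symmetric] by (simp add: sc_0)
  then show ?thesis by (rule eq_neg_iff_add_eq_0[THEN iffD2])
qed

lemma eq_0_if_eigen: "x = sc (- (qq ^ 2)) * x \<Longrightarrow> x = 0"
proof -
  assume *: "x = sc (- (qq ^ 2)) * x"
  have "sc (1 + qq ^ 2) * x = x + sc (qq ^ 2) * x"
    by (simp add: sc_add sc_1 distrib_right)
  also have "\<dots> = sc (1 + qq ^ 2) * 0"
    by (subst * ) (simp add: sc_minus sc_add sc_1)
  finally show ?thesis using sc_cancel one_plus_qq2_nonzero by blast
qed

text \<open>
  For \<open>a < b\<close> the eigenvalue equation at a list containing \<open>a, b\<close> in adjacent places has only one term on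
  the left and is the rule for swapping them; for \<open>a = b\<close> it reads \<open>f = - q\<^sup>2 f\<close>, and
  \<open>1 + q\<^sup>2\<close> is invertible.
\<close>

lemma act_eigen_eq_eps_u:
  assumes eigen: "\<And>k u. Suc k < n \<Longrightarrow> length u = n \<Longrightarrow> act (Rop k) f u = sc (- (qq ^ 2)) * f u"
    and "length u = n"
  shows "f u = sc (eps_u u) * f (sort u)"
proof (rule antisymmetric_eq_eps[OF sc_0 sc_1 sc_mult _ _ assms(2)])
  fix xs a b ys
  assume ab: "a < b" and len: "length (xs @ a # b # ys :: 'n list) = n"
  have "sc (qij b a) * f (xs @ b # a # ys) = sc (- (qq ^ 2)) * f (xs @ a # b # ys)"
    using eigen[of "length xs" "xs @ a # b # ys"] len less_not_sym[OF ab] by (simp add: act_Rop)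
  also have "- (qq ^ 2) = qij b a * - qij a b"
    using qij_mult_qij[of b a] ab by simp
  finally show "f (xs @ b # a # ys) = sc (- qij a b) * f (xs @ a # b # ys)"
    unfolding sc_mult mult.assoc by (rule sc_cancel) simp
next
  fix xs a ys
  assume len: "length (xs @ a # a # ys :: 'n list) = n"
  have "f (xs @ a # a # ys) = sc (- (qq ^ 2)) * f (xs @ a # a # ys)"
    using eigen[of "length xs" "xs @ a # a # ys"] len by (simp add: act_Rop qij_def sc_1)
  then show "f (xs @ a # a # ys) = 0" by (rule eq_0_if_eigen)
qed

end

lemma nth_split_2:
  assumes "Suc k < length u"
  obtains x a b z where "u = x @ a # b # z" "length x = k"
proof
  show "u = take k u @ u ! k # u ! Suc k # drop (Suc (Suc k)) u"
    using assms by (metis Cons_nth_drop_Suc Suc_lessD append_take_drop_id)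
qed (use assms in simp)

text \<open>
  The factor \<open>g\<close> is arbitrary since \<open>R\<^sub>k\<close> does not change the set of indices.  Choosing it
  as an indicator function gives the vectors \<open>u\<^sub>J\<close>.
\<close>

lemma act_Rop_eps_u:
  fixes g :: "'n::{finite,linorder} set \<Rightarrow> 'n ratfun"
  assumes "Suc k < length u"
  shows "act (id_hom.Rop k) (\<lambda>u. eps_u u * g (set u)) u = - (qq ^ 2) * (eps_u u * g (set u))"
proof -
  obtain x a b z where u: "u = x @ a # b # z" "length x = k"
    using assms by (rule nth_split_2)
  have set: "set (x @ b # a # z) = set (x @ a # b # z)" by auto
  have act: "act (id_hom.Rop k) (\<lambda>u. eps_u u * g (set u)) u = (qij b a * eps_u (x @ b # a # z)
    + (if b < a then (1 - qq ^ 2) * eps_u (x @ a # b # z) else 0)) * g (set u)"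
    unfolding u(1) id_hom.act_Rop[OF u(2)] set by (simp add: algebra_simps)
  consider "a = b" | "a < b" | "b < a" by force
  then have "qij b a * eps_u (x @ b # a # z) + (if b < a then (1 - qq ^ 2) * eps_u (x @ a # b # z) else 0)
    = - (qq ^ 2) * eps_u u"
  proof cases
    case 1
    then show ?thesis by (simp add: eps_not_distinct u)
  next
    case 2
    then show ?thesis
      using qij_mult_qij[of b a] less_not_sym[OF 2] by (simp add: u eps_swap[OF 2] mult.assoc[symmetric])
  next
    case 3
    then show ?thesis
      using qij_mult_qij[of b a] by (simp add: u eps_swap[OF 3] mult.assoc[symmetric])
        (simp add: algebra_simps)
  qed
  then show ?thesis unfolding act by simp
qed

lemma rf_star_eps: "rf_star (eps Q u) = eps (\<lambda>x y. rf_star (Q x y)) u"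
proof (induction u)
  case (Cons x u)
  have "rf_star (prod f A) = (\<Prod>x\<in>A. rf_star (f x))" for f :: "'b \<Rightarrow> 'a ratfun" and A
    by (induction A rule: infinite_finite_induct) (simp_all add: rf_star_mult)
  then show ?case using Cons by (simp add: rf_star_mult rf_star_minus)
qed simp

lemma rf_star_eps_u [simp]: "rf_star (eps_u u) = eps_v u" and rf_star_eps_v [simp]: "rf_star (eps_v u) = eps_u u"
  by (simp_all add: rf_star_eps rf_star_qij)

subsection \<open>The antisymmetrizer\<close>

text \<open>
  On each tensor power this is the sum of \<open>u\<^sub>J v\<^sub>J\<close> over the sets \<open>J\<close>; it is \<open>[n]!\<close> times a projection to the
  antisymmetric tensors.
\<close>

lift_definition antisym :: "('n::{finite,linorder}, 'n ratfun) lmat"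
  is "\<lambda>u w. if length u = length w \<and> set u = set w then eps_u u * eps_v w else 0"
  by auto

lemma entry_antisym: "length u = length w \<Longrightarrow>
    entry antisym u w = (if set u = set w then eps_u u * eps_v w else 0)"
  by (simp add: antisym.rep_eq)

lemma Rop_antisym:
  assumes "Suc k < length u"
  shows "entry (id_hom.Rop k * antisym) u w = - (qq ^ 2) * entry antisym u w"
proof (cases "length u = length w")
  case True
  have "entry (id_hom.Rop k * antisym) u w =
      act (id_hom.Rop k) (\<lambda>u. eps_u u * (if set u = set w then eps_v w else 0)) u"
    unfolding entry_mult_act using True by (intro act_cong) (simp add: entry_antisym)
  also have "\<dots> = - (qq ^ 2) * entry antisym u w"
    using act_Rop_eps_u[OF assms, of "\<lambda>U. if U = set w then eps_v w else 0"] True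
    by (simp add: entry_antisym)
  finally show ?thesis .
next
  case False
  then show ?thesis by (simp add: entry_diff_length)
qed

lemma sum_eps_v_eps_u: "(\<Sum>u\<in>arrangements J. eps_v u * eps_u u) = q_fact (card J)"
  by (rule sum_eps_eps) (metis less_irrefl qij_mult_qij)

lemma sum_permutations:
  fixes u :: "'n::finite list"
  assumes "distinct u"
  shows "(\<Sum>v | length v = length u. if set v = set u then g v else 0) = (\<Sum>v\<in>arrangements (set u). g v)"
proof (rule sum.mono_neutral_cong_right)
  show "arrangements (set u) \<subseteq> {v. length v = length u}"
    using assms by (auto simp: length_arrangements distinct_card)
  show "\<forall>v\<in>{v. length v = length u} - arrangements (set u). (if set v = set u then g v else 0) = 0"
    using assms by (auto simp: arrangements_def) (metis card_distinct distinct_card)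
qed (auto simp: arrangements_def)

lemma sort_arrangement: "u \<in> arrangements (set v) \<Longrightarrow> distinct v \<Longrightarrow> sort u = sort v"
  by (simp add: arrangements_def) (metis sorted_list_of_set_sort_remdups distinct_remdups_id)

text \<open>
  By \<open>act_eigen_eq_eps_u\<close> the vector is a combination of the \<open>u\<^sub>J\<close>, and
  \<open>v\<^sub>J u\<^sub>J = [n]!\<close>.
\<close>

lemma antisym_act_eigen:
  assumes eigen: "\<And>k u. Suc k < n \<Longrightarrow> length u = n \<Longrightarrow> act (id_hom.Rop k) f u = - (qq ^ 2) * f u"
    and u: "length u = n"
  shows "act antisym f u = q_fact n * f u"
proof -
  have f: "f v = eps_u v * f (sort v)" if "length v = n" for v
    using id_hom.act_eigen_eq_eps_u[OF eigen that] by simp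
  show ?thesis
  proof (cases "distinct u")
    case True
    have "act antisym f u = (\<Sum>v | length v = length u. if set v = set u then eps_u u * eps_v v * f v else 0)"
      unfolding act_def by (intro sum.cong refl) (auto simp: entry_antisym)
    also have "\<dots> = (\<Sum>v\<in>arrangements (set u). eps_u u * eps_v v * f v)"
      by (rule sum_permutations[OF True])
    also have "\<dots> = (\<Sum>v\<in>arrangements (set u). (eps_v v * eps_u v) * (eps_u u * f (sort u)))"
    proof (intro sum.cong refl)
      fix v assume v: "v \<in> arrangements (set u)"
      then have "length v = n" using True u by (simp add: length_arrangements distinct_card)
      then show "eps_u u * eps_v v * f v = (eps_v v * eps_u v) * (eps_u u * f (sort u))"
        using f[of v] sort_arrangement[OF v True] by (simp add: mult.assoc mult.left_commute)
    qed
    also have "\<dots> = q_fact n * f u"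
      unfolding sum_distrib_right[symmetric] sum_eps_v_eps_u using f[OF u] True u by (simp add: distinct_card)
    finally show ?thesis .
  next
    case False
    then show ?thesis using f[OF u] by (auto simp: act_def entry_antisym eps_not_distinct intro!: sum.neutral)
  qed
qed

lemma on_legs_Rop:
  assumes "Suc k < n"
  shows "id_hom.Rop (j + k) * on_legs j n A = on_legs j n (id_hom.Rop k * A)"
    and "on_legs j n A * id_hom.Rop (j + k) = on_legs j n (A * id_hom.Rop k)"
  using assms on_legs_absorb[of k 2 n j] by (simp_all add: id_hom.Rop_def)

text \<open>
  Both \<open>R\<^sub>k\<close> and the antisymmetrizer are fixed by the adjoint with respect to the involution of the
  scalars.  Statements on rows therefore follow from those on columns.
\<close>

lift_definition adjoint :: "('n::{finite,linorder}, 'n ratfun) lmat \<Rightarrow> ('n, 'n ratfun) lmat"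
  is "\<lambda>A u w. rf_star (A w u)"
  by auto

lemma rf_star_sum: "rf_star (sum f A) = (\<Sum>x\<in>A. rf_star (f x))"
  by (induction A rule: infinite_finite_induct) (simp_all add: rf_star_add)

lemma adjoint_adjoint [simp]: "adjoint (adjoint A) = A"
  by transfer simp

lemma adjoint_mult: "adjoint (A * B) = adjoint B * adjoint A"
  by (rule lmat_eqI)
    (simp add: adjoint.rep_eq entry_mult[OF refl] tmul_def rf_star_sum rf_star_mult mult.commute)

lemma adjoint_1 [simp]: "adjoint 1 = 1"
  by (rule lmat_eqI) (simp add: adjoint.rep_eq entry_one)

lemma adjoint_diag: "adjoint (diag_lmat c) = diag_lmat (rf_star c)"
  by (rule lmat_eqI) (simp add: adjoint.rep_eq diag_lmat.rep_eq)

lemma adjoint_on_legs: "adjoint (on_legs k m A) = on_legs k m (adjoint A)"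
  by (rule lmat_eqI) (auto simp: adjoint.rep_eq on_legs.rep_eq)

lemma adjoint_Rop: "adjoint (id_hom.Rop k) = id_hom.Rop k"
proof -
  have "rf_star (1 - qq ^ 2) = (1 - qq ^ 2 :: 'a ratfun)"
    by (simp add: rf_star_diff power2_eq_square rf_star_mult)
  then have "rf_star (entry Rhat_lmat v [a, b]) = entry Rhat_lmat [a, b] v" for v :: "'a list" and a b
    unfolding entry_Rhat_lmat rf_star_add
    by (simp add: if_distrib[of rf_star] rf_star_qij split del: if_split cong: if_cong)
  then have "on_legs k 2 (adjoint Rhat_lmat) = on_legs k 2 (Rhat_lmat :: ('a, 'a ratfun) lmat)"
    by (intro on_legs_cong) (auto simp: adjoint.rep_eq elim!: length_2_cases)
  then show ?thesis by (simp add: id_hom.Rop_def map_lmat_id adjoint_on_legs)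
qed

lemma adjoint_antisym: "adjoint antisym = antisym"
  by (rule lmat_eqI) (auto simp: adjoint.rep_eq entry_antisym rf_star_mult)

lemma adjoint_diag_mult:
  assumes "rf_star c = c"
  shows "adjoint (diag_lmat c * A) = diag_lmat c * adjoint A"
  by (simp add: adjoint_mult adjoint_diag assms id_hom.diag_commute)

lemma rf_star_minus_qq2: "rf_star (- (qq ^ 2)) = - (qq ^ 2)"
  by (simp add: rf_star_minus power2_eq_square rf_star_mult)

lemma rf_star_q_fact: "rf_star (q_fact n) = q_fact n"
proof -
  have "rf_star (qq ^ k) = (qq ^ k :: 'a ratfun)" for k
    by (induction k) (simp_all add: rf_star_mult)
  then have "rf_star (q_int k) = (q_int k :: 'a ratfun)" for k by (simp add: q_int_def rf_star_sum)
  then show ?thesis by (induction n) (simp_all add: q_fact_Suc rf_star_mult, simp add: q_fact_def)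
qed

lemma Rop_on_legs_antisym:
  assumes "Suc k < n"
  shows "id_hom.Rop (j + k) * on_legs j n antisym = diag_lmat (- (qq ^ 2)) * on_legs j n antisym"
    and "on_legs j n antisym * id_hom.Rop (j + k) = diag_lmat (- (qq ^ 2)) * on_legs j n antisym"
proof -
  show *: "id_hom.Rop (j + k) * on_legs j n antisym = diag_lmat (- (qq ^ 2)) * on_legs j n antisym"
    for j
    unfolding on_legs_Rop[OF assms] on_legs_diag_mult[symmetric]
    using assms by (intro on_legs_cong) (simp add: Rop_antisym)
  show "on_legs j n antisym * id_hom.Rop (j + k) = diag_lmat (- (qq ^ 2)) * on_legs j n antisym"
    using arg_cong[OF *[of j], of adjoint] unfolding adjoint_diag_mult[OF rf_star_minus_qq2]
    by (simp only: adjoint_mult adjoint_on_legs adjoint_Rop adjoint_antisym)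
qed

lemma on_legs_antisym_mult_eigen:
  assumes eigen: "\<And>k. Suc k < n \<Longrightarrow> id_hom.Rop (j + k) * N = diag_lmat (- (qq ^ 2)) * N"
    and short: "on_legs j n 1 * N = N"
  shows "on_legs j n antisym * N = diag_lmat (q_fact n) * N"
proof (rule lmat_eqI)
  fix u w :: "'a list"
  show "entry (on_legs j n antisym * N) u w = entry (diag_lmat (q_fact n) * N) u w"
  proof (cases "j + n \<le> length u")
    case True
    then obtain x y z where u: "u = x @ y @ z" "length x = j" "length y = n"
      by (rule split_list_lengths)
    have "act (id_hom.Rop k) (\<lambda>y. entry N (x @ y @ z) w) y = - (qq ^ 2) * entry N (x @ y @ z) w"
      if k: "Suc k < n" and y: "length y = n" for k y
    proof -
      have "id_hom.Rop (j + k) * N = on_legs j n (id_hom.Rop k) * N"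
        using k short by (simp add: id_hom.Rop_def on_legs_on_legs(1) mult.assoc)
      then have "entry (on_legs j n (id_hom.Rop k) * N) (x @ y @ z) w = - (qq ^ 2) * entry N (x @ y @ z) w"
        using eigen[OF k] by (metis entry_diag_mult)
      then have "act (on_legs j n (id_hom.Rop k)) (\<lambda>v. entry N v w) (x @ y @ z) = - (qq ^ 2) * entry N (x @ y @ z) w"
        unfolding entry_mult_act .
      then show ?thesis unfolding act_on_legs[OF u(2) y] .
    qed
    then show ?thesis
      unfolding entry_mult_act[of "on_legs j n antisym"] u(1) act_on_legs[OF u(2,3)]
      using antisym_act_eigen[of n "\<lambda>y. entry N (x @ y @ z) w" y] u(3) by simp
  next
    case False
    then have "entry N u w = 0"
      using arg_cong[OF short, of "\<lambda>M. entry M u w"]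
      by (simp add: entry_mult_act act_def entry_on_legs_one cong: if_cong)
    then show ?thesis using False by (simp add: entry_mult_act[of "on_legs j n antisym"] act_on_legs_short)
  qed
qed

lemma mult_on_legs_antisym_eigen:
  assumes eigen: "\<And>k. Suc k < n \<Longrightarrow> N * id_hom.Rop (j + k) = diag_lmat (- (qq ^ 2)) * N"
    and short: "N * on_legs j n 1 = N"
  shows "N * on_legs j n antisym = diag_lmat (q_fact n) * N"
proof -
  have "on_legs j n antisym * adjoint N = diag_lmat (q_fact n) * adjoint N"
  proof (rule on_legs_antisym_mult_eigen)
    show "id_hom.Rop (j + k) * adjoint N = diag_lmat (- (qq ^ 2)) * adjoint N" if "Suc k < n" for k
      using arg_cong[OF eigen[OF that], of adjoint] unfolding adjoint_diag_mult[OF rf_star_minus_qq2]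
      by (simp only: adjoint_mult adjoint_Rop)
    show "on_legs j n 1 * adjoint N = adjoint N"
      using arg_cong[OF short, of adjoint] by (simp only: adjoint_mult adjoint_on_legs adjoint_1)
  qed
  from arg_cong[OF this, of adjoint] show ?thesis
    unfolding adjoint_diag_mult[OF rf_star_q_fact]
    by (simp only: adjoint_mult adjoint_on_legs adjoint_antisym adjoint_adjoint)
qed

lemma Rs_on_legs_one:
  assumes "k < n"
  shows "on_legs 0 (Suc n) 1 * scalar_braid.Rs k n = (scalar_braid.Rs k n :: ('n::{finite,linorder}, 'n ratfun) lmat)"
    and "scalar_braid.Rs k n * on_legs 0 (Suc n) 1 = (scalar_braid.Rs k n :: ('n, 'n ratfun) lmat)"
proof -
  obtain m where n: "n = Suc m" "k \<le> m" using assms by (cases n) auto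
  have "scalar_braid.Rs k n = (scalar_braid.Rs k m * id_hom.Rop m :: ('n, 'n ratfun) lmat)"
    using n by (simp add: scalar_braid.Rs_Suc)
  moreover have "id_hom.Rop m * on_legs 0 (Suc n) 1 = (id_hom.Rop m :: ('n, 'n ratfun) lmat)"
    unfolding id_hom.Rop_def n by (rule on_legs_one_mult) simp
  ultimately show *: "scalar_braid.Rs k n * on_legs 0 (Suc n) 1 = (scalar_braid.Rs k n :: ('n, 'n ratfun) lmat)"
    by (simp add: mult.assoc)
  show "on_legs 0 (Suc n) 1 * scalar_braid.Rs k n = (scalar_braid.Rs k n :: ('n, 'n ratfun) lmat)"
    unfolding on_legs_one_central * ..
qed

text \<open>
  Carrying a strand across \<open>n\<close> others commutes with antisymmetrizing them.  Write \<open>C\<close> for the crossing and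
  \<open>L\<close>, \<open>R\<close> for the antisymmetrizer on the last and on the first \<open>n\<close> legs.  The columns of
  \<open>C R\<close> are antisymmetric in the last \<open>n\<close> legs by \<open>Rs_shift\<close>, so \<open>L C R = [n]! C R\<close>; the rows of
  \<open>L C\<close> are antisymmetric in the first \<open>n\<close> legs, so \<open>L C R = [n]! L C\<close>.
\<close>

lemma antisym_cross:
  assumes "n > 0"
  shows "on_legs 1 n antisym * scalar_braid.Rs 0 n = scalar_braid.Rs 0 n * on_legs 0 n antisym"
proof -
  let ?C = "scalar_braid.Rs 0 n :: ('a, 'a ratfun) lmat"
    and ?L = "on_legs 1 n antisym" and ?R = "on_legs 0 n antisym"
  have CC: "diag_lmat c * A = A * diag_lmat c" for c and A :: "('a, 'a ratfun) lmat"
    using id_hom.diag_commute .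
  have one: "on_legs 1 n 1 * ?C = ?C" "?C * on_legs 0 n 1 = ?C"
  proof -
    have "on_legs 1 n 1 * (on_legs 0 (Suc n) 1 * ?C) = on_legs 0 (Suc n) 1 * ?C"
      by (simp add: on_legs_one_mult(1) mult.assoc[symmetric])
    then show "on_legs 1 n 1 * ?C = ?C" unfolding Rs_on_legs_one[OF assms] .
    have "?C * on_legs 0 (Suc n) 1 * on_legs 0 n 1 = ?C * on_legs 0 (Suc n) 1"
      by (simp add: on_legs_one_mult(2) mult.assoc)
    then show "?C * on_legs 0 n 1 = ?C" unfolding Rs_on_legs_one[OF assms] .
  qed
  have "?L * (?C * ?R) = diag_lmat (q_fact n) * (?C * ?R)"
  proof (rule on_legs_antisym_mult_eigen)
    fix k assume k: "Suc k < n"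
    have "id_hom.Rop (1 + k) * (?C * ?R) = ?C * (id_hom.Rop (0 + k) * ?R)"
      using k by (simp add: scalar_braid.Rs_shift mult.assoc[symmetric])
    also have "\<dots> = diag_lmat (- (qq ^ 2)) * (?C * ?R)"
      unfolding Rop_on_legs_antisym[OF k] mult.assoc[symmetric] CC[symmetric, of ?C] ..
    finally show "id_hom.Rop (1 + k) * (?C * ?R) = diag_lmat (- (qq ^ 2)) * (?C * ?R)" .
  qed (simp add: one[unfolded One_nat_def] mult.assoc[symmetric])
  moreover have "(?L * ?C) * ?R = diag_lmat (q_fact n) * (?L * ?C)"
  proof (rule mult_on_legs_antisym_eigen)
    fix k assume k: "Suc k < n"
    have "(?L * ?C) * id_hom.Rop (0 + k) = (?L * id_hom.Rop (1 + k)) * ?C"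
      using k by (simp add: scalar_braid.Rs_shift[symmetric] mult.assoc)
    also have "\<dots> = diag_lmat (- (qq ^ 2)) * (?L * ?C)"
      unfolding Rop_on_legs_antisym[OF k] mult.assoc ..
    finally show "(?L * ?C) * id_hom.Rop (0 + k) = diag_lmat (- (qq ^ 2)) * (?L * ?C)" .
  qed (simp add: one[unfolded One_nat_def] mult.assoc)
  ultimately have eq: "diag_lmat (q_fact n) * (?L * ?C) = diag_lmat (q_fact n) * (?C * ?R)"
    by (simp only: mult.assoc)
  show ?thesis
  proof (rule lmat_eqI)
    fix u w :: "'a list"
    show "entry (?L * ?C) u w = entry (?C * ?R) u w"
      using arg_cong[OF eq, of "\<lambda>M. entry M u w"] by simp
  qed
qed

section \<open>The generating matrices on tensor powers\<close>

text \<open>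
  On the \<open>n\<close>-th tensor power these are \<open>X\<^sub>1 \<cdots> X\<^sub>n\<close> and \<open>Y\<^sub>n \<cdots> Y\<^sub>1\<close>, as \<open>Xs_eq_on_legs\<close> and
  \<open>Ys_eq_on_legs\<close> confirm.  On the first power they are the generating matrices themselves.
\<close>

lift_definition X_lmat :: "('n::{finite,linorder}, 'n qalg) lmat"
  is "\<lambda>u w. if length u = length w then prod_list (map2 qalg_X u w) else 0"
  by auto

lift_definition Y_lmat :: "('n::{finite,linorder}, 'n qalg) lmat"
  is "\<lambda>u w. if length u = length w then prod_list (rev (map2 qalg_Y u w)) else 0"
  by auto

lemma on_legs_eq_beside:
  assumes "\<And>a b c d. length a = m \<Longrightarrow> length c = m \<Longrightarrow> length b = p \<Longrightarrow> length d = p \<Longrightarrow>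
    entry M (a @ b) (c @ d) = entry A a c * entry B b d"
  shows "on_legs k (m + p) M = on_legs k m A * on_legs (k + m) p B"
proof -
  have "on_legs k (m + p) M = on_legs k (m + p) (on_legs 0 m A * on_legs m p B)"
  proof (rule on_legs_cong)
    fix u w :: "'a list"
    assume "length u = m + p" "length w = m + p"
    then obtain a b c d where "u = a @ b" "length a = m" "length b = p" "w = c @ d" "length c = m" "length d = p"
      by (metis append_take_drop_id length_drop length_take add_diff_cancel_left' le_add1 min.absorb2)
    then show "entry M u w = entry (on_legs 0 m A * on_legs m p B) u w"
      by (simp add: assms entry_mult_beside)
  qed
  also have "\<dots> = on_legs k m A * (on_legs k (m + p) 1 * on_legs (k + m) p B)"
    by (simp add: on_legs_mult on_legs_on_legs(1)[of 0] on_legs_on_legs_end mult.assoc)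
  finally show ?thesis by (simp add: on_legs_one_mult)
qed

lemma on_legs_eq_beside_rev:
  assumes "\<And>a b c d. length a = m \<Longrightarrow> length c = m \<Longrightarrow> length b = p \<Longrightarrow> length d = p \<Longrightarrow>
    entry M (a @ b) (c @ d) = entry B b d * entry A a c"
  shows "on_legs k (m + p) M = on_legs (k + m) p B * on_legs k m A"
proof -
  have "on_legs k (m + p) M = on_legs k (m + p) (on_legs m p B * on_legs 0 m A)"
  proof (rule on_legs_cong)
    fix u w :: "'a list"
    assume "length u = m + p" "length w = m + p"
    then obtain a b c d where "u = a @ b" "length a = m" "length b = p" "w = c @ d" "length c = m" "length d = p"
      by (metis append_take_drop_id length_drop length_take add_diff_cancel_left' le_add1 min.absorb2)
    then show "entry M u w = entry (on_legs m p B * on_legs 0 m A) u w"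
      by (simp add: assms entry_mult_beside)
  qed
  also have "\<dots> = (on_legs (k + m) p B * on_legs k (m + p) 1) * on_legs k m A"
    by (simp add: on_legs_mult on_legs_on_legs(2)[of 0] on_legs_on_legs_end mult.assoc)
  finally show ?thesis by (simp add: on_legs_one_mult)
qed

lemma on_legs_X_add: "on_legs k (m + p) X_lmat = on_legs k m X_lmat * on_legs (k + m) p X_lmat"
  by (rule on_legs_eq_beside) (simp add: X_lmat.rep_eq)

lemma on_legs_Y_add: "on_legs k (m + p) Y_lmat = on_legs (k + m) p Y_lmat * on_legs k m Y_lmat"
  by (rule on_legs_eq_beside_rev) (simp add: Y_lmat.rep_eq)

lemma entry_2:
  "entry (on_legs 0 1 A * on_legs (Suc 0) 1 B) [a, b] [c, d] = entry A [a] [c] * entry B [b] [d]"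
  "entry (on_legs (Suc 0) 1 B * on_legs 0 1 A) [a, b] [c, d] = entry B [b] [d] * entry A [a] [c]"
  using entry_mult_beside(1)[of "[a]" 1 "[c]" "[b]" 1 "[d]" A B]
    entry_mult_beside(2)[of "[a]" 1 "[c]" "[b]" 1 "[d]" B A] by simp_all

lemma entry_leg_2:
  "entry (on_legs 0 1 A) [a, b] [c, d] = (if b = d then entry A [a] [c] else 0)"
  "entry (on_legs (Suc 0) 1 A) [a, b] [c, d] = (if a = c then entry A [b] [d] else 0)"
  using entry_on_legs[of "[]" 0 "[a]" 1 "[]" "[c]" A "[b]" "[d]"]
    entry_on_legs[of "[a]" "Suc 0" "[b]" 1 "[c]" "[d]" A "[]" "[]"] by simp_all

lemma tmul_2: "tmul 2 A B [a, b] [c, d] = (\<Sum>e\<in>UNIV. \<Sum>f\<in>UNIV. A [a, b] [e, f] * B [e, f] [c, d])"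
  by (simp add: tmul_def sum_lists_2)

lemma tmul_leg_2:
  fixes M N :: "'n::finite \<Rightarrow> 'n \<Rightarrow> 'a::ring_1"
  shows "tmul 2 (leg 1 M) (leg 2 N) [a, b] [c, d] = M a c * N b d"
    and "tmul 2 (leg 2 N) (leg 1 M) [a, b] [c, d] = N b d * M a c"
proof -
  have *: "(\<Sum>f\<in>UNIV. if P then if f = y then z f else 0 else 0) = (if P then z y else 0)"
    for P y and z :: "'n \<Rightarrow> 'a"
    by simp
  have "tmul 2 (leg 1 M) (leg 2 N) [a, b] [c, d] =
      (\<Sum>e\<in>UNIV. \<Sum>f\<in>UNIV. if e = c then if f = b then M a e * N f d else 0 else 0)"
    unfolding tmul_2 by (intro sum.cong refl) (auto simp: leg_12_entry)
  then show "tmul 2 (leg 1 M) (leg 2 N) [a, b] [c, d] = M a c * N b d"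
    unfolding * by simp
  have "tmul 2 (leg 2 N) (leg 1 M) [a, b] [c, d] =
      (\<Sum>e\<in>UNIV. \<Sum>f\<in>UNIV. if e = a then if f = d then N b f * M e c else 0 else 0)"
    unfolding tmul_2 by (intro sum.cong refl) (auto simp: leg_12_entry)
  then show "tmul 2 (leg 2 N) (leg 1 M) [a, b] [c, d] = N b d * M a c"
    unfolding * by simp
qed

lemma relation_XX_entry:
  "(\<Sum>e\<in>UNIV. \<Sum>f\<in>UNIV. qalg_scal (Rmat [a, b] [e, f]) * (qalg_X e c * qalg_X f d)) =
   (\<Sum>e\<in>UNIV. \<Sum>f\<in>UNIV. (qalg_X b f * qalg_X a e) * qalg_scal (Rmat [e, f] [c, d]))"
proof -
  let ?T = "tmap qalg_scal Rmat" and ?X1 = "leg 1 qalg_X" and ?X2 = "leg 2 qalg_X"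
  have "tmul 2 ?T (tmul 2 ?X1 ?X2) [a, b] [c, d] = tmul 2 (tmul 2 ?X2 ?X1) ?T [a, b] [c, d]"
    using qalg_relations(1)[of "[a, b]" "[c, d]"] unfolding rel_XX_def tmul_assoc[of 2 ?T]
    by (simp add: numeral_2_eq_2)
  then show ?thesis
    unfolding tmul_2[of ?T] tmul_2[of _ ?T] tmul_leg_2 unfolding tmap_def .
qed

lemma relation_YY_entry:
  "(\<Sum>e\<in>UNIV. \<Sum>f\<in>UNIV. qalg_scal (Rmat [a, b] [e, f]) * (qalg_Y f d * qalg_Y e c)) =
   (\<Sum>e\<in>UNIV. \<Sum>f\<in>UNIV. (qalg_Y a e * qalg_Y b f) * qalg_scal (Rmat [e, f] [c, d]))"
proof -
  let ?T = "tmap qalg_scal Rmat" and ?Y1 = "leg 1 qalg_Y" and ?Y2 = "leg 2 qalg_Y"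
  have "tmul 2 ?T (tmul 2 ?Y2 ?Y1) [a, b] [c, d] = tmul 2 (tmul 2 ?Y1 ?Y2) ?T [a, b] [c, d]"
    using qalg_relations(2)[of "[a, b]" "[c, d]"] unfolding rel_YY_def tmul_assoc[of 2 ?T]
    by (simp add: numeral_2_eq_2)
  then show ?thesis
    unfolding tmul_2[of ?T] tmul_2[of _ ?T] tmul_leg_2 unfolding tmap_def .
qed

lemma tmul_leg_T_leg_2:
  fixes M N :: "'n::finite \<Rightarrow> 'n \<Rightarrow> 'a::ring_1"
  shows "tmul 2 (tmul 2 (leg 1 M) T) (leg 2 N) [a, b] [c, d] =
      (\<Sum>e\<in>UNIV. \<Sum>f\<in>UNIV. M a e * T [e, b] [c, f] * N f d)"
    and "tmul 2 (tmul 2 (leg 2 N) T) (leg 1 M) [a, b] [c, d] =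
      (\<Sum>e\<in>UNIV. \<Sum>f\<in>UNIV. N b f * T [a, f] [e, d] * M e c)"
proof -
  have *: "(\<Sum>f\<in>UNIV. if f = y then z f else 0) = z y" for y and z :: "'n \<Rightarrow> 'a"
    by simp
  have **: "(\<Sum>f\<in>UNIV. if P then z f else 0) = (if P then \<Sum>f\<in>UNIV. z f else 0)" for P and z :: "'n \<Rightarrow> 'a"
    by simp
  have L: "tmul 2 (leg 1 M) T [a, b] w = (\<Sum>e\<in>UNIV. M a e * T [e, b] w)" for w
  proof -
    have "tmul 2 (leg 1 M) T [a, b] w = (\<Sum>e\<in>UNIV. \<Sum>f\<in>UNIV. if f = b then M a e * T [e, f] w else 0)"
      unfolding tmul_def sum_lists_2 by (intro sum.cong refl) (auto simp: leg_12_entry)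
    then show ?thesis unfolding * .
  qed
  have L': "tmul 2 (leg 2 N) T [a, b] w = (\<Sum>f\<in>UNIV. N b f * T [a, f] w)" for w
  proof -
    have "tmul 2 (leg 2 N) T [a, b] w = (\<Sum>e\<in>UNIV. \<Sum>f\<in>UNIV. if e = a then N b f * T [e, f] w else 0)"
      unfolding tmul_def sum_lists_2 by (intro sum.cong refl) (auto simp: leg_12_entry)
    then show ?thesis unfolding ** * .
  qed
  have "tmul 2 (tmul 2 (leg 1 M) T) (leg 2 N) [a, b] [c, d] =
      (\<Sum>e\<in>UNIV. \<Sum>f\<in>UNIV. if e = c then tmul 2 (leg 1 M) T [a, b] [e, f] * N f d else 0)"
    unfolding tmul_2[of _ "leg 2 N"] by (intro sum.cong refl) (auto simp: leg_12_entry)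
  also have "\<dots> = (\<Sum>f\<in>UNIV. \<Sum>e\<in>UNIV. M a e * T [e, b] [c, f] * N f d)"
    unfolding ** * L sum_distrib_right ..
  finally show "tmul 2 (tmul 2 (leg 1 M) T) (leg 2 N) [a, b] [c, d] =
      (\<Sum>e\<in>UNIV. \<Sum>f\<in>UNIV. M a e * T [e, b] [c, f] * N f d)"
    by (subst sum.swap)
  have "tmul 2 (tmul 2 (leg 2 N) T) (leg 1 M) [a, b] [c, d] =
      (\<Sum>e\<in>UNIV. \<Sum>f\<in>UNIV. if f = d then tmul 2 (leg 2 N) T [a, b] [e, f] * M e c else 0)"
    unfolding tmul_2[of _ "leg 1 M"] by (intro sum.cong refl) (auto simp: leg_12_entry)
  then show "tmul 2 (tmul 2 (leg 2 N) T) (leg 1 M) [a, b] [c, d] =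
      (\<Sum>e\<in>UNIV. \<Sum>f\<in>UNIV. N b f * T [a, f] [e, d] * M e c)"
    unfolding * L' sum_distrib_right .
qed

lemma relation_XY_entry:
  "(\<Sum>e\<in>UNIV. \<Sum>f\<in>UNIV. qalg_X a e * qalg_scal (Rmat [e, b] [c, f]) * qalg_Y f d) =
   (\<Sum>e\<in>UNIV. \<Sum>f\<in>UNIV. qalg_Y b f * qalg_scal (Rmat [a, f] [e, d]) * qalg_X e c)"
  using qalg_relations(3)[of "[a, b]" "[c, d]"] unfolding rel_XY_def tmul_leg_T_leg_2 tmap_def
  by (simp add: numeral_2_eq_2)

lemma entry_mult_2:
  fixes A B :: "('n::finite, 'a::ring_1) lmat"
  shows "entry (A * B) [a, b] w = (\<Sum>e\<in>UNIV. \<Sum>f\<in>UNIV. entry A [a, b] [e, f] * entry B [e, f] w)"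
  using entry_mult[of "[a, b]" 2 A B w] by (simp add: tmul_def sum_lists_2)

text \<open>
  Passing from \<open>R\<close> to \<open>Rhat\<close> exchanges the two entries of the row index, so each defining relation
  is used with its first two indices exchanged.
\<close>

lemma relations_lmat:
  fixes R2 :: "('n::{finite,linorder}, 'n qalg) lmat"
  defines "R2 \<equiv> map_lmat qalg_scal Rhat_lmat"
  assumes "length u = 2" "length w = 2"
  shows "entry (R2 * (on_legs 0 1 X_lmat * on_legs 1 1 X_lmat)) u w =
      entry (on_legs 0 1 X_lmat * on_legs 1 1 X_lmat * R2) u w"
    and "entry (R2 * (on_legs 1 1 Y_lmat * on_legs 0 1 Y_lmat)) u w =
      entry (on_legs 1 1 Y_lmat * on_legs 0 1 Y_lmat * R2) u w"
    and "entry (on_legs 1 1 X_lmat * R2 * on_legs 1 1 Y_lmat) u w =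
      entry (on_legs 0 1 Y_lmat * R2 * on_legs 0 1 X_lmat) u w"
proof -
  obtain a b c d where uw: "u = [a, b]" "w = [c, d]"
    using assms by (metis length_2_cases)
  have R2: "entry R2 [a, b] [c, d] = qalg_scal (Rmat [b, a] [c, d])" for a b c d
    by (simp add: R2_def entry_map_lmat Rhat_lmat.rep_eq Rhat_entry)
  have XY1: "entry X_lmat [a] [c] = qalg_X a c" "entry Y_lmat [a] [c] = qalg_Y a c" for a c :: 'n
    by (simp_all add: X_lmat.rep_eq Y_lmat.rep_eq)
  have delta: "(\<Sum>f\<in>UNIV. if f = y then z f else 0) = z y" "(\<Sum>f\<in>UNIV. if y = f then z f else 0) = z y"
    "(\<Sum>f\<in>UNIV. if P then z f else 0) = (if P then \<Sum>f\<in>UNIV. z f else 0)"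
    for P y and z :: "'n \<Rightarrow> 'n qalg"
    by simp_all
  have "entry (R2 * (on_legs 0 1 X_lmat * on_legs (Suc 0) 1 X_lmat)) [a, b] [c, d] =
      (\<Sum>e\<in>UNIV. \<Sum>f\<in>UNIV. (qalg_X a f * qalg_X b e) * qalg_scal (Rmat [e, f] [c, d]))"
    unfolding entry_mult_2[of R2] entry_2 R2 XY1 relation_XX_entry ..
  also have "\<dots> = (\<Sum>e\<in>UNIV. \<Sum>f\<in>UNIV. (qalg_X a e * qalg_X b f) * qalg_scal (Rmat [f, e] [c, d]))"
    by (rule sum.swap)
  also have "\<dots> = entry (on_legs 0 1 X_lmat * on_legs (Suc 0) 1 X_lmat * R2) [a, b] [c, d]"
    unfolding entry_mult_2[of _ R2] entry_2 R2 XY1 ..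
  finally show "entry (R2 * (on_legs 0 1 X_lmat * on_legs 1 1 X_lmat)) u w =
      entry (on_legs 0 1 X_lmat * on_legs 1 1 X_lmat * R2) u w"
    by (simp add: uw)
  have "entry (R2 * (on_legs (Suc 0) 1 Y_lmat * on_legs 0 1 Y_lmat)) [a, b] [c, d] =
      (\<Sum>e\<in>UNIV. \<Sum>f\<in>UNIV. (qalg_Y b e * qalg_Y a f) * qalg_scal (Rmat [e, f] [c, d]))"
    unfolding entry_mult_2[of R2] entry_2 R2 XY1 relation_YY_entry ..
  also have "\<dots> = (\<Sum>e\<in>UNIV. \<Sum>f\<in>UNIV. (qalg_Y b f * qalg_Y a e) * qalg_scal (Rmat [f, e] [c, d]))"
    by (rule sum.swap)
  also have "\<dots> = entry (on_legs (Suc 0) 1 Y_lmat * on_legs 0 1 Y_lmat * R2) [a, b] [c, d]"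
    unfolding entry_mult_2[of _ R2] entry_2 R2 XY1 ..
  finally show "entry (R2 * (on_legs 1 1 Y_lmat * on_legs 0 1 Y_lmat)) u w =
      entry (on_legs 1 1 Y_lmat * on_legs 0 1 Y_lmat * R2) u w"
    by (simp add: uw)
  have L: "entry (on_legs (Suc 0) 1 X_lmat * R2) [a, b] [e, f] =
      (\<Sum>g\<in>UNIV. qalg_X b g * qalg_scal (Rmat [g, a] [e, f]))" for e f
  proof -
    have "entry (on_legs (Suc 0) 1 X_lmat * R2) [a, b] [e, f] = (\<Sum>h\<in>UNIV. \<Sum>g\<in>UNIV.
        if a = h then qalg_X b g * qalg_scal (Rmat [g, h] [e, f]) else 0)"
      unfolding entry_mult_2 entry_leg_2 R2 XY1 by (intro sum.cong refl) simp
    then show ?thesis unfolding delta .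
  qed
  have L': "entry (on_legs 0 1 Y_lmat * R2) [a, b] [e, f] =
      (\<Sum>g\<in>UNIV. qalg_Y a g * qalg_scal (Rmat [b, g] [e, f]))" for e f
  proof -
    have "entry (on_legs 0 1 Y_lmat * R2) [a, b] [e, f] = (\<Sum>g\<in>UNIV. \<Sum>h\<in>UNIV.
        if b = h then qalg_Y a g * qalg_scal (Rmat [h, g] [e, f]) else 0)"
      unfolding entry_mult_2 entry_leg_2 R2 XY1 by (intro sum.cong refl) simp
    then show ?thesis unfolding delta .
  qed
  have "entry (on_legs (Suc 0) 1 X_lmat * R2 * on_legs (Suc 0) 1 Y_lmat) [a, b] [c, d] =
      (\<Sum>e\<in>UNIV. \<Sum>f\<in>UNIV. if e = c then entry (on_legs (Suc 0) 1 X_lmat * R2) [a, b] [e, f] * qalg_Y f d else 0)"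
    unfolding entry_mult_2[of "on_legs (Suc 0) 1 X_lmat * R2"] entry_leg_2 XY1
    by (intro sum.cong refl) simp
  also have "\<dots> = (\<Sum>f\<in>UNIV. \<Sum>g\<in>UNIV. qalg_X b g * qalg_scal (Rmat [g, a] [c, f]) * qalg_Y f d)"
    unfolding delta L sum_distrib_right ..
  also have "\<dots> = (\<Sum>e\<in>UNIV. \<Sum>f\<in>UNIV. qalg_Y a f * qalg_scal (Rmat [b, f] [e, d]) * qalg_X e c)"
    unfolding relation_XY_entry[symmetric] by (rule sum.swap)
  also have "\<dots> = (\<Sum>e\<in>UNIV. \<Sum>f\<in>UNIV. if f = d then entry (on_legs 0 1 Y_lmat * R2) [a, b] [e, f] * qalg_X e c else 0)"
    unfolding delta L' sum_distrib_right ..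
  also have "\<dots> = entry (on_legs 0 1 Y_lmat * R2 * on_legs 0 1 X_lmat) [a, b] [c, d]"
    unfolding entry_mult_2[of "on_legs 0 1 Y_lmat * R2"] entry_leg_2 XY1
    by (intro sum.cong refl) simp
  finally show "entry (on_legs 1 1 X_lmat * R2 * on_legs 1 1 Y_lmat) u w =
      entry (on_legs 0 1 Y_lmat * R2 * on_legs 0 1 X_lmat) u w"
    by (simp add: uw)
qed

lemma on_legs_2_absorb:
  "on_legs k 1 A * on_legs k 2 B = on_legs k 2 (on_legs 0 1 A * B)"
  "on_legs (Suc k) 1 A * on_legs k 2 B = on_legs k 2 (on_legs 1 1 A * B)"
  "on_legs k 2 B * on_legs k 1 A = on_legs k 2 (B * on_legs 0 1 A)"
  "on_legs k 2 B * on_legs (Suc k) 1 A = on_legs k 2 (B * on_legs 1 1 A)"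
  using on_legs_absorb(1)[of 0 1 2 k A B] on_legs_absorb(1)[of 1 1 2 k A B]
    on_legs_absorb(2)[of 0 1 2 k B A] on_legs_absorb(2)[of 1 1 2 k B A] by simp_all

interpretation qalg_braid: braid_relations "qalg_hom.Rop :: nat \<Rightarrow> ('n::{finite,linorder}, 'n qalg) lmat"
  "\<lambda>k. on_legs k 1 X_lmat" "\<lambda>k. on_legs k 1 Y_lmat"
proof unfold_locales
  fix k l :: nat
  show "qalg_hom.Rop k * (on_legs k 1 X_lmat * on_legs (Suc k) 1 X_lmat) =
      on_legs k 1 X_lmat * on_legs (Suc k) 1 X_lmat * (qalg_hom.Rop k :: ('n, 'n qalg) lmat)"
    unfolding qalg_hom.Rop_def mult.assoc[symmetric] on_legs_2_absorb
    unfolding mult.assoc on_legs_2_absorb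
    by (rule on_legs_cong) (use relations_lmat(1) in \<open>simp add: mult.assoc\<close>)
  show "qalg_hom.Rop k * (on_legs (Suc k) 1 Y_lmat * on_legs k 1 Y_lmat) =
      on_legs (Suc k) 1 Y_lmat * on_legs k 1 Y_lmat * (qalg_hom.Rop k :: ('n, 'n qalg) lmat)"
    unfolding qalg_hom.Rop_def mult.assoc[symmetric] on_legs_2_absorb
    unfolding mult.assoc on_legs_2_absorb
    by (rule on_legs_cong) (use relations_lmat(2) in \<open>simp add: mult.assoc\<close>)
  show "on_legs (Suc k) 1 X_lmat * qalg_hom.Rop k * on_legs (Suc k) 1 Y_lmat =
      on_legs k 1 Y_lmat * (qalg_hom.Rop k :: ('n, 'n qalg) lmat) * on_legs k 1 X_lmat"
    unfolding qalg_hom.Rop_def on_legs_2_absorb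
    by (rule on_legs_cong) (rule relations_lmat(3))
  show "qalg_hom.Rop k * qalg_hom.Rop (Suc k) * qalg_hom.Rop k =
      qalg_hom.Rop (Suc k) * qalg_hom.Rop k * (qalg_hom.Rop (Suc k) :: ('n, 'n qalg) lmat)"
    by (rule qalg_hom.Rop_braid)
  show "Suc k < l \<Longrightarrow> qalg_hom.Rop k * qalg_hom.Rop l = qalg_hom.Rop l * (qalg_hom.Rop k :: ('n, 'n qalg) lmat)"
    by (rule qalg_hom.Rop_far)
  show "qalg_hom.Rop k * on_legs l 1 X_lmat = on_legs l 1 X_lmat * (qalg_hom.Rop k :: ('n, 'n qalg) lmat)"
    "qalg_hom.Rop k * on_legs l 1 Y_lmat = on_legs l 1 Y_lmat * (qalg_hom.Rop k :: ('n, 'n qalg) lmat)"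
    if "l \<noteq> k" "l \<noteq> Suc k"
    unfolding qalg_hom.Rop_def using that by (auto intro!: qalg_hom.on_legs_scalar_commute)
qed

lemma Xs_eq_on_legs:
  "qalg_braid.Xs k (k + Suc l) = (on_legs k (Suc l) X_lmat :: ('n::{finite,linorder}, 'n qalg) lmat)"
proof (induction l)
  case 0
  then show ?case by (simp add: qalg_braid.Xs_Suc del: One_nat_def) simp
next
  case (Suc l)
  have "(qalg_braid.Xs k (k + Suc (Suc l)) :: ('n, 'n qalg) lmat) =
      qalg_braid.Xs k (k + Suc l) * on_legs (k + Suc l) 1 X_lmat"
    using qalg_braid.Xs_Suc[of k "k + Suc l"] by simp
  also have "\<dots> = on_legs k (Suc l) X_lmat * on_legs (k + Suc l) 1 X_lmat"
    unfolding Suc.IH ..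
  also have "\<dots> = on_legs k (Suc (Suc l)) X_lmat"
    unfolding on_legs_X_add[of k "Suc l" 1, symmetric] by simp
  finally show ?case .
qed

lemma Ys_eq_on_legs:
  "qalg_braid.Ys k (k + Suc l) = (on_legs k (Suc l) Y_lmat :: ('n::{finite,linorder}, 'n qalg) lmat)"
proof (induction l)
  case 0
  then show ?case by (simp add: qalg_braid.Ys_Suc del: One_nat_def) simp
next
  case (Suc l)
  have "(qalg_braid.Ys k (k + Suc (Suc l)) :: ('n, 'n qalg) lmat) =
      on_legs (k + Suc l) 1 Y_lmat * qalg_braid.Ys k (k + Suc l)"
    using qalg_braid.Ys_Suc[of k "k + Suc l"] by simp
  also have "\<dots> = on_legs (k + Suc l) 1 Y_lmat * on_legs k (Suc l) Y_lmat"
    unfolding Suc.IH ..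
  also have "\<dots> = on_legs k (Suc (Suc l)) Y_lmat"
    unfolding on_legs_Y_add[of k "Suc l" 1, symmetric] by simp
  finally show ?case .
qed

section \<open>Weighted traces\<close>

definition wtrace :: "nat \<Rightarrow> ('n::{finite,linorder} list \<Rightarrow> 'n ratfun) \<Rightarrow> ('n, 'n qalg) lmat \<Rightarrow> 'n qalg" where
  "wtrace n \<omega> M = (\<Sum>u | length u = n. qalg_scal (\<omega> u) * entry M u u)"

lemma wtrace_cong:
  assumes "on_legs 0 n M = on_legs 0 n M'"
  shows "wtrace n \<omega> M = wtrace n \<omega> M'"
proof -
  have *: "entry (on_legs 0 n A) u u = entry A u u" if "length u = n" for A :: "('a, 'a qalg) lmat" and u
    using that entry_on_legs[of "[]" 0 u n "[]" u A "[]" "[]"] by simp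
  have "entry M u u = entry M' u u" if "length u = n" for u
    using *[OF that, of M] *[OF that, of M'] assms by simp
  then show ?thesis
    unfolding wtrace_def by simp
qed

lemma wtrace_diag: "wtrace n \<omega> (diag_lmat (qalg_scal c) * M) = qalg_scal c * wtrace n \<omega> M"
  unfolding wtrace_def entry_diag_mult sum_distrib_left
  by (intro sum.cong refl) (simp add: mult.assoc[symmetric] mult.commute[of c] flip: qalg_scal_hom(4))

lemma sum_lists_Cons:
  "(\<Sum>u | length u = Suc n. g u) = (\<Sum>a\<in>UNIV. \<Sum>u | length u = n. g (a # u :: 'n::finite list))"
proof -
  have "(\<Sum>a\<in>UNIV. \<Sum>u | length u = n. g (a # u)) = (\<Sum>(a, u)\<in>UNIV \<times> {u. length u = n}. g (a # u))"
    by (simp add: sum.cartesian_product)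
  also have "\<dots> = (\<Sum>u | length u = Suc n. g u)"
    by (rule sum.reindex_bij_witness[of _ "\<lambda>u. (hd u, tl u)" "\<lambda>(a, u). a # u"])
      (auto simp: length_Suc_conv)
  finally show ?thesis ..
qed

lemma sum_lists_snoc:
  "(\<Sum>u | length u = Suc n. g u) = (\<Sum>a\<in>UNIV. \<Sum>u | length u = n. g (u @ [a :: 'n::finite]))"
proof -
  have "(\<Sum>a\<in>UNIV. \<Sum>u | length u = n. g (u @ [a])) = (\<Sum>(a, u)\<in>UNIV \<times> {u. length u = n}. g (u @ [a]))"
    by (simp add: sum.cartesian_product)
  also have "\<dots> = (\<Sum>u | length u = Suc n. g u)"
  proof (rule sum.reindex_bij_witness[of _ "\<lambda>u. (last u, butlast u)" "\<lambda>(a, u). u @ [a]"])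
    fix u :: "'n list" assume "u \<in> {u. length u = Suc n}"
    then have "u \<noteq> []" "length u = Suc n" by auto
    then show "(case (last u, butlast u) of (a, u) \<Rightarrow> u @ [a]) = u"
      "(last u, butlast u) \<in> UNIV \<times> {u. length u = n}" by auto
  qed auto
  finally show ?thesis ..
qed

text \<open>
  A partial trace is linear over the operators that do not touch the leg that is traced out.
\<close>

lemma partial_trace_sum:
  fixes K :: "'n::{finite,linorder} \<Rightarrow> 'n list \<Rightarrow> 'n list \<Rightarrow> 'n qalg"
  assumes K: "\<And>v v'. length v = n \<Longrightarrow> length v' = n \<Longrightarrow>
      (\<Sum>a\<in>UNIV. qalg_scal (W a) * K a v v') = (if v = v' then 1 else 0)"
    and u: "length u = n"
  shows "(\<Sum>a\<in>UNIV. qalg_scal (W a) * act A (\<lambda>v. ract (K a v) B u) u) = entry (A * B) u u"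
proof -
  have "(\<Sum>a\<in>UNIV. qalg_scal (W a) * act A (\<lambda>v. ract (K a v) B u) u) =
      (\<Sum>a\<in>UNIV. \<Sum>v | length v = n. \<Sum>v' | length v' = n.
        entry A u v * ((qalg_scal (W a) * K a v v') * entry B v' u))"
    unfolding act_def ract_def sum_distrib_left u
    unfolding mult.assoc[symmetric] qalg_scal_commute[of "W _" "entry A u _"] ..
  also have "\<dots> = (\<Sum>v | length v = n. \<Sum>v' | length v' = n. \<Sum>a\<in>UNIV.
        entry A u v * ((qalg_scal (W a) * K a v v') * entry B v' u))"
    by (subst sum.swap) (intro sum.cong refl sum.swap)
  also have "\<dots> = (\<Sum>v | length v = n. \<Sum>v' | length v' = n.
        entry A u v * ((if v = v' then 1 else 0) * entry B v' u))"
    unfolding sum_distrib_left[symmetric] sum_distrib_right[symmetric] by (simp add: K)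
  also have "\<dots> = entry (A * B) u u"
    by (simp add: entry_mult_act act_def u if_distrib[of "\<lambda>x. _ * x"] if_distrib[of "\<lambda>x. x * _"] cong: if_cong)
  finally show ?thesis .
qed

text \<open>
  Between two operators that do not touch a leg, a factor whose partial trace over this leg is the
  identity drops out.
\<close>

lemma wtrace_remove_first:
  fixes K A B :: "('n::{finite,linorder}, 'n qalg) lmat"
  assumes K: "\<And>v v'. length v = n \<Longrightarrow> length v' = n \<Longrightarrow>
      (\<Sum>a\<in>UNIV. qalg_scal (W a) * entry K (a # v) (a # v')) = (if v = v' then 1 else 0)"
    and \<omega>: "\<And>a u. length u = n \<Longrightarrow> \<omega>' (a # u) = W a * \<omega> u"
  shows "wtrace (Suc n) \<omega>' (on_legs 1 n A * K * on_legs 1 n B) = wtrace n \<omega> (A * B)"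
proof -
  have entry: "entry (on_legs 1 n A * K * on_legs 1 n B) (a # u) (a # u) =
      act A (\<lambda>v. ract (\<lambda>v'. entry K (a # v) (a # v')) B u) u" if "length u = n" for a u
    using that act_on_legs[of "[a]" 1 u n A _ "[]"] ract_on_legs[of "[a]" 1 u n _ B "[]"]
    by (simp add: mult.assoc entry_mult_act[of "on_legs _ _ A"] entry_mult_ract[of K])
  have "wtrace (Suc n) \<omega>' (on_legs 1 n A * K * on_legs 1 n B) =
      (\<Sum>u | length u = n. \<Sum>a\<in>UNIV. qalg_scal (\<omega>' (a # u)) *
        entry (on_legs 1 n A * K * on_legs 1 n B) (a # u) (a # u))"
    unfolding wtrace_def sum_lists_Cons by (rule sum.swap)
  also have "\<dots> = (\<Sum>u | length u = n. qalg_scal (\<omega> u) * (\<Sum>a\<in>UNIV. qalg_scal (W a) *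
      act A (\<lambda>v. ract (\<lambda>v'. entry K (a # v) (a # v')) B u) u))"
    unfolding sum_distrib_left
    by (intro sum.cong refl) (simp add: \<omega> entry[unfolded mult.assoc One_nat_def] qalg_scal_hom(4) mult.commute[of "W _"] mult.assoc)
  also have "\<dots> = wtrace n \<omega> (A * B)"
    unfolding wtrace_def
    by (intro sum.cong refl) (simp add: partial_trace_sum[where K = "\<lambda>a v v'. entry K (a # v) (a # v')", OF K])
  finally show ?thesis .
qed

lemma wtrace_remove_last:
  fixes K A B :: "('n::{finite,linorder}, 'n qalg) lmat"
  assumes K: "\<And>v v'. length v = n \<Longrightarrow> length v' = n \<Longrightarrow>
      (\<Sum>a\<in>UNIV. qalg_scal (W a) * entry K (v @ [a]) (v' @ [a])) = (if v = v' then 1 else 0)"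
    and \<omega>: "\<And>a u. length u = n \<Longrightarrow> \<omega>' (u @ [a]) = W a * \<omega> u"
  shows "wtrace (Suc n) \<omega>' (on_legs 0 n A * K * on_legs 0 n B) = wtrace n \<omega> (A * B)"
proof -
  have entry: "entry (on_legs 0 n A * K * on_legs 0 n B) (u @ [a]) (u @ [a]) =
      act A (\<lambda>v. ract (\<lambda>v'. entry K (v @ [a]) (v' @ [a])) B u) u" if "length u = n" for a u
    using that act_on_legs[of "[]" 0 u n A _ "[a]"] ract_on_legs[of "[]" 0 u n _ B "[a]"]
    by (simp add: mult.assoc entry_mult_act[of "on_legs _ _ A"] entry_mult_ract[of K])
  have "wtrace (Suc n) \<omega>' (on_legs 0 n A * K * on_legs 0 n B) =
      (\<Sum>u | length u = n. \<Sum>a\<in>UNIV. qalg_scal (\<omega>' (u @ [a])) *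
        entry (on_legs 0 n A * K * on_legs 0 n B) (u @ [a]) (u @ [a]))"
    unfolding wtrace_def sum_lists_snoc by (rule sum.swap)
  also have "\<dots> = (\<Sum>u | length u = n. qalg_scal (\<omega> u) * (\<Sum>a\<in>UNIV. qalg_scal (W a) *
      act A (\<lambda>v. ract (\<lambda>v'. entry K (v @ [a]) (v' @ [a])) B u) u))"
    unfolding sum_distrib_left
    by (intro sum.cong refl) (simp add: \<omega> entry[unfolded mult.assoc One_nat_def] qalg_scal_hom(4) mult.commute[of "W _"] mult.assoc)
  also have "\<dots> = wtrace n \<omega> (A * B)"
    unfolding wtrace_def
    by (intro sum.cong refl) (simp add: partial_trace_sum[where K = "\<lambda>a v v'. entry K (v @ [a]) (v' @ [a])", OF K])
  finally show ?thesis .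
qed

subsection \<open>Partial traces of the braid generator\<close>

lemma sum_power_corank:
  fixes t :: "'c::comm_semiring_1"
  assumes "finite (J :: 'n::linorder set)"
  shows "(\<Sum>x\<in>J. t ^ card {y \<in> J. x < y}) = (\<Sum>k<card J. t ^ k)"
  using assms
proof (induction J rule: finite_linorder_min_induct)
  case (insert b A)
  have "{y \<in> insert b A. b < y} = A" using insert by auto
  moreover have "{y \<in> insert b A. x < y} = {y \<in> A. x < y}" if "x \<in> A" for x
    using that insert by force
  moreover have "b \<notin> A" using insert by auto
  ultimately show ?case using insert by (simp add: add.commute)
qed simp

text \<open>
  Both sums are geometric progressions in \<open>q\<^sup>2\<close>.
\<close>

lemma D_entry_recursion:
  fixes b :: "'n::{finite,linorder}"
  shows "D_entry b ^ 2 + (1 - qq ^ 2) * (\<Sum>a | a < b. D_entry a ^ 2) = 1"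
    and "D'_entry b ^ 2 + (1 - qq ^ 2) * (\<Sum>a | b < a. D'_entry a ^ 2) = 1"
proof -
  have t: "(qq ^ m) ^ 2 = ((qq ^ 2) ^ m :: 'n ratfun)" for m
    by (simp add: power_mult[symmetric] mult.commute)
  have "(\<Sum>a | a < b. D_entry a ^ 2) = (\<Sum>a\<in>{a. a < b}. (qq ^ 2) ^ card {y \<in> {a. a < b}. y < a})"
    unfolding D_entry_def t by (intro sum.cong refl arg_cong[where f = "\<lambda>S. _ ^ card S"]) auto
  also have "\<dots> = (\<Sum>k<card {a. a < b}. (qq ^ 2) ^ k)"
    by (rule sum_power_rank) simp
  finally show "D_entry b ^ 2 + (1 - qq ^ 2) * (\<Sum>a | a < b. D_entry a ^ 2) = 1"
    by (simp add: one_diff_power_eq[symmetric] D_entry_def t)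
  have "(\<Sum>a | b < a. D'_entry a ^ 2) = (\<Sum>a\<in>{a. b < a}. (qq ^ 2) ^ card {y \<in> {a. b < a}. a < y})"
    unfolding D'_entry_def t by (intro sum.cong refl arg_cong[where f = "\<lambda>S. _ ^ card S"]) auto
  also have "\<dots> = (\<Sum>k<card {a. b < a}. (qq ^ 2) ^ k)"
    by (rule sum_power_corank) simp
  finally show "D'_entry b ^ 2 + (1 - qq ^ 2) * (\<Sum>a | b < a. D'_entry a ^ 2) = 1"
    by (simp add: one_diff_power_eq[symmetric] D'_entry_def t)
qed

text \<open>
  In the diagonal block of \<open>R\<close> with index \<open>a\<close> on the first leg, only \<open>a = b\<close> and \<open>a > b\<close> contribute, where
  \<open>b\<close> is the index on the second leg; \<open>D_entry_recursion\<close> sums these contributions to \<open>1\<close>.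
\<close>

lemma partial_trace_first:
  fixes v v' :: "'n::{finite,linorder} list"
  assumes "length v = n" "length v' = n" "n > 0"
  shows "(\<Sum>a\<in>UNIV. qalg_scal (D'_entry a ^ 2) * entry (qalg_hom.Rop 0) (a # v) (a # v')) = (if v = v' then 1 else 0)"
proof -
  obtain b y b' y' where v: "v = b # y" "v' = b' # y'" "length y = length y'"
    using assms by (cases v; cases v') auto
  have entry: "entry (qalg_hom.Rop 0) (a # v) (a # v') = (if v = v' then
      qalg_scal ((if a = b then 1 else 0) + (if b < a then 1 - qq ^ 2 else 0)) else 0)" for a
    using entry_on_legs[of "[]" 0 "[a, b]" 2 "[]" "[a, b']" "map_lmat qalg_scal Rhat_lmat" y y'] v
    by (auto simp: qalg_hom.Rop_def entry_map_lmat entry_Rhat_lmat(1) qij_def qalg_scal_hom)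
  have "(\<Sum>a\<in>UNIV. D'_entry a ^ 2 * ((if a = b then 1 else 0) + (if b < a then 1 - qq ^ 2 else 0))) =
      D'_entry b ^ 2 + (\<Sum>a\<in>UNIV. if b < a then (1 - qq ^ 2) * D'_entry a ^ 2 else 0)"
    by (simp add: distrib_left sum.distrib if_distrib[of "\<lambda>x. x * _"] if_distrib[of "\<lambda>x. _ * x"] mult.commute cong: if_cong)
  also have "\<dots> = D'_entry b ^ 2 + (1 - qq ^ 2) * (\<Sum>a | b < a. D'_entry a ^ 2)"
    by (simp add: sum.If_cases sum_distrib_left)
  also have "\<dots> = 1" by (rule D_entry_recursion)
  finally show ?thesis
    unfolding entry using qalg_hom.sc_sum[symmetric] qalg_scal_hom(2)
    by (cases "v = v'") (simp_all add: qalg_scal_hom(4)[symmetric] qalg_hom.sc_sum[symmetric])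
qed

text \<open>
  The roles of the two legs and the order of the indices are reversed, whence the other weight.
\<close>

lemma partial_trace_last:
  fixes v v' :: "'n::{finite,linorder} list"
  assumes "length v = Suc m" "length v' = Suc m"
  shows "(\<Sum>a\<in>UNIV. qalg_scal (D_entry a ^ 2) * entry (qalg_hom.Rop m) (v @ [a]) (v' @ [a])) = (if v = v' then 1 else 0)"
proof -
  obtain b y b' y' where v: "v = y @ [b]" "v' = y' @ [b']" "length y = m" "length y' = m"
    using assms by (auto simp: length_Suc_conv_rev)
  have entry: "entry (qalg_hom.Rop m) (v @ [a]) (v' @ [a]) = (if v = v' then
      qalg_scal ((if a = b then 1 else 0) + (if a < b then 1 - qq ^ 2 else 0)) else 0)" for a
    using entry_on_legs[of y m "[b, a]" 2 y' "[b', a]" "map_lmat qalg_scal Rhat_lmat" "[]" "[]"] v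
    by (auto simp: qalg_hom.Rop_def entry_map_lmat entry_Rhat_lmat(1) qij_def qalg_scal_hom)
  have "(\<Sum>a\<in>UNIV. D_entry a ^ 2 * ((if a = b then 1 else 0) + (if a < b then 1 - qq ^ 2 else 0))) =
      D_entry b ^ 2 + (\<Sum>a\<in>UNIV. if a < b then (1 - qq ^ 2) * D_entry a ^ 2 else 0)"
    by (simp add: distrib_left sum.distrib if_distrib[of "\<lambda>x. x * _"] if_distrib[of "\<lambda>x. _ * x"] mult.commute cong: if_cong)
  also have "\<dots> = D_entry b ^ 2 + (1 - qq ^ 2) * (\<Sum>a | a < b. D_entry a ^ 2)"
    by (simp add: sum.If_cases sum_distrib_left)
  also have "\<dots> = 1" by (rule D_entry_recursion)
  finally show ?thesis
    unfolding entry using qalg_hom.sc_sum[symmetric] qalg_scal_hom(2)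
    by (cases "v = v'") (simp_all add: qalg_scal_hom(4)[symmetric] qalg_hom.sc_sum[symmetric])
qed

section \<open>Moving the matrix Y past the matrix X under the trace\<close>

abbreviation qantisym :: "('n::{finite,linorder}, 'n qalg) lmat" where
  "qantisym \<equiv> map_lmat qalg_scal antisym"

lemma Rs_eq_map: "qalg_braid.Rs a b = map_lmat qalg_scal (scalar_braid.Rs a b)"
  unfolding qalg_braid.Rs_def scalar_braid.Rs_def qalg_hom.map_lmat_prod_list
  by (simp add: comp_def flip: qalg_hom.Rop_eq_map)

lemma qantisym_cross:
  assumes "n > 0"
  shows "on_legs 1 n qantisym * qalg_braid.Rs 0 n = qalg_braid.Rs 0 n * on_legs 0 n qantisym"
  using arg_cong[OF antisym_cross[OF assms], of "map_lmat qalg_scal"]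
  unfolding qalg_hom.map_lmat_mult qalg_hom.map_lmat_on_legs Rs_eq_map .

lemma Rop_qantisym:
  assumes "Suc k < n"
  shows "qalg_hom.Rop k * on_legs 0 n qantisym = diag_lmat (qalg_scal (- (qq ^ 2))) * on_legs 0 n qantisym"
    and "on_legs 0 n qantisym * qalg_hom.Rop k = diag_lmat (qalg_scal (- (qq ^ 2))) * on_legs 0 n qantisym"
proof -
  note 1 = Rop_on_legs_antisym[OF assms, of 0, unfolded add_0]
  show "qalg_hom.Rop k * on_legs 0 n qantisym = diag_lmat (qalg_scal (- (qq ^ 2))) * on_legs 0 n qantisym"
    using arg_cong[OF 1(1), of "map_lmat qalg_scal"]
    unfolding qalg_hom.map_lmat_mult qalg_hom.map_lmat_on_legs qalg_hom.Rop_eq_map[symmetric] qalg_hom.map_lmat_diag .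
  show "on_legs 0 n qantisym * qalg_hom.Rop k = diag_lmat (qalg_scal (- (qq ^ 2))) * on_legs 0 n qantisym"
    using arg_cong[OF 1(2), of "map_lmat qalg_scal"]
    unfolding qalg_hom.map_lmat_mult qalg_hom.map_lmat_on_legs qalg_hom.Rop_eq_map[symmetric] qalg_hom.map_lmat_diag .
qed

lemma Rs_qantisym:
  assumes "m < n"
  shows "qalg_braid.Rs 0 m * on_legs 0 n (qantisym :: ('n::{finite,linorder}, 'n qalg) lmat) =
      diag_lmat (qalg_scal ((- (qq ^ 2)) ^ m)) * on_legs 0 n qantisym"
    and "on_legs 0 n (qantisym :: ('n, 'n qalg) lmat) * qalg_braid.Rs 0 m =
      diag_lmat (qalg_scal ((- (qq ^ 2)) ^ m)) * on_legs 0 n qantisym"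
  using assms
proof (induction m)
  case 0
  {
    case 1
    then show ?case by (simp add: qalg_scal_hom)
  next
    case 2
    then show ?case by (simp add: qalg_scal_hom)
  }
next
  case (Suc m)
  let ?P = "on_legs 0 n (qantisym :: ('n, 'n qalg) lmat)" and ?R = "qalg_hom.Rop m :: ('n, 'n qalg) lmat"
  let ?S = "qalg_braid.Rs 0 m :: ('n, 'n qalg) lmat"
  let ?t = "diag_lmat (qalg_scal (- (qq ^ 2))) :: ('n, 'n qalg) lmat"
    and ?c = "diag_lmat (qalg_scal ((- (qq ^ 2)) ^ m)) :: ('n, 'n qalg) lmat"
  have t: "?t * A = A * ?t" for A by (rule qalg_hom.diag_commute)
  have ct: "?c * ?t = diag_lmat (qalg_scal ((- (qq ^ 2)) ^ Suc m))" "?t * ?c = diag_lmat (qalg_scal ((- (qq ^ 2)) ^ Suc m))"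
    by (rule lmat_eqI, simp add: diag_lmat.rep_eq mult.commute flip: qalg_scal_hom(4))+
  have S: "qalg_braid.Rs 0 (Suc m) = ?S * ?R" by (simp add: qalg_braid.Rs_Suc)
  {
    case 1
    have "?S * (?R * ?P) = ?t * ?S * ?P"
      unfolding Rop_qantisym(1)[OF 1] t[of ?S] by (simp only: mult.assoc)
    also have "\<dots> = ?t * (?c * ?P)"
      unfolding mult.assoc Suc.IH(1)[OF Suc_lessD[OF 1]] ..
    finally show ?case unfolding S ct(2)[symmetric] by (simp only: mult.assoc)
  next
    case 2
    have "?P * ?S * ?R = ?c * (?P * ?R)"
      unfolding Suc.IH(2)[OF Suc_lessD[OF 2]] by (simp only: mult.assoc)
    also have "\<dots> = ?c * ?t * ?P"
      unfolding Rop_qantisym(2)[OF 2] by (simp only: mult.assoc)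
    finally show ?case unfolding S ct(1)[symmetric] by (simp only: mult.assoc)
  }
qed

lemma on_legs_Rs:
  assumes "b < n"
  shows "on_legs j n (qalg_braid.Rs a b) = qalg_braid.Rs (j + a) (j + b) * on_legs j n 1"
  using assms
proof (induction b)
  case 0
  then show ?case by (simp add: qalg_braid.Rs_def)
next
  case (Suc b)
  show ?case
  proof (cases "a \<le> b")
    case True
    have R: "on_legs j n (qalg_hom.Rop b :: ('a, 'a qalg) lmat) = qalg_hom.Rop (j + b) * on_legs j n 1"
      using Suc.prems by (simp add: qalg_hom.Rop_def on_legs_on_legs(1))
    have "on_legs j n (qalg_braid.Rs a (Suc b)) = on_legs j n (qalg_braid.Rs a b) * on_legs j n (qalg_hom.Rop b :: ('a, 'a qalg) lmat)"
      using True by (simp add: qalg_braid.Rs_Suc on_legs_mult)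
    also have "\<dots> = qalg_braid.Rs (j + a) (j + b) * (on_legs j n 1 * qalg_hom.Rop (j + b)) * on_legs j n 1"
      using Suc by (simp add: R mult.assoc)
    also have "\<dots> = qalg_braid.Rs (j + a) (Suc (j + b)) * (on_legs j n 1 * on_legs j n 1)"
      unfolding on_legs_one_central[of j n "qalg_hom.Rop (j + b)"] using True
      by (simp add: qalg_braid.Rs_Suc mult.assoc)
    finally show ?thesis by (simp add: on_legs_one_mult)
  next
    case False
    then show ?thesis by (simp add: qalg_braid.Rs_def)
  qed
qed

definition mixed_weight :: "nat \<Rightarrow> 'n::{finite,linorder} list \<Rightarrow> 'n ratfun" where
  "mixed_weight k u = prod_list (map (\<lambda>a. D'_entry a ^ 2) (take k u)) * prod_list (map (\<lambda>a. D_entry a ^ 2) (drop k u))"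

text \<open>
  The trace in which \<open>k\<close> of the matrices \<open>Y\<close> already stand to the left of \<open>X\<close>.  Their legs come
  first and carry the weight \<open>D'\<^sup>2\<close>; the others still carry \<open>D\<^sup>2\<close>.
\<close>

definition mixed_trace :: "nat \<Rightarrow> nat \<Rightarrow> 'n::{finite,linorder} qalg" where
  "mixed_trace n k = wtrace n (mixed_weight k)
    (on_legs 0 k Y_lmat * qantisym * X_lmat * on_legs k (n - k) Y_lmat)"

text \<open>
  The antisymmetrizer makes it possible to insert the word \<open>S = R\<^sub>1 \<cdots> R\<^bsub>n-1\<^esub>\<close> at the cost of a
  scalar \<open>c\<close>.  This word is the partial trace of \<open>C = R\<^sub>0 R\<^sub>1 \<cdots> R\<^bsub>n-1\<^esub>\<close> over a new leg in front,
  and on \<open>n + 1\<close> legs \<open>Xs_Rs_Y\<close> carries the next \<open>Y\<close> across \<open>C\<close> to the new leg.  Tracing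
  out the last leg reduces \<open>C\<close> to \<open>S\<close> again, and \<open>S\<close> is absorbed by the antisymmetrizer with the
  same scalar \<open>c\<close>.
\<close>

lemma mixed_trace_Suc:
  assumes k: "k < n"
  shows "(mixed_trace n k :: 'n::{finite,linorder} qalg) = mixed_trace n (Suc k)"
proof -
  let ?P = "qantisym :: ('n, 'n qalg) lmat"
  let ?X = "X_lmat :: ('n, 'n qalg) lmat"
  let ?Y = "Y_lmat :: ('n, 'n qalg) lmat"
  obtain m where n: "n = Suc m" using k by (cases n) auto
  define S where "S = (qalg_braid.Rs 0 m :: ('n, 'n qalg) lmat)"
  define C where "C = (qalg_braid.Rs 0 n :: ('n, 'n qalg) lmat)"
  define c :: "'n ratfun" where "c = (- (qq ^ 2)) ^ m"
  define p where "p = m - k"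
  have p: "n - k = Suc p" "n - Suc k = p" "k + Suc p = n" "Suc k + p = n" "1 + k + p = n" "1 + n = Suc n"
    using k n by (auto simp: p_def)
  define A1 where "A1 = on_legs 0 k ?Y * ?P * ?X"
  define B1 where "B1 = on_legs k (Suc p) ?Y"
  define A2 where "A2 = on_legs 0 (Suc k) ?Y * S"
  define B2 where "B2 = ?P * ?X * on_legs (Suc k) p ?Y"
  let ?one = "on_legs 0 n 1 :: ('n, 'n qalg) lmat"
  have X: "on_legs j n ?X = qalg_braid.Xs j (j + n)" for j
    unfolding n by (rule Xs_eq_on_legs[symmetric])
  have S: "on_legs 0 n S = S * ?one" "on_legs 0 n S = ?one * S"
    using on_legs_one_central[of 0 n S] n by (simp_all add: S_def on_legs_Rs)
  have SX: "on_legs 0 n ?X * S = S * on_legs 0 n ?X"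
    unfolding X S_def add_0 by (rule qalg_braid.Rs_Xs[symmetric]) (simp_all add: n)
  have SP: "S * on_legs 0 n ?P = diag_lmat (qalg_scal c) * on_legs 0 n ?P"
    "on_legs 0 n ?P * S = diag_lmat (qalg_scal c) * on_legs 0 n ?P"
    using n by (simp_all add: S_def c_def Rs_qantisym)
  have one: "?one * on_legs 0 n M = on_legs 0 n M" "on_legs 0 n M * ?one = on_legs 0 n M" for M
    by (simp_all add: on_legs_one_mult)
  have dc: "diag_lmat (qalg_scal c) * M = M * diag_lmat (qalg_scal c)" for M :: "('n, 'n qalg) lmat"
    by (rule qalg_hom.diag_commute)
  have "on_legs 0 n (A1 * (S * B1)) =
      on_legs 0 n (on_legs 0 k ?Y) * (on_legs 0 n ?P * (on_legs 0 n ?X * S)) * on_legs 0 n B1"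
    by (simp add: A1_def on_legs_mult S(1) mult.assoc one)
  also have "\<dots> = on_legs 0 n (on_legs 0 k ?Y) * (on_legs 0 n ?P * S * on_legs 0 n ?X) * on_legs 0 n B1"
    unfolding SX by (simp add: mult.assoc)
  also have "\<dots> = diag_lmat (qalg_scal c) * (on_legs 0 n (on_legs 0 k ?Y) * on_legs 0 n ?P * on_legs 0 n ?X * on_legs 0 n B1)"
    unfolding SP mult.assoc[symmetric] dc[of "on_legs 0 n (on_legs 0 k ?Y)"] ..
  also have "\<dots> = on_legs 0 n (diag_lmat (qalg_scal c) * (A1 * B1))"
    unfolding on_legs_diag_mult unfolding A1_def on_legs_mult by (simp only: mult.assoc)
  finally have 1: "qalg_scal c * mixed_trace n k = wtrace n (mixed_weight k) (A1 * (S * B1))"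
    unfolding mixed_trace_def p A1_def[symmetric] B1_def[symmetric] wtrace_diag[symmetric]
    by (rule wtrace_cong[symmetric])
  also have "\<dots> = wtrace (Suc n) (mixed_weight (Suc k)) (on_legs 1 n A1 * qalg_hom.Rop 0 * on_legs 1 n (S * B1))"
  proof (rule wtrace_remove_first[symmetric])
    fix v v' :: "'n list" assume "length v = n" "length v' = n"
    then show "(\<Sum>a\<in>UNIV. qalg_scal (D'_entry a ^ 2) * entry (qalg_hom.Rop 0) (a # v) (a # v')) = (if v = v' then 1 else 0)"
      by (rule partial_trace_first) (simp add: n)
  qed (simp add: mixed_weight_def mult.assoc)
  also have "on_legs 1 n A1 * qalg_hom.Rop 0 * on_legs 1 n (S * B1) =
      on_legs 0 n A2 * qalg_hom.Rop m * on_legs 0 n B2"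
  proof -
    have L: "on_legs 1 n A1 = on_legs 1 k ?Y * on_legs 1 n ?P * on_legs 1 n ?X"
    proof -
      have "on_legs 1 n (on_legs 0 k ?Y) = on_legs 1 k ?Y * on_legs 1 n 1"
        using k on_legs_on_legs(1)[of 0 k n 1 ?Y] by simp
      moreover have "on_legs 1 n 1 * on_legs 1 n ?P = on_legs 1 n ?P"
        by (rule on_legs_one_mult) simp
      ultimately show ?thesis unfolding A1_def on_legs_mult by (simp only: mult.assoc)
    qed
    have C: "qalg_hom.Rop 0 * on_legs 1 n S = C * on_legs 1 n 1"
      using n by (simp add: S_def C_def on_legs_Rs qalg_braid.Rs_Cons[of 0 "Suc m"] mult.assoc)
    have B: "on_legs 1 n 1 * on_legs 1 n B1 = on_legs n 1 ?Y * on_legs (Suc k) p ?Y"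
    proof -
      have "on_legs 1 n B1 = on_legs (Suc k) (Suc p) ?Y"
        unfolding B1_def using p(3) by (simp add: on_legs_on_legs_end)
      moreover have "on_legs 1 n 1 * on_legs (Suc k) (Suc p) ?Y = on_legs (Suc k) (Suc p) ?Y"
        by (rule on_legs_one_mult) (use p(3) in simp)
      moreover have "on_legs (Suc k) (Suc p) ?Y = on_legs n 1 ?Y * on_legs (Suc k) p ?Y"
        using on_legs_Y_add[of "Suc k" p 1, where 'a = 'n] p(4) by simp
      ultimately show ?thesis by simp
    qed
    \<comment> \<open>This is the step that moves \<open>Y\<close> from the last leg to the new first leg.\<close>
    have cross: "on_legs 1 n ?X * C * on_legs n 1 ?Y = on_legs 0 1 ?Y * C * on_legs 0 n ?X"
      using qalg_braid.Xs_Rs_Y[of n] X[of 1] X[of 0] p(6) by (simp add: C_def)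
    have PY: "on_legs 1 n ?P * on_legs 0 1 ?Y = on_legs 0 1 ?Y * on_legs 1 n ?P"
      by (rule qalg_hom.on_legs_scalar_commute) simp
    have YY: "on_legs 1 k ?Y * on_legs 0 1 ?Y = on_legs 0 (Suc k) ?Y"
      using on_legs_Y_add[of 0 1 k, where 'a = 'n] by simp
    have PC: "on_legs 1 n ?P * C = C * on_legs 0 n ?P"
      using qantisym_cross[of n] n by (simp add: C_def)
    have "on_legs 1 n A1 * qalg_hom.Rop 0 * on_legs 1 n (S * B1) =
        on_legs 1 n A1 * (qalg_hom.Rop 0 * on_legs 1 n S) * on_legs 1 n B1"
      by (simp add: on_legs_mult mult.assoc)
    also have "\<dots> = on_legs 1 k ?Y * on_legs 1 n ?P * (on_legs 1 n ?X * C * on_legs n 1 ?Y) * on_legs (Suc k) p ?Y"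
      unfolding C L using B by (simp add: mult.assoc)
    also have "\<dots> = on_legs 1 k ?Y * (on_legs 1 n ?P * on_legs 0 1 ?Y) * C * on_legs 0 n ?X * on_legs (Suc k) p ?Y"
      unfolding cross by (simp add: mult.assoc)
    also have "\<dots> = on_legs 0 (Suc k) ?Y * (on_legs 1 n ?P * C) * on_legs 0 n ?X * on_legs (Suc k) p ?Y"
      unfolding PY YY[symmetric] by (simp add: mult.assoc)
    also have "\<dots> = on_legs 0 (Suc k) ?Y * C * on_legs 0 n B2"
      unfolding PC B2_def using p by (simp add: on_legs_mult on_legs_on_legs_end mult.assoc)
    also have "on_legs 0 (Suc k) ?Y * C = on_legs 0 n A2 * qalg_hom.Rop m"
    proof -
      have "on_legs 0 n A2 * qalg_hom.Rop m = on_legs 0 (Suc k) ?Y * (?one * ?one * S) * qalg_hom.Rop m"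
        using k by (simp add: A2_def on_legs_mult on_legs_on_legs(1) S(2) mult.assoc)
      also have "\<dots> = on_legs 0 (Suc k) ?Y * (S * (?one * qalg_hom.Rop m))"
        unfolding one on_legs_one_central[of 0 n S] by (simp add: mult.assoc)
      also have "?one * qalg_hom.Rop m = (qalg_hom.Rop m :: ('n, 'n qalg) lmat)"
        unfolding qalg_hom.Rop_def by (rule on_legs_one_mult) (simp add: n)
      also have "S * qalg_hom.Rop m = C"
        by (simp add: S_def C_def n qalg_braid.Rs_Suc)
      finally show ?thesis ..
    qed
    finally show ?thesis .
  qed
  also have "wtrace (Suc n) (mixed_weight (Suc k)) (on_legs 0 n A2 * qalg_hom.Rop m * on_legs 0 n B2) =
      wtrace n (mixed_weight (Suc k)) (A2 * B2)"
  proof (rule wtrace_remove_last)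
    fix v v' :: "'n list" assume "length v = n" "length v' = n"
    then show "(\<Sum>a\<in>UNIV. qalg_scal (D_entry a ^ 2) * entry (qalg_hom.Rop m) (v @ [a]) (v' @ [a])) = (if v = v' then 1 else 0)"
      unfolding n by (rule partial_trace_last)
  qed (use k in \<open>simp add: mixed_weight_def mult_ac\<close>)
  also have "\<dots> = qalg_scal c * mixed_trace n (Suc k)"
  proof -
    have "on_legs 0 n (A2 * B2) = on_legs 0 n (on_legs 0 (Suc k) ?Y) * (S * on_legs 0 n ?P) * on_legs 0 n ?X * on_legs 0 n (on_legs (Suc k) p ?Y)"
      using one(1)[of ?P] by (simp add: A2_def B2_def on_legs_mult S(1) flip: mult.assoc) (simp add: mult.assoc)
    also have "\<dots> = on_legs 0 n (diag_lmat (qalg_scal c) * (on_legs 0 (Suc k) ?Y * ?P * ?X * on_legs (Suc k) p ?Y))"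
      unfolding SP on_legs_diag_mult unfolding on_legs_mult mult.assoc[symmetric]
        dc[of "on_legs 0 n (on_legs 0 (Suc k) ?Y)"] ..
    finally show ?thesis
      unfolding mixed_trace_def p wtrace_diag[symmetric] by (rule wtrace_cong)
  qed
  finally show ?thesis
    by (rule qalg_hom.sc_cancel) (simp add: c_def)
qed

lemma mixed_trace_eq: "mixed_trace n 0 = mixed_trace n n"
proof -
  have "k \<le> n \<Longrightarrow> mixed_trace n 0 = (mixed_trace n k :: 'a qalg)" for k
    by (induction k) (simp_all add: mixed_trace_Suc)
  then show ?thesis by simp
qed

section \<open>Minors as coefficients of antisymmetric vectors\<close>

lemma eps_map_upt:
  assumes "inj_on \<tau> {m..<n}"
  shows "eps Q (map \<tau> [m..<n]) = (\<Prod>(a, b)\<in>{(a, b). m \<le> a \<and> a < b \<and> b < n \<and> \<tau> b < \<tau> a}. - Q (\<tau> a) (\<tau> b))"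
  using assms
proof (induction "n - m" arbitrary: m)
  case 0
  then have "{(a, b). m \<le> a \<and> a < b \<and> b < n \<and> \<tau> b < \<tau> a} = {}" by auto
  then show ?case using 0 by (simp only: prod.empty) simp
next
  case (Suc d)
  let ?S = "\<lambda>m. {(a, b). m \<le> a \<and> a < b \<and> b < n \<and> \<tau> b < \<tau> a}"
  let ?B = "{b \<in> {Suc m..<n}. \<tau> b < \<tau> m}"
  have m: "m < n" using Suc by simp
  have inj: "inj_on \<tau> {Suc m..<n}" using Suc.prems by (rule inj_on_subset) auto
  have fin: "finite (?S k)" for k
    by (rule finite_subset[of _ "{..<n} \<times> {..<n}"]) auto
  have S: "?S m = Pair m ` ?B \<union> ?S (Suc m)" "Pair m ` ?B \<inter> ?S (Suc m) = {}"
    using m by (auto simp: le_eq_less_or_eq Suc_le_eq)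
  have notin: "\<tau> m \<notin> set (map \<tau> [Suc m..<n])"
  proof
    assume "\<tau> m \<in> set (map \<tau> [Suc m..<n])"
    then obtain b where b: "\<tau> m = \<tau> b" "Suc m \<le> b" "b < n" by auto
    then have "m = b" by (intro inj_onD[OF Suc.prems]) auto
    then show False using b by simp
  qed
  have "{y \<in> set (map \<tau> [Suc m..<n]). y < \<tau> m} = \<tau> ` ?B" by auto
  moreover have "inj_on \<tau> ?B" using inj by (rule inj_on_subset) auto
  ultimately have "(\<Prod>y\<in>{y \<in> set (map \<tau> [Suc m..<n]). y < \<tau> m}. - Q (\<tau> m) y) = (\<Prod>b\<in>?B. - Q (\<tau> m) (\<tau> b))"
    by (simp add: prod.reindex)
  also have "\<dots> = (\<Prod>(a, b)\<in>Pair m ` ?B. - Q (\<tau> a) (\<tau> b))"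
    by (subst prod.reindex) (auto simp: inj_on_def)
  finally have first: "(\<Prod>y\<in>{y \<in> set (map \<tau> [Suc m..<n]). y < \<tau> m}. - Q (\<tau> m) y) =
    (\<Prod>(a, b)\<in>Pair m ` ?B. - Q (\<tau> a) (\<tau> b))" .
  have "eps Q (map \<tau> [m..<n]) = eps Q (\<tau> m # map \<tau> [Suc m..<n])"
    using m by (simp add: upt_conv_Cons)
  also have "\<dots> = (\<Prod>(a, b)\<in>Pair m ` ?B. - Q (\<tau> a) (\<tau> b)) * (\<Prod>(a, b)\<in>?S (Suc m). - Q (\<tau> a) (\<tau> b))"
    unfolding eps.simps first using notin Suc.hyps(1)[of "Suc m", OF _ inj] Suc.hyps(2) by simp
  also have "\<dots> = (\<Prod>(a, b)\<in>?S m. - Q (\<tau> a) (\<tau> b))"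
    unfolding S(1) by (rule prod.union_disjoint[symmetric]) (use S(2) fin in auto)
  finally show ?case .
qed

lemma neg_q_eq_eps:
  assumes "\<tau> \<in> bijections i K"
  shows "neg_q_c {1..i} \<tau> = eps_u (map \<tau> [1..<Suc i])"
    and "neg_q_r {1..i} \<tau> = eps_v (map \<tau> [1..<Suc i])"
proof -
  have inj: "inj_on \<tau> {1..<Suc i}"
    using assms by (auto simp: bijections_def bij_betw_def atLeastLessThanSuc_atLeastAtMost)
  have "{(a, b). a \<in> {1..i} \<and> b \<in> {1..i} \<and> a < b \<and> \<tau> b < \<tau> a} =
    {(a, b). 1 \<le> a \<and> a < b \<and> b < Suc i \<and> \<tau> b < \<tau> a}" by auto
  then show "neg_q_c {1..i} \<tau> = eps_u (map \<tau> [1..<Suc i])"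
    and "neg_q_r {1..i} \<tau> = eps_v (map \<tau> [1..<Suc i])"
    unfolding neg_q_c_def neg_q_r_def eps_map_upt[OF inj] by simp_all
qed

lemma bij_betw_bijections_arrangements:
  fixes K :: "'n::finite set"
  assumes "card K = i"
  shows "bij_betw (\<lambda>\<tau>. map \<tau> [1..<Suc i]) (bijections i K) (arrangements K)"
  unfolding bij_betw_def
proof
  have set: "set (map \<tau> [1..<Suc i]) = \<tau> ` {1..i}" for \<tau> :: "nat \<Rightarrow> 'n"
    by (simp only: set_map set_upt atLeastLessThanSuc_atLeastAtMost)
  show "inj_on (\<lambda>\<tau>. map \<tau> [1..<Suc i]) (bijections i K)"
  proof (rule inj_onI)
    fix \<sigma> \<tau> assume *: "\<sigma> \<in> bijections i K" "\<tau> \<in> bijections i K" "map \<sigma> [1..<Suc i] = map \<tau> [1..<Suc i]"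
    have eq: "\<sigma> k = \<tau> k" if "k \<in> {1..i}" for k
    proof -
      have "k \<in> set [1..<Suc i]"
        using that by (simp only: set_upt atLeastLessThanSuc_atLeastAtMost)
      then show ?thesis using *(3) unfolding map_eq_conv by blast
    qed
    have "\<sigma> \<in> {1..i} \<rightarrow>\<^sub>E K" "\<tau> \<in> {1..i} \<rightarrow>\<^sub>E K"
      using * by (simp_all only: bijections_def mem_Collect_eq)
    then show "\<sigma> = \<tau>" by (rule PiE_ext) (rule eq)
  qed
  show "(\<lambda>\<tau>. map \<tau> [1..<Suc i]) ` bijections i K = arrangements K"
  proof (intro equalityI subsetI)
    fix u assume "u \<in> (\<lambda>\<tau>. map \<tau> [1..<Suc i]) ` bijections i K"
    then obtain \<tau> where "u = map \<tau> [1..<Suc i]" "\<tau> \<in> bijections i K" by blast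
    then show "u \<in> arrangements K"
      unfolding arrangements_def bijections_def bij_betw_def mem_Collect_eq
      by (simp only: set distinct_map distinct_upt set_upt atLeastLessThanSuc_atLeastAtMost simp_thms)
  next
    fix u assume u: "u \<in> arrangements K"
    then have len: "length u = i" using assms by (simp add: length_arrangements)
    define \<tau> where "\<tau> = restrict (\<lambda>k. u ! (k - 1)) {1..i}"
    have "map \<tau> [1..<Suc i] = u"
      using len by (intro nth_equalityI) (auto simp: \<tau>_def simp del: upt_Suc)
    moreover from this have "\<tau> ` {1..i} = K" "inj_on \<tau> {1..i}"
      using u set[of \<tau>] unfolding arrangements_def
      by (auto simp: distinct_map atLeastLessThanSuc_atLeastAtMost simp del: upt_Suc)
    ultimately show "u \<in> (\<lambda>\<tau>. map \<tau> [1..<Suc i]) ` bijections i K"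
      by (intro image_eqI[of _ _ \<tau>]) (auto simp: bijections_def bij_betw_def \<tau>_def simp del: upt_Suc)
  qed
qed

lemma (in scalar_hom) qminor_eq:
  assumes "card J = card K"
  shows "qminor sc M J K = (\<Sum>u\<in>arrangements K. sc (eps_u u) * prod_list (map2 M (sorted_list_of_set J) u))"
proof -
  let ?i = "card K"
  have "map (\<lambda>k. M (sorted_list_of_set J ! (k - 1)) (\<tau> k)) [1..<Suc ?i] =
      map2 M (sorted_list_of_set J) (map \<tau> [1..<Suc ?i])" for \<tau>
    using assms by (intro nth_equalityI) (simp_all del: upt_Suc)
  then have "qminor sc M J K = (\<Sum>\<tau>\<in>bijections ?i K. sc (eps_u (map \<tau> [1..<Suc ?i])) *
      prod_list (map2 M (sorted_list_of_set J) (map \<tau> [1..<Suc ?i])))"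
    unfolding qminor_def assms by (intro sum.cong refl) (simp only: neg_q_eq_eps(1))
  also have "\<dots> = (\<Sum>u\<in>arrangements K. sc (eps_u u) * prod_list (map2 M (sorted_list_of_set J) u))"
    by (rule sum.reindex_bij_betw[OF bij_betw_bijections_arrangements[OF refl]])
  finally show ?thesis .
qed

lemma (in scalar_hom) prod_list_scaled:
  "length s = length u \<Longrightarrow> prod_list (map2 (\<lambda>a b. sc (d a) * M a b) s u) =
    sc (prod_list (map d s)) * prod_list (map2 M s u)"
  "length s = length u \<Longrightarrow> prod_list (map2 (\<lambda>a b. M a b * sc (d b)) s u) =
    prod_list (map2 M s u) * sc (prod_list (map d u))"
proof (induction s u rule: list_induct2)
  case Nil
  case 1 show ?case by (simp add: sc_1)
  case 2 show ?case by (simp add: sc_1)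
next
  case (Cons a s b u)
  {
    case 1
    have "M a b * (sc (prod_list (map d s)) * z) = sc (prod_list (map d s)) * (M a b * z)" for z
      by (simp add: mult.assoc[symmetric] sc_commute[of _ "M a b"])
    then show ?case using Cons by (simp add: sc_mult mult.assoc)
  next
    case 2
    have "sc (d b) * z = z * sc (d b)" for z by (rule sc_commute)
    then show ?case using Cons by (simp add: sc_mult mult.assoc)
  }
qed

lemma (in scalar_hom) qminor_scaled_rows:
  assumes "card J = card K"
  shows "qminor sc (\<lambda>a b. sc (d a) * M a b) J K = sc (\<Prod>a\<in>J. d a) * qminor sc M J K"
proof -
  have d: "prod_list (map d (sorted_list_of_set J)) = (\<Prod>a\<in>J. d a)"
    by (simp add: prod.distinct_set_conv_list[symmetric])
  have "sc (eps_u u) * (sc (\<Prod>a\<in>J. d a) * z) = sc (\<Prod>a\<in>J. d a) * (sc (eps_u u) * z)" for u z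
    by (simp add: mult.assoc[symmetric] mult.commute[of "eps_u u"] flip: sc_mult)
  then show ?thesis
    unfolding qminor_eq[OF assms] sum_distrib_left
    by (intro sum.cong refl) (simp add: prod_list_scaled d assms length_arrangements)
qed

lemma (in scalar_hom) qminor_scaled_columns:
  assumes "card J = card K"
  shows "qminor sc (\<lambda>a b. M a b * sc (d b)) J K = qminor sc M J K * sc (\<Prod>b\<in>K. d b)"
proof -
  have d: "prod_list (map d u) = (\<Prod>b\<in>K. d b)" if "u \<in> arrangements K" for u
    using that by (auto simp: arrangements_def prod.distinct_set_conv_list)
  show ?thesis
    unfolding qminor_eq[OF assms] sum_distrib_right
    by (intro sum.cong refl) (simp add: prod_list_scaled d assms length_arrangements mult.assoc)
qed

lemma qalg_star_0 [simp]: "qalg_star 0 = 0"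
  using qalg_star_add[of 0 0] by simp

lemma qalg_star_sum: "qalg_star (sum f A) = (\<Sum>x\<in>A. qalg_star (f x))"
  by (induction A rule: infinite_finite_induct) (simp_all add: qalg_star_add)

lemma qalg_star_1 [simp]: "qalg_star 1 = 1"
  using qalg_star_scal[of 1] by (simp add: qalg_scal_hom)

lemma qalg_star_prod_list: "qalg_star (prod_list xs) = prod_list (rev (map qalg_star xs))"
  by (induction xs) (simp_all add: qalg_star_mult)

lemma qalg_star_entry_X: "qalg_star (entry X_lmat u w) = entry Y_lmat w u"
proof (cases "length u = length w")
  case True
  then have "map qalg_star (map2 qalg_X u w) = map2 qalg_Y w u"
    by (induction u w rule: list_induct2) (simp_all add: qalg_star_X)
  then show ?thesis using True by (simp add: X_lmat.rep_eq Y_lmat.rep_eq qalg_star_prod_list)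
next
  case False
  then show ?thesis by (simp add: entry_diff_length)
qed

abbreviation X_minor :: "'n::{finite,linorder} set \<Rightarrow> 'n set \<Rightarrow> 'n qalg" where
  "X_minor \<equiv> qminor qalg_scal qalg_X"

lemma sum_lists_arrangements:
  fixes K :: "'n::finite set"
  assumes "card K = n" "\<And>u. length u = n \<Longrightarrow> u \<notin> arrangements K \<Longrightarrow> g u = 0"
  shows "(\<Sum>u | length u = n. g u) = (\<Sum>u\<in>arrangements K. g u)"
  by (rule sum.mono_neutral_right) (auto simp: assms length_arrangements)

lemma sort_distinct: "distinct u \<Longrightarrow> sort u = sorted_list_of_set (set u)"
  by (metis sorted_list_of_set_sort_remdups distinct_remdups_id)

lemma act_map_scal: "act (map_lmat qalg_scal A) (\<lambda>v. qalg_scal (h v)) u = qalg_scal (act A h u)"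
  by (simp add: act_def entry_map_lmat qalg_hom.sc_sum qalg_scal_hom)

lemma act_scal_left: "act A (\<lambda>v. qalg_scal c * f v) u = qalg_scal c * act A f u"
  unfolding act_def sum_distrib_left
  by (intro sum.cong refl) (simp only: mult.assoc[symmetric] qalg_scal_commute[of c "entry A u _"])

lemma entry_Rop_commute:
  fixes M :: "('n::{finite,linorder}, 'n qalg) lmat"
  assumes "qalg_hom.Rop k * on_legs 0 n M = on_legs 0 n M * qalg_hom.Rop k" "length u = n" "length w = n"
  shows "entry (qalg_hom.Rop k * M) u w = entry (M * qalg_hom.Rop k) u w"
proof -
  have M: "entry (on_legs 0 n M) a b = entry M a b" if "length a = n" "length b = n" for a b
    using that entry_on_legs[of "[]" 0 a n "[]" b _ "[]" "[]"] by simp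
  have "entry (qalg_hom.Rop k * on_legs 0 n M) u w = entry (on_legs 0 n M * qalg_hom.Rop k) u w"
    using assms(1) by simp
  then show ?thesis
    using assms(2,3) by (simp add: entry_mult[of u n] tmul_def M)
qed

lemma entry_Rop_X_Y:
  fixes u :: "'n::{finite,linorder} list"
  assumes "Suc k < n" "length u = n" "length w = n"
  shows "entry (qalg_hom.Rop k * X_lmat) u w = entry (X_lmat * qalg_hom.Rop k) u w"
    and "entry (qalg_hom.Rop k * Y_lmat) u w = entry (Y_lmat * qalg_hom.Rop k) u w"
proof -
  obtain m where n: "n = Suc m" using assms by (cases n) auto
  show "entry (qalg_hom.Rop k * X_lmat) u w = entry (X_lmat * qalg_hom.Rop k) u w"
  proof (rule entry_Rop_commute[OF _ assms(2,3)])
    show "qalg_hom.Rop k * on_legs 0 n X_lmat = on_legs 0 n X_lmat * (qalg_hom.Rop k :: ('n, 'n qalg) lmat)"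
      unfolding n Xs_eq_on_legs[of 0 m, symmetric] add_0 by (rule qalg_braid.R_Xs) (use assms n in simp_all)
  qed
  show "entry (qalg_hom.Rop k * Y_lmat) u w = entry (Y_lmat * qalg_hom.Rop k) u w"
  proof (rule entry_Rop_commute[OF _ assms(2,3)])
    show "qalg_hom.Rop k * on_legs 0 n Y_lmat = on_legs 0 n Y_lmat * (qalg_hom.Rop k :: ('n, 'n qalg) lmat)"
      unfolding n Ys_eq_on_legs[of 0 m, symmetric] add_0 by (rule qalg_braid.R_Ys) (use assms n in simp_all)
  qed
qed

text \<open>
  Applied to \<open>u\<^sub>K\<close>, an operator that commutes with the \<open>R\<^sub>k\<close> gives an antisymmetric vector, which is
  determined by its values on sorted lists.
\<close>

lemma commuting_eps_u:
  fixes u :: "'n::{finite,linorder} list"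
  assumes M: "\<And>k u w. Suc k < n \<Longrightarrow> length u = n \<Longrightarrow> length w = n \<Longrightarrow>
      entry (qalg_hom.Rop k * M) u w = entry (M * qalg_hom.Rop k) u w"
    and K: "card K = n" and u: "length u = n"
  shows "(\<Sum>w\<in>arrangements K. entry M u w * qalg_scal (eps_u w)) =
    qalg_scal (eps_u u) * (\<Sum>w\<in>arrangements K. entry M (sort u) w * qalg_scal (eps_u w))"
proof -
  define h where "h w = eps_u w * (if set w = K then 1 else 0)" for w
  define f where "f = act M (\<lambda>w. qalg_scal (h w))"
  have f: "f u = (\<Sum>w\<in>arrangements K. entry M u w * qalg_scal (eps_u w))" if "length u = n" for u
  proof -
    have "f u = (\<Sum>w\<in>arrangements K. entry M u w * qalg_scal (h w))"
      unfolding f_def act_def that using K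
      by (intro sum_lists_arrangements) (auto simp: h_def arrangements_def eps_not_distinct qalg_scal_hom)
    then show ?thesis by (simp add: h_def arrangements_def)
  qed
  have "act (qalg_hom.Rop k) f v = qalg_scal (- (qq ^ 2)) * f v" if "Suc k < n" "length v = n" for k v
  proof -
    have "act (qalg_hom.Rop k) f v = act (qalg_hom.Rop k * M) (\<lambda>w. qalg_scal (h w)) v"
      by (simp add: f_def act_mult_fun)
    also have "\<dots> = act (M * qalg_hom.Rop k) (\<lambda>w. qalg_scal (h w)) v"
      using that by (simp add: act_def M)
    also have "\<dots> = act M (act (qalg_hom.Rop k) (\<lambda>w. qalg_scal (h w))) v"
      by (simp add: act_mult_fun)
    also have "\<dots> = act M (\<lambda>w. qalg_scal (- (qq ^ 2)) * qalg_scal (h w)) v"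
    proof (rule act_cong)
      fix w :: "'n list" assume "length w = length v"
      then have "act (id_hom.Rop k) h w = - (qq ^ 2) * h w"
        unfolding h_def using that by (intro act_Rop_eps_u) simp
      then show "act (qalg_hom.Rop k) (\<lambda>w. qalg_scal (h w)) w = qalg_scal (- (qq ^ 2)) * qalg_scal (h w)"
        unfolding qalg_hom.Rop_eq_map act_map_scal by (simp add: qalg_scal_hom(4)[symmetric])
    qed
    finally show ?thesis by (simp add: act_scal_left f_def)
  qed
  then have "f u = qalg_scal (eps_u u) * f (sort u)"
    using qalg_hom.act_eigen_eq_eps_u[of n f u] u by simp
  then show ?thesis using f[OF u] f[of "sort u"] u by simp
qed

text \<open>
  On sorted lists, the sum is the defining expansion of the minor.
\<close>

lemma X_eps_u:
  fixes u :: "'n::{finite,linorder} list"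
  assumes K: "card K = n" and u: "length u = n"
  shows "(\<Sum>w\<in>arrangements K. entry X_lmat u w * qalg_scal (eps_u w)) = qalg_scal (eps_u u) * X_minor (set u) K"
proof (cases "distinct u")
  case True
  have card: "card (set u) = card K" using True u K by (simp add: distinct_card)
  have "(\<Sum>w\<in>arrangements K. entry X_lmat (sort u) w * qalg_scal (eps_u w)) = X_minor (set u) K"
    unfolding qalg_hom.qminor_eq[OF card] sort_distinct[OF True]
    using u by (intro sum.cong refl)
      (simp add: X_lmat.rep_eq length_arrangements card K qalg_scal_commute)
  then show ?thesis using commuting_eps_u[OF entry_Rop_X_Y(1) K u] by simp
next
  case False
  then show ?thesis using commuting_eps_u[OF entry_Rop_X_Y(1) K u] by (simp add: eps_not_distinct qalg_scal_hom)
qed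

text \<open>
  The involution turns the row \<open>v\<^sub>J X\<^sub>1 \<cdots> X\<^sub>n\<close> into the column \<open>Y\<^sub>n \<cdots> Y\<^sub>1 u\<^sub>J\<close>, which is
  antisymmetric.  Its value on a sorted list is an expansion of the minor along the other index
  set.  That this is the same minor follows by evaluating \<open>v\<^sub>J X\<^sub>1 \<cdots> X\<^sub>n u\<^sub>K\<close> in two ways and cancelling
  \<open>[n]!\<close>.
\<close>

lemma eps_v_X:
  fixes w :: "'n::{finite,linorder} list"
  assumes J: "card J = n" and w: "length w = n"
  shows "(\<Sum>u\<in>arrangements J. qalg_scal (eps_v u) * entry X_lmat u w) = qalg_scal (eps_v w) * X_minor J (set w)"
proof -
  define f where "f w = (\<Sum>u\<in>arrangements J. qalg_scal (eps_v u) * entry X_lmat u w)" for w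
  have f_star: "f w = qalg_star (\<Sum>u\<in>arrangements J. entry Y_lmat w u * qalg_scal (eps_u u))" for w
    by (simp add: f_def qalg_star_sum qalg_star_mult qalg_star_scal flip: qalg_star_entry_X)
  have *: "f v = qalg_scal (eps_v v) * f (sort v)" if "length v = n" for v
  proof -
    have "(\<Sum>u\<in>arrangements J. entry Y_lmat v u * qalg_scal (eps_u u)) =
        qalg_scal (eps_u v) * (\<Sum>u\<in>arrangements J. entry Y_lmat (sort v) u * qalg_scal (eps_u u))"
      by (rule commuting_eps_u[OF _ J that]) (rule entry_Rop_X_Y(2))
    then show ?thesis
      unfolding f_star by (simp only: qalg_star_mult qalg_star_scal rf_star_eps_u qalg_scal_commute)
  qed
  show ?thesis
  proof (cases "distinct w")
    case True
    define K where "K = set w"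
    have K: "card K = n" using True w by (simp add: distinct_card K_def)
    have sorted: "sort v = sorted_list_of_set K" if "v \<in> arrangements K" for v
      using that by (auto simp: arrangements_def sort_distinct)
    have "(\<Sum>v\<in>arrangements K. f v * qalg_scal (eps_u v)) =
        (\<Sum>v\<in>arrangements K. qalg_scal (eps_v v * eps_u v)) * f (sorted_list_of_set K)"
      unfolding sum_distrib_right
    proof (intro sum.cong refl)
      fix v assume v: "v \<in> arrangements K"
      then have "f v = qalg_scal (eps_v v) * f (sorted_list_of_set K)"
        using *[of v] sorted[OF v] K by (simp add: length_arrangements)
      then show "f v * qalg_scal (eps_u v) = qalg_scal (eps_v v * eps_u v) * f (sorted_list_of_set K)"
        by (simp only: qalg_scal_hom(4) mult.assoc qalg_scal_commute[of "eps_u v" "f (sorted_list_of_set K)"])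
    qed
    also have "\<dots> = qalg_scal (q_fact n) * f (sorted_list_of_set K)"
      by (simp add: sum_eps_v_eps_u K flip: qalg_hom.sc_sum)
    finally have 1: "(\<Sum>v\<in>arrangements K. f v * qalg_scal (eps_u v)) = qalg_scal (q_fact n) * f (sorted_list_of_set K)" .
    have "(\<Sum>v\<in>arrangements K. f v * qalg_scal (eps_u v)) =
        (\<Sum>v\<in>arrangements K. \<Sum>u\<in>arrangements J. qalg_scal (eps_v u) * entry X_lmat u v * qalg_scal (eps_u v))"
      using K by (intro sum.cong refl) (simp add: f_def length_arrangements sum_distrib_right)
    also have "\<dots> = (\<Sum>u\<in>arrangements J. qalg_scal (eps_v u) * (\<Sum>v\<in>arrangements K. entry X_lmat u v * qalg_scal (eps_u v)))"
      unfolding sum_distrib_left mult.assoc by (rule sum.swap)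
    also have "\<dots> = (\<Sum>u\<in>arrangements J. qalg_scal (eps_v u * eps_u u) * X_minor J K)"
    proof (intro sum.cong refl)
      fix u assume u: "u \<in> arrangements J"
      then have "set u = J" "length u = n" using J by (auto simp: arrangements_def distinct_card)
      then show "qalg_scal (eps_v u) * (\<Sum>v\<in>arrangements K. entry X_lmat u v * qalg_scal (eps_u v)) =
          qalg_scal (eps_v u * eps_u u) * X_minor J K"
        by (simp add: X_eps_u[OF K] qalg_scal_hom(4) mult.assoc)
    qed
    also have "\<dots> = qalg_scal (q_fact n) * X_minor J K"
      by (simp add: sum_eps_v_eps_u J flip: qalg_hom.sc_sum sum_distrib_right)
    finally have "f (sorted_list_of_set K) = X_minor J K"
      using 1 qalg_hom.sc_cancel[of "q_fact n"] by simp
    then show ?thesis using *[OF w] f_def[of w] True by (simp add: sort_distinct K_def)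
  next
    case False
    then show ?thesis using *[OF w] f_def[of w] by (simp add: eps_not_distinct qalg_scal_hom)
  qed
qed

lemma Y_eps_u:
  fixes w :: "'n::{finite,linorder} list"
  assumes "card J = n" "length w = n"
  shows "(\<Sum>u\<in>arrangements J. entry Y_lmat w u * qalg_scal (eps_u u)) =
    qalg_star (X_minor J (set w)) * qalg_scal (eps_u w)"
  using arg_cong[OF eps_v_X[OF assms], of qalg_star]
  by (simp add: qalg_star_sum qalg_star_mult qalg_star_scal qalg_star_entry_X)

section \<open>The two extreme traces\<close>

lemma sum_distinct_lists:
  fixes g :: "'n::finite list \<Rightarrow> 'b::comm_monoid_add"
  assumes "\<And>u. length u = n \<Longrightarrow> \<not> distinct u \<Longrightarrow> g u = 0"
  shows "(\<Sum>u | length u = n. g u) = (\<Sum>J\<in>subsets_of_card n. \<Sum>u\<in>arrangements J. g u)"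
proof -
  have "(\<Sum>J\<in>subsets_of_card n. \<Sum>u\<in>arrangements J. g u) = sum g (\<Union>J\<in>subsets_of_card n. arrangements J)"
    using finite_arrangements[OF finite]
    by (intro sum.UNION_disjoint[symmetric]) (auto simp: arrangements_def)
  also have "(\<Union>J\<in>subsets_of_card n. arrangements J) = {u :: 'n list. length u = n \<and> distinct u}"
    by (auto simp: subsets_of_card_def arrangements_def distinct_card)
  also have "sum g \<dots> = (\<Sum>u | length u = n. g u)"
    by (rule sum.mono_neutral_left) (use assms in auto)
  finally show ?thesis ..
qed

text \<open>
  Between \<open>X\<close> and \<open>Y\<close> only the antisymmetric vectors \<open>v\<^sub>K\<close> and \<open>u\<^sub>K\<close> meet, and
  \<open>v\<^sub>K u\<^sub>K = [n]!\<close>.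
\<close>

lemma eps_v_XY_eps_u:
  fixes J :: "'n::{finite,linorder} set"
  assumes J: "card J = n"
  shows "(\<Sum>w\<in>arrangements J. \<Sum>u\<in>arrangements J.
      qalg_scal (eps_v w) * entry (X_lmat * Y_lmat) w u * qalg_scal (eps_u u)) =
    qalg_scal (q_fact n) * (\<Sum>K\<in>subsets_of_card n. X_minor J K * qalg_star (X_minor J K))"
proof -
  have "(\<Sum>w\<in>arrangements J. \<Sum>u\<in>arrangements J.
      qalg_scal (eps_v w) * entry (X_lmat * Y_lmat) w u * qalg_scal (eps_u u)) =
    (\<Sum>w\<in>arrangements J. \<Sum>u\<in>arrangements J. \<Sum>v | length v = n.
      (qalg_scal (eps_v w) * entry X_lmat w v) * (entry Y_lmat v u * qalg_scal (eps_u u)))"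
    using J by (intro sum.cong refl)
      (simp add: entry_mult[of _ n] length_arrangements tmul_def sum_distrib_left sum_distrib_right mult.assoc)
  also have "\<dots> = (\<Sum>v | length v = n. \<Sum>w\<in>arrangements J. \<Sum>u\<in>arrangements J.
      (qalg_scal (eps_v w) * entry X_lmat w v) * (entry Y_lmat v u * qalg_scal (eps_u u)))"
    by (subst (2) sum.swap, subst sum.swap) (rule refl)
  also have "\<dots> = (\<Sum>v | length v = n. (\<Sum>w\<in>arrangements J. qalg_scal (eps_v w) * entry X_lmat w v) *
      (\<Sum>u\<in>arrangements J. entry Y_lmat v u * qalg_scal (eps_u u)))"
    unfolding sum_product ..
  also have "\<dots> = (\<Sum>v | length v = n. qalg_scal (eps_v v) * X_minor J (set v) *
      (qalg_star (X_minor J (set v)) * qalg_scal (eps_u v)))"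
    by (intro sum.cong refl) (simp add: eps_v_X[OF J] Y_eps_u[OF J])
  also have "\<dots> = (\<Sum>v | length v = n. qalg_scal (eps_v v * eps_u v) *
      (X_minor J (set v) * qalg_star (X_minor J (set v))))"
    by (intro sum.cong refl) (simp only: qalg_scal_hom(4) mult.assoc
        qalg_scal_commute[of "eps_u _" "X_minor J _ * qalg_star (X_minor J _)"])
  also have "\<dots> = (\<Sum>K\<in>subsets_of_card n. \<Sum>v\<in>arrangements K. qalg_scal (eps_v v * eps_u v) *
      (X_minor J (set v) * qalg_star (X_minor J (set v))))"
    by (rule sum_distinct_lists) (simp add: eps_not_distinct qalg_scal_hom)
  also have "\<dots> = (\<Sum>K\<in>subsets_of_card n. \<Sum>v\<in>arrangements K. qalg_scal (eps_v v * eps_u v) *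
      (X_minor J K * qalg_star (X_minor J K)))"
    by (intro sum.cong refl) (simp add: arrangements_def)
  also have "\<dots> = qalg_scal (q_fact n) * (\<Sum>K\<in>subsets_of_card n. X_minor J K * qalg_star (X_minor J K))"
    unfolding sum_distrib_left sum_distrib_right[symmetric] qalg_hom.sc_sum[symmetric] sum_eps_v_eps_u
    by (simp add: subsets_of_card_def)
  finally show ?thesis .
qed

lemma on_block_entry:
  assumes "length u = n" "length w = n"
  shows "entry (on_legs 0 n A * B) u w = entry (A * B) u w"
    and "entry (B * on_legs 0 n A) u w = entry (B * A) u w"
    and "entry (on_legs 0 0 Y_lmat * B) u w = entry B u w"
    and "entry (B * on_legs n 0 Y_lmat) u w = entry B u w"
proof -
  have A: "entry (on_legs 0 n A) a b = entry A a b" if "length a = n" "length b = n" for a b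
    using that entry_on_legs[of "[]" 0 a n "[]" b A "[]" "[]"] by simp
  show "entry (on_legs 0 n A * B) u w = entry (A * B) u w"
    and "entry (B * on_legs 0 n A) u w = entry (B * A) u w"
    using assms by (simp_all add: entry_mult[of u n] tmul_def A)
  have 0: "entry (on_legs 0 0 Y_lmat) a b = (if a = b then 1 else 0)" for a b :: "'c::{finite,linorder} list"
    by (auto simp: on_legs.rep_eq Y_lmat.rep_eq)
  show "entry (on_legs 0 0 Y_lmat * B) u w = entry B u w" for B
    using assms by (simp add: entry_mult_act act_def 0 if_distrib[of "\<lambda>x. x * _"] cong: if_cong)
  have n: "entry (on_legs n 0 Y_lmat) a b = (if a = b then 1 else 0)" if "length a = n" "length b = n" for a b :: "'c::{finite,linorder} list"
    using that by (auto simp: on_legs.rep_eq Y_lmat.rep_eq)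
  show "entry (B * on_legs n 0 Y_lmat) u w = entry B u w" for B
    using assms by (simp add: entry_mult_ract ract_def n if_distrib[of "\<lambda>x. _ * x"] cong: if_cong)
qed

lemma qalg_scal_left_commute: "qalg_scal c * (qalg_scal d * z) = qalg_scal d * (qalg_scal c * z)"
  by (simp only: mult.assoc[symmetric] qalg_scal_hom(4)[symmetric] mult.commute[of c])

lemma mixed_trace_0:
  "(mixed_trace n 0 :: 'n::{finite,linorder} qalg) = qalg_scal (q_fact n) *
    (\<Sum>J\<in>subsets_of_card n. qalg_scal (\<Prod>a\<in>J. D_entry a ^ 2) *
      (\<Sum>K\<in>subsets_of_card n. X_minor J K * qalg_star (X_minor J K)))"
proof -
  let ?Z = "X_lmat * Y_lmat :: ('n, 'n qalg) lmat"
  let ?\<omega> = "\<lambda>u :: 'n list. prod_list (map (\<lambda>a. D_entry a ^ 2) u)"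
  have "mixed_trace n 0 = (\<Sum>u | length u = n. qalg_scal (?\<omega> u) * entry (qantisym * ?Z) u u)"
    unfolding mixed_trace_def wtrace_def
    by (intro sum.cong refl) (simp add: mixed_weight_def mult.assoc on_block_entry,
      simp add: mult.assoc[symmetric] on_block_entry)
  also have "\<dots> = (\<Sum>J\<in>subsets_of_card n. \<Sum>u\<in>arrangements J. qalg_scal (?\<omega> u) * entry (qantisym * ?Z) u u)"
    by (rule sum_distinct_lists)
      (simp add: entry_mult_act act_def entry_map_lmat entry_antisym eps_not_distinct qalg_scal_hom cong: if_cong)
  also have "\<dots> = (\<Sum>J\<in>subsets_of_card n. qalg_scal (\<Prod>a\<in>J. D_entry a ^ 2) *
      (\<Sum>w\<in>arrangements J. \<Sum>u\<in>arrangements J. qalg_scal (eps_v w) * entry ?Z w u * qalg_scal (eps_u u)))"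
  proof (rule sum.cong[OF refl])
    fix J :: "'n set" assume "J \<in> subsets_of_card n"
    then have J: "card J = n" by (simp add: subsets_of_card_def)
    have "(\<Sum>u\<in>arrangements J. qalg_scal (?\<omega> u) * entry (qantisym * ?Z) u u) =
        (\<Sum>u\<in>arrangements J. qalg_scal (\<Prod>a\<in>J. D_entry a ^ 2) *
          (\<Sum>w\<in>arrangements J. qalg_scal (eps_v w) * entry ?Z w u * qalg_scal (eps_u u)))"
    proof (intro sum.cong refl arg_cong2[where f = "(*)"])
      fix u assume u: "u \<in> arrangements J"
      then have u': "distinct u" "set u = J" "length u = n" using J by (auto simp: arrangements_def distinct_card)
      show "qalg_scal (?\<omega> u) = qalg_scal (\<Prod>a\<in>J. D_entry a ^ 2)"
        using prod.distinct_set_conv_list[OF u'(1), of "\<lambda>a. D_entry a ^ 2"] u'(2) by simp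
      have "entry (qantisym * ?Z) u u =
          (\<Sum>w | length w = length u. if set w = set u then qalg_scal (eps_u u * eps_v w) * entry ?Z w u else 0)"
        unfolding entry_mult_act act_def by (intro sum.cong refl) (auto simp: entry_map_lmat entry_antisym qalg_scal_hom(1))
      also have "\<dots> = (\<Sum>w\<in>arrangements (set u). qalg_scal (eps_u u * eps_v w) * entry ?Z w u)"
        by (rule sum_permutations[OF u'(1)])
      also have "\<dots> = (\<Sum>w\<in>arrangements J. qalg_scal (eps_v w) * entry ?Z w u * qalg_scal (eps_u u))"
        unfolding u'(2)
      proof (intro sum.cong refl)
        fix w
        show "qalg_scal (eps_u u * eps_v w) * entry ?Z w u = qalg_scal (eps_v w) * entry ?Z w u * qalg_scal (eps_u u)"
          unfolding qalg_scal_commute[of "eps_u u", symmetric] by (simp only: qalg_scal_hom(4) mult.assoc)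
      qed
      finally show "entry (qantisym * ?Z) u u =
          (\<Sum>w\<in>arrangements J. qalg_scal (eps_v w) * entry ?Z w u * qalg_scal (eps_u u))" .
    qed
    also have "\<dots> = qalg_scal (\<Prod>a\<in>J. D_entry a ^ 2) * (\<Sum>u\<in>arrangements J.
        \<Sum>w\<in>arrangements J. qalg_scal (eps_v w) * entry ?Z w u * qalg_scal (eps_u u))"
      by (rule sum_distrib_left[symmetric])
    also have "(\<Sum>u\<in>arrangements J. \<Sum>w\<in>arrangements J. qalg_scal (eps_v w) * entry ?Z w u * qalg_scal (eps_u u)) =
        (\<Sum>w\<in>arrangements J. \<Sum>u\<in>arrangements J. qalg_scal (eps_v w) * entry ?Z w u * qalg_scal (eps_u u))"
      by (rule sum.swap)
    finally show "(\<Sum>u\<in>arrangements J. qalg_scal (?\<omega> u) * entry (qantisym * ?Z) u u) =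
        qalg_scal (\<Prod>a\<in>J. D_entry a ^ 2) *
        (\<Sum>w\<in>arrangements J. \<Sum>u\<in>arrangements J. qalg_scal (eps_v w) * entry ?Z w u * qalg_scal (eps_u u))" .
  qed
  also have "\<dots> = (\<Sum>J\<in>subsets_of_card n. qalg_scal (\<Prod>a\<in>J. D_entry a ^ 2) *
      (qalg_scal (q_fact n) * (\<Sum>K\<in>subsets_of_card n. X_minor J K * qalg_star (X_minor J K))))"
    by (intro sum.cong refl) (simp add: eps_v_XY_eps_u subsets_of_card_def)
  also have "\<dots> = qalg_scal (q_fact n) * (\<Sum>J\<in>subsets_of_card n. qalg_scal (\<Prod>a\<in>J. D_entry a ^ 2) *
      (\<Sum>K\<in>subsets_of_card n. X_minor J K * qalg_star (X_minor J K)))"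
    by (subst sum_distrib_left) (intro sum.cong refl qalg_scal_left_commute)
  finally show ?thesis .
qed

lemma mixed_trace_n:
  "(mixed_trace n n :: 'n::{finite,linorder} qalg) = qalg_scal (q_fact n) *
    (\<Sum>J\<in>subsets_of_card n. qalg_scal (\<Prod>a\<in>J. D'_entry a ^ 2) *
      (\<Sum>K\<in>subsets_of_card n. qalg_star (X_minor K J) * X_minor K J))"
proof -
  let ?P = "qantisym :: ('n, 'n qalg) lmat"
  let ?\<omega> = "\<lambda>u :: 'n list. prod_list (map (\<lambda>a. D'_entry a ^ 2) u)"
  have PX: "entry (Y_lmat * ?P * X_lmat) u u =
    qalg_scal (eps_v u * eps_u u) * (\<Sum>K\<in>subsets_of_card n. qalg_star (X_minor K (set u)) * X_minor K (set u))"
    if u: "length u = n" for u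
  proof -
    have "entry (Y_lmat * ?P * X_lmat) u u = (\<Sum>v | length v = n. \<Sum>w | length w = n.
        entry Y_lmat u v * entry ?P v w * entry X_lmat w u)"
      using u by (simp add: mult.assoc entry_mult[of _ n] tmul_def sum_distrib_left)
    also have "\<dots> = (\<Sum>v | length v = n. \<Sum>w | length w = n. if set w = set v then
        entry Y_lmat u v * qalg_scal (eps_u v) * (qalg_scal (eps_v w) * entry X_lmat w u) else 0)"
      by (intro sum.cong refl) (auto simp: entry_map_lmat entry_antisym qalg_scal_hom mult.assoc)
    also have "\<dots> = (\<Sum>K\<in>subsets_of_card n. \<Sum>v\<in>arrangements K. \<Sum>w | length w = n. if set w = set v then
        entry Y_lmat u v * qalg_scal (eps_u v) * (qalg_scal (eps_v w) * entry X_lmat w u) else 0)"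
      by (rule sum_distinct_lists) (auto simp: eps_not_distinct qalg_scal_hom intro!: sum.neutral)
    also have "\<dots> = (\<Sum>K\<in>subsets_of_card n. \<Sum>v\<in>arrangements K. \<Sum>w\<in>arrangements K.
        entry Y_lmat u v * qalg_scal (eps_u v) * (qalg_scal (eps_v w) * entry X_lmat w u))"
    proof (rule sum.cong[OF refl], rule sum.cong[OF refl])
      fix K :: "'n set" and v assume "K \<in> subsets_of_card n" "v \<in> arrangements K"
      then have "distinct v" "set v = K" "length v = n" by (auto simp: arrangements_def subsets_of_card_def distinct_card)
      then show "(\<Sum>w | length w = n. if set w = set v then
        entry Y_lmat u v * qalg_scal (eps_u v) * (qalg_scal (eps_v w) * entry X_lmat w u) else 0) =
        (\<Sum>w\<in>arrangements K. entry Y_lmat u v * qalg_scal (eps_u v) * (qalg_scal (eps_v w) * entry X_lmat w u))"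
        using sum_permutations[of v] by simp
    qed
    also have "\<dots> = (\<Sum>K\<in>subsets_of_card n. (\<Sum>v\<in>arrangements K. entry Y_lmat u v * qalg_scal (eps_u v)) *
        (\<Sum>w\<in>arrangements K. qalg_scal (eps_v w) * entry X_lmat w u))"
      unfolding sum_product ..
    also have "\<dots> = (\<Sum>K\<in>subsets_of_card n. (qalg_star (X_minor K (set u)) * qalg_scal (eps_u u)) *
        (qalg_scal (eps_v u) * X_minor K (set u)))"
      using u by (intro sum.cong refl) (simp add: Y_eps_u[of _ n] eps_v_X[of _ n] subsets_of_card_def)
    also have "\<dots> = (\<Sum>K\<in>subsets_of_card n. qalg_scal (eps_v u * eps_u u) * (qalg_star (X_minor K (set u)) * X_minor K (set u)))"
    proof (intro sum.cong refl)
      fix K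
      have "qalg_star (X_minor K (set u)) * qalg_scal (eps_u u) * (qalg_scal (eps_v u) * X_minor K (set u)) =
          (qalg_star (X_minor K (set u)) * qalg_scal (eps_u u * eps_v u)) * X_minor K (set u)"
        by (simp only: qalg_scal_hom(4) mult.assoc)
      then show "qalg_star (X_minor K (set u)) * qalg_scal (eps_u u) * (qalg_scal (eps_v u) * X_minor K (set u)) =
          qalg_scal (eps_v u * eps_u u) * (qalg_star (X_minor K (set u)) * X_minor K (set u))"
        unfolding qalg_scal_commute[of "eps_u u * eps_v u", symmetric] by (simp only: mult.assoc mult.commute[of "eps_u u"])
    qed
    finally show ?thesis by (simp only: sum_distrib_left)
  qed
  have "mixed_trace n n = (\<Sum>u | length u = n. qalg_scal (?\<omega> u) * entry (Y_lmat * ?P * X_lmat) u u)"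
    unfolding mixed_trace_def wtrace_def
    by (intro sum.cong refl) (simp add: mixed_weight_def on_block_entry(4),
      simp add: mult.assoc on_block_entry(1))
  also have "\<dots> = (\<Sum>u | length u = n. qalg_scal (?\<omega> u) * (qalg_scal (eps_v u * eps_u u) *
      (\<Sum>K\<in>subsets_of_card n. qalg_star (X_minor K (set u)) * X_minor K (set u))))"
    by (intro sum.cong refl) (simp add: PX)
  also have "\<dots> = (\<Sum>J\<in>subsets_of_card n. \<Sum>u\<in>arrangements J. qalg_scal (?\<omega> u) * (qalg_scal (eps_v u * eps_u u) *
      (\<Sum>K\<in>subsets_of_card n. qalg_star (X_minor K (set u)) * X_minor K (set u))))"
    by (rule sum_distinct_lists) (simp add: eps_not_distinct qalg_scal_hom)
  also have "\<dots> = (\<Sum>J\<in>subsets_of_card n. \<Sum>u\<in>arrangements J. qalg_scal (eps_v u * eps_u u) * (qalg_scal (\<Prod>a\<in>J. D'_entry a ^ 2) *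
      (\<Sum>K\<in>subsets_of_card n. qalg_star (X_minor K J) * X_minor K J)))"
  proof (intro sum.cong refl)
    fix J :: "'n set" and u assume "u \<in> arrangements J"
    then have u: "distinct u" "set u = J" by (auto simp: arrangements_def)
    then have "?\<omega> u = (\<Prod>a\<in>J. D'_entry a ^ 2)"
      using prod.distinct_set_conv_list[of u "\<lambda>a. D'_entry a ^ 2"] by simp
    then show "qalg_scal (?\<omega> u) * (qalg_scal (eps_v u * eps_u u) *
      (\<Sum>K\<in>subsets_of_card n. qalg_star (X_minor K (set u)) * X_minor K (set u))) =
      qalg_scal (eps_v u * eps_u u) * (qalg_scal (\<Prod>a\<in>J. D'_entry a ^ 2) *
      (\<Sum>K\<in>subsets_of_card n. qalg_star (X_minor K J) * X_minor K J))"
      unfolding u(2) by (simp only: qalg_scal_left_commute)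
  qed
  also have "\<dots> = qalg_scal (q_fact n) *
    (\<Sum>J\<in>subsets_of_card n. qalg_scal (\<Prod>a\<in>J. D'_entry a ^ 2) *
      (\<Sum>K\<in>subsets_of_card n. qalg_star (X_minor K J) * X_minor K J))"
    unfolding sum_distrib_left[of "qalg_scal (q_fact n)"] sum_distrib_right[symmetric] qalg_hom.sc_sum[symmetric] sum_eps_v_eps_u
    by (intro sum.cong refl) (simp add: subsets_of_card_def)
  finally show ?thesis .
qed

text \<open>
  The two sums are the mixed traces with all \<open>Y\<close> on the right and with all \<open>Y\<close> on the left.
\<close>

lemma sum_minors_eq:
  "(\<Sum>J\<in>subsets_of_card n. qalg_scal (\<Prod>a\<in>J. D_entry a ^ 2) *
      (\<Sum>K\<in>subsets_of_card n. X_minor J K * qalg_star (X_minor J K))) =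
   (\<Sum>J\<in>subsets_of_card n. qalg_scal (\<Prod>a\<in>J. D'_entry a ^ 2) *
      (\<Sum>K\<in>subsets_of_card n. qalg_star (X_minor K J) * (X_minor K J :: 'n::{finite,linorder} qalg)))"
  by (rule qalg_hom.sc_cancel[of "q_fact n"])
    (simp_all only: mixed_trace_0[symmetric] mixed_trace_n[symmetric] mixed_trace_eq q_fact_nonzero simp_thms not_False_eq_True)

section \<open>Expansion of sigma along the legs\<close>

lemma v_row_eq: "length a = CARD('n) \<Longrightarrow> v_row (a :: 'n::{finite,linorder} list) = eps_v a"
  and u_col_eq: "length a = CARD('n) \<Longrightarrow> u_col (a :: 'n list) = eps_u a"
proof -
  let ?B = "bijections CARD('n) (UNIV :: 'n set)"
  have 1: "(\<Sum>\<sigma>\<in>?B. h (map \<sigma> [1..<Suc CARD('n)]) * (if a = map \<sigma> [1..<Suc CARD('n)] then 1 else 0)) =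
      (if a \<in> arrangements UNIV then h a else 0)" for h :: "'n list \<Rightarrow> 'n ratfun"
    using sum.reindex_bij_betw[OF bij_betw_bijections_arrangements[of "UNIV :: 'n set", OF refl],
        of "\<lambda>u. h u * (if a = u then 1 else 0)"]
    by (simp add: if_distrib[of "\<lambda>x. _ * x"] cong: if_cong)
  assume "length a = CARD('n)"
  then have "set a = UNIV" if "distinct a"
    using that by (metis card_subset_eq distinct_card finite subset_UNIV)
  then have 2: "\<not> distinct a" if "a \<notin> arrangements UNIV"
    using that by (auto simp: arrangements_def)
  have "v_row a = (if a \<in> arrangements UNIV then eps_v a else 0)"
    unfolding v_row_def 1[of eps_v, symmetric] by (intro sum.cong refl) (simp only: neg_q_eq_eps(2))
  then show "v_row a = eps_v a" using 2 by (auto simp: eps_not_distinct)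
  have "u_col a = (if a \<in> arrangements UNIV then eps_u a else 0)"
    unfolding u_col_def 1[of eps_u, symmetric] by (intro sum.cong refl) (simp only: neg_q_eq_eps(1))
  then show "u_col a = eps_u a" using 2 by (auto simp: eps_not_distinct)
qed

lemma tpow_cong:
  assumes "\<And>u w. length u = n \<Longrightarrow> length w = n \<Longrightarrow> A u w = B u w" "length u = n" "length w = n"
  shows "tpow n k A u w = tpow n k B u w"
  using assms(2,3)
proof (induction k arbitrary: u)
  case (Suc k)
  then show ?case
    unfolding tpow_def funpow.simps comp_def by (intro tmul_cong) (simp_all add: assms(1))
qed (simp add: tpow_def)

lemma leg_eq_on_legs:
  assumes "length u = length w" "u \<noteq> []"
  shows "leg 1 (\<lambda>a b. entry A [a] [b]) u w = entry (on_legs 0 1 A) u w"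
proof -
  obtain a u' b w' where u: "u = a # u'" "w = b # w'" using assms by (cases u; cases w) auto
  have "(\<forall>l<length u. l \<noteq> 0 \<longrightarrow> u ! l = w ! l) \<longleftrightarrow> u' = w'"
  proof
    assume *: "\<forall>l<length u. l \<noteq> 0 \<longrightarrow> u ! l = w ! l"
    have "u' ! l = w' ! l" if "l < length u'" for l
      using *[rule_format, of "Suc l"] that u by simp
    then show "u' = w'" using assms u by (intro nth_equalityI) auto
  next
    assume "u' = w'"
    then show "\<forall>l<length u. l \<noteq> 0 \<longrightarrow> u ! l = w ! l" using u by (simp add: nth_Cons')
  qed
  then show ?thesis
    using entry_on_legs[of "[]" 0 "[a]" 1 "[]" "[b]" A u' w'] by (simp add: leg_def u)
qed

lemma leg2_eq_Rop:
  assumes "length u = length w" "Suc k < length u"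
  shows "leg2 (Suc k) (tmap qalg_scal Rhat) u w = entry (qalg_hom.Rop k) u w"
proof -
  obtain x a b z where u: "u = x @ a # b # z" "length x = k" using assms(2) by (rule nth_split_2)
  obtain x' a' b' z' where w: "w = x' @ a' # b' # z'" "length x' = k" using assms by (metis nth_split_2)
  have len: "length z = length z'" using assms u w by simp
  have "(\<forall>l<length u. l \<noteq> k \<and> l \<noteq> Suc k \<longrightarrow> u ! l = w ! l) \<longleftrightarrow> x = x' \<and> z = z'"
  proof
    assume *: "\<forall>l<length u. l \<noteq> k \<and> l \<noteq> Suc k \<longrightarrow> u ! l = w ! l"
    have "x ! l = x' ! l" if "l < k" for l
      using *[rule_format, of l] that u w by (simp add: nth_append)
    moreover have "z ! l = z' ! l" if "l < length z" for l
      using *[rule_format, of "Suc (Suc (k + l))"] that u w by (simp add: nth_append)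
    ultimately show "x = x' \<and> z = z'" using u w len by (auto simp: list_eq_iff_nth_eq)
  next
    assume "x = x' \<and> z = z'"
    then show "\<forall>l<length u. l \<noteq> k \<and> l \<noteq> Suc k \<longrightarrow> u ! l = w ! l"
      using u w by (auto simp: nth_append nth_Cons')
  qed
  moreover have "entry (qalg_hom.Rop k) (x @ [a, b] @ z) (x' @ [a', b'] @ z') =
      (if x = x' \<and> z = z' then qalg_scal (Rhat [a, b] [a', b']) else 0)"
    unfolding qalg_hom.Rop_def using u w
    by (subst entry_on_legs) (simp_all add: entry_map_lmat Rhat_lmat.rep_eq)
  ultimately show ?thesis
    using u w by (simp add: leg2_def tmap_def nth_append)
qed

lemma sigma_factor_eq:
  assumes "Suc m \<le> CARD('n)" "length u = CARD('n)" "length w = CARD('n)"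
  shows "sigma_factor (Suc m) u (w :: 'n::{finite,linorder} list) =
    entry (on_legs 0 1 X_lmat * on_legs 0 1 Y_lmat * qalg_braid.Rs 0 m) u w"
  using assms
proof (induction m arbitrary: w)
  case 0
  then have "u \<noteq> []" by auto
  have "XY_mat = (\<lambda>a b. entry (X_lmat * Y_lmat) [a] [b :: 'n])"
  proof (intro ext)
    fix a b :: 'n
    have "entry (X_lmat * Y_lmat) [a] [b] = (\<Sum>c\<in>UNIV. \<Sum>v | length v = 0. qalg_X a c * entry Y_lmat (c # v) [b])"
      using sum_lists_Cons[of "\<lambda>v. entry X_lmat [a] v * entry Y_lmat v [b]" 0]
      by (simp add: entry_mult[of _ 1] tmul_def X_lmat.rep_eq)
    then show "XY_mat a b = entry (X_lmat * Y_lmat) [a] [b]"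
      by (simp add: XY_mat_def Y_lmat.rep_eq)
  qed
  then show ?case
    using leg_eq_on_legs[of u w "X_lmat * Y_lmat"] 0 \<open>u \<noteq> []\<close>
    by (simp add: sigma_factor_def qalg_braid.Rs_def on_legs_mult)
next
  case (Suc m)
  let ?A = "on_legs 0 1 X_lmat * on_legs 0 1 Y_lmat * qalg_braid.Rs 0 m :: ('n, 'n qalg) lmat"
  have "sigma_factor (Suc (Suc m)) u w =
      tmul CARD('n) (sigma_factor (Suc m)) (leg2 (Suc m) (tmap qalg_scal Rhat)) u w"
    by (simp add: sigma_factor_def)
  also have "\<dots> = tmul CARD('n) (entry ?A) (entry (qalg_hom.Rop m)) u w"
    using Suc by (intro tmul_cong) (simp_all add: leg2_eq_Rop)
  also have "\<dots> = entry (?A * qalg_hom.Rop m) u w"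
    using Suc by (simp add: entry_mult)
  finally show ?case by (simp add: qalg_braid.Rs_Suc mult.assoc)
qed

text \<open>
  The inversions between the entries in \<open>J\<close> and those in its complement, counted with \<open>q\<^sup>2\<close>.
\<close>

definition cross_weight :: "'n::{finite,linorder} set \<Rightarrow> 'n ratfun" where
  "cross_weight J = (\<Prod>x\<in>J. (qq ^ 2) ^ card {y \<in> - J. y < x})"

lemma eps_append_eps_append:
  assumes "a \<in> arrangements J" "b \<in> arrangements J" "s \<in> arrangements (- J)"
  shows "eps_v (a @ s) * eps_u (b @ s) = cross_weight J * (eps_v s * eps_u s) * (eps_v a * eps_u b)"
proof -
  have sets: "set a = J" "set b = J" "set s = - J" using assms by (auto simp: arrangements_def)
  have "(\<Prod>x\<in>J. \<Prod>y\<in>{y \<in> - J. y < x}. - qij x y) * (\<Prod>x\<in>J. \<Prod>y\<in>{y \<in> - J. y < x}. - qij y x) =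
      (\<Prod>x\<in>J. \<Prod>y\<in>{y \<in> - J. y < x}. qq ^ 2)"
    unfolding prod.distrib[symmetric] by (intro prod.cong refl) (auto simp: qij_mult_qij)
  also have "\<dots> = cross_weight J" by (simp add: cross_weight_def)
  finally have cross: "(\<Prod>x\<in>J. \<Prod>y\<in>{y \<in> - J. y < x}. - qij x y) *
      (\<Prod>x\<in>J. \<Prod>y\<in>{y \<in> - J. y < x}. - qij y x) = cross_weight J" .
  have v: "eps_v (a @ s) = (\<Prod>x\<in>J. \<Prod>y\<in>{y \<in> - J. y < x}. - qij x y) * (eps_v a * eps_v s)"
    using eps_append[of a s qij] sets by simp
  have u: "eps_u (b @ s) = (\<Prod>x\<in>J. \<Prod>y\<in>{y \<in> - J. y < x}. - qij y x) * (eps_u b * eps_u s)"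
    using eps_append[of b s "\<lambda>x y. qij y x"] sets by simp
  show ?thesis unfolding v u cross[symmetric] by (simp only: mult_ac)
qed

lemma sum_lists_append:
  "(\<Sum>u | length u = i + m. g u) = (\<Sum>x | length x = i. \<Sum>y | length y = m. g (x @ y :: 'n::finite list))"
proof -
  have "(\<Sum>x | length x = i. \<Sum>y | length y = m. g (x @ y)) =
      (\<Sum>(x, y)\<in>{x. length x = i} \<times> {y. length y = m}. g (x @ y))"
    by (simp add: sum.cartesian_product)
  also have "\<dots> = (\<Sum>u | length u = i + m. g u)"
    by (rule sum.reindex_bij_witness[of _ "\<lambda>u. (take i u, drop i u)" "\<lambda>(x, y). x @ y"]) auto
  finally show ?thesis ..
qed

lemma card_complement: "card (- J) = CARD('n) - card (J :: 'n::finite set)"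
  by (simp add: Compl_eq_Diff_UNIV card_Diff_subset)

lemma complement_arrangement:
  fixes J :: "'n::finite set"
  assumes "distinct (a @ s)" "set a = J" "length s + card J = CARD('n)"
  shows "s \<in> arrangements (- J)"
proof -
  have "set s \<subseteq> - J" "card (set s) = card (- J)"
    using assms by (auto simp: distinct_card card_complement)
  then have "set s = - J" by (intro card_subset_eq) auto
  then show ?thesis using assms by (simp add: arrangements_def)
qed

text \<open>
  The last \<open>m\<close> legs are not touched by the operator, so they carry the same indices in the row and
  in the column.  A nonzero term needs distinct indices on all legs; hence the indices on these \<open>m\<close> legs
  fill the complement of the set \<open>J\<close> that occurs on the first \<open>i\<close> legs, both in the row and in the
  column.
\<close>

lemma laplace_expansion:
  fixes Z :: "('n::{finite,linorder}, 'n qalg) lmat"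
  assumes N: "i + m = CARD('n)"
  shows "(\<Sum>a | length a = CARD('n). \<Sum>b | length b = CARD('n).
      qalg_scal (eps_v a) * entry (on_legs 0 i Z) a b * qalg_scal (eps_u b)) =
    qalg_scal (q_fact m) * (\<Sum>J\<in>subsets_of_card i. qalg_scal (cross_weight J) *
      (\<Sum>a\<in>arrangements J. \<Sum>b\<in>arrangements J. qalg_scal (eps_v a) * entry Z a b * qalg_scal (eps_u b)))"
proof -
  \<comment> \<open>The term with row index \<open>a @ s\<close> and column index \<open>b @ s\<close>.\<close>
  define h where "h a b s = qalg_scal (eps_v (a @ s)) * entry Z a b * qalg_scal (eps_u (b @ s))" for a b s
  have h0: "h a b s = 0" if "\<not> distinct (a @ s) \<or> \<not> distinct (b @ s)" for a b s
    using that eps_not_distinct[of "a @ s" qij] eps_not_distinct[of "b @ s" "\<lambda>x y. qij y x"]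
    by (elim disjE) (simp_all add: h_def qalg_scal_hom del: distinct_append)
  have entry: "entry (on_legs 0 i Z) (a @ s) (b @ t) = (if s = t then entry Z a b else 0)"
    if "length a = i" "length b = i" for a b s t
    using that entry_on_legs[of "[]" 0 a i "[]" b Z s t] by simp
  have "(\<Sum>a | length a = CARD('n). \<Sum>b | length b = CARD('n).
      qalg_scal (eps_v a) * entry (on_legs 0 i Z) a b * qalg_scal (eps_u b)) =
    (\<Sum>a | length a = i. \<Sum>s | length s = m. \<Sum>b | length b = i. \<Sum>t | length t = m. if s = t then h a b s else 0)"
    unfolding N[symmetric] sum_lists_append by (intro sum.cong refl) (auto simp: entry h_def)
  also have "\<dots> = (\<Sum>a | length a = i. \<Sum>s | length s = m. \<Sum>b | length b = i. h a b s)"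
    by (intro sum.cong refl) simp
  also have "\<dots> = (\<Sum>J\<in>subsets_of_card i. \<Sum>a\<in>arrangements J. \<Sum>s | length s = m. \<Sum>b | length b = i. h a b s)"
    by (rule sum_distinct_lists) (simp add: h0)
  also have "\<dots> = (\<Sum>J\<in>subsets_of_card i. \<Sum>a\<in>arrangements J. \<Sum>s\<in>arrangements (- J). \<Sum>b\<in>arrangements J. h a b s)"
  proof (rule sum.cong[OF refl], rule sum.cong[OF refl])
    fix J :: "'n set" and a assume "J \<in> subsets_of_card i" and a: "a \<in> arrangements J"
    then have J: "card J = i" by (simp add: subsets_of_card_def)
    have a': "set a = J" "distinct a" using a by (auto simp: arrangements_def)
    have Jm: "card (- J) = m" using J N by (simp add: card_complement)
    have "(\<Sum>s | length s = m. \<Sum>b | length b = i. h a b s) = (\<Sum>s\<in>arrangements (- J). \<Sum>b | length b = i. h a b s)"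
    proof (rule sum_lists_arrangements[OF Jm])
      fix s :: "'n list" assume s: "length s = m" "s \<notin> arrangements (- J)"
      then have "\<not> distinct (a @ s)" using complement_arrangement[of a s J] a' J N by auto
      then show "(\<Sum>b | length b = i. h a b s) = 0" by (simp add: h0 del: distinct_append)
    qed
    also have "\<dots> = (\<Sum>s\<in>arrangements (- J). \<Sum>b\<in>arrangements J. h a b s)"
    proof (rule sum.cong[OF refl])
      fix s assume s: "s \<in> arrangements (- J)"
      show "(\<Sum>b | length b = i. h a b s) = (\<Sum>b\<in>arrangements J. h a b s)"
      proof (rule sum_lists_arrangements[OF J])
        fix b :: "'n list" assume b: "length b = i" "b \<notin> arrangements J"
        have "\<not> distinct (b @ s)"
        proof
          assume "distinct (b @ s)"
          then have "b \<in> arrangements (- (- J))"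
            using s b Jm N by (intro complement_arrangement[of s]) (auto simp: arrangements_def)
          then show False using b by simp
        qed
        then show "h a b s = 0" by (simp add: h0 del: distinct_append)
      qed
    qed
    finally show "(\<Sum>s | length s = m. \<Sum>b | length b = i. h a b s) =
        (\<Sum>s\<in>arrangements (- J). \<Sum>b\<in>arrangements J. h a b s)" .
  qed
  also have "\<dots> = (\<Sum>J\<in>subsets_of_card i. \<Sum>a\<in>arrangements J. \<Sum>s\<in>arrangements (- J). \<Sum>b\<in>arrangements J.
      qalg_scal (eps_v s * eps_u s) * (qalg_scal (cross_weight J) * (qalg_scal (eps_v a) * entry Z a b * qalg_scal (eps_u b))))"
  proof (intro sum.cong refl)
    fix J :: "'n set" and a s b
    assume *: "a \<in> arrangements J" "s \<in> arrangements (- J)" "b \<in> arrangements J"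
    have "h a b s = qalg_scal (eps_v (a @ s) * eps_u (b @ s)) * entry Z a b"
      unfolding h_def mult.assoc qalg_scal_commute[of _ "entry Z a b", symmetric] by (simp only: qalg_scal_hom(4) mult.assoc)
    also have "\<dots> = qalg_scal (eps_v s * eps_u s) * (qalg_scal (cross_weight J) *
        (qalg_scal (eps_v a) * (qalg_scal (eps_u b) * entry Z a b)))"
      unfolding eps_append_eps_append[OF *(1,3,2)] mult.commute[of "cross_weight J"]
      by (simp only: qalg_scal_hom(4) mult.assoc)
    finally show "h a b s = qalg_scal (eps_v s * eps_u s) * (qalg_scal (cross_weight J) *
        (qalg_scal (eps_v a) * entry Z a b * qalg_scal (eps_u b)))"
      unfolding qalg_scal_commute[of "eps_u b"] by (simp only: mult.assoc)
  qed
  also have "\<dots> = (\<Sum>J\<in>subsets_of_card i. \<Sum>s\<in>arrangements (- J). qalg_scal (eps_v s * eps_u s) *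
      (qalg_scal (cross_weight J) *
      (\<Sum>a\<in>arrangements J. \<Sum>b\<in>arrangements J. qalg_scal (eps_v a) * entry Z a b * qalg_scal (eps_u b))))"
    unfolding sum_distrib_left by (rule sum.cong[OF refl], rule sum.swap)
  also have "\<dots> = (\<Sum>J\<in>subsets_of_card i. qalg_scal (q_fact m) * (qalg_scal (cross_weight J) *
      (\<Sum>a\<in>arrangements J. \<Sum>b\<in>arrangements J. qalg_scal (eps_v a) * entry Z a b * qalg_scal (eps_u b))))"
    unfolding sum_distrib_right[symmetric] qalg_hom.sc_sum[symmetric] sum_eps_v_eps_u
    by (intro sum.cong refl) (simp add: subsets_of_card_def card_complement N[symmetric])
  finally show ?thesis by (simp only: sum_distrib_left)
qed

lemma prod_power_rank:
  fixes t :: "'c::comm_semiring_1"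
  assumes "finite (J :: 'n::linorder set)"
  shows "(\<Prod>x\<in>J. t ^ card {y \<in> J. y < x}) = t ^ (\<Sum>k<card J. k)"
  using assms
proof (induction J rule: finite_linorder_max_induct)
  case (insert b A)
  have "{y \<in> insert b A. y < b} = A" using insert by auto
  moreover have "{y \<in> insert b A. y < x} = {y \<in> A. y < x}" if "x \<in> A" for x
    using that insert by force
  moreover have "b \<notin> A" using insert by auto
  ultimately show ?case using insert by (simp add: power_add mult.commute)
qed simp

text \<open>
  The elements below \<open>a\<close> lie either in \<open>J\<close> or in its complement.  Over all \<open>a\<close> the former add up to
  \<open>0 + 1 + \<dots> + m\<close>, and the latter give \<open>cross_weight\<close>.
\<close>

lemma prod_D_entry:
  fixes J :: "'n::{finite,linorder} set"
  assumes "card J = Suc m"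
  shows "(\<Prod>a\<in>J. D_entry a ^ 2) = qq ^ (m * Suc m) * cross_weight J"
proof -
  have "D_entry a ^ 2 = (qq ^ 2) ^ card {y \<in> J. y < a} * (qq ^ 2) ^ card {y \<in> - J. y < a}" for a
  proof -
    have "{j. j < a} = {y \<in> J. y < a} \<union> {y \<in> - J. y < a}" by auto
    then have "card {j. j < a} = card {y \<in> J. y < a} + card {y \<in> - J. y < a}"
      by (simp only:) (rule card_Un_disjoint, auto)
    then show ?thesis
      by (simp add: D_entry_def power_mult[symmetric] power_add[symmetric] algebra_simps)
  qed
  then have "(\<Prod>a\<in>J. D_entry a ^ 2) = (qq ^ 2) ^ (\<Sum>k<Suc m. k) * cross_weight J"
    by (simp only: prod.distrib prod_power_rank[OF finite] assms cross_weight_def)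
  moreover have "2 * (\<Sum>k<Suc m. k) = m * Suc m" by (induction m) simp_all
  ultimately show ?thesis by (simp only: power_mult[symmetric])
qed

lemma act_Rs_power_eps_u:
  assumes "m < CARD('n)" "length v = CARD('n)"
  shows "act (qalg_braid.Rs 0 m ^ k) (\<lambda>v :: 'n::{finite,linorder} list. qalg_scal (eps_u v)) v =
    qalg_scal (((- (qq ^ 2)) ^ m) ^ k) * qalg_scal (eps_u v)"
proof -
  let ?e = "\<lambda>v :: 'n list. qalg_scal (eps_u v)"
  let ?N = "CARD('n)"
  \<comment> \<open>\<open>P A c\<close>: the column vector \<open>u\<close> is an eigenvector of \<open>A\<close> for the eigenvalue \<open>c\<close>.\<close>
  define P where "P A c \<longleftrightarrow> (\<forall>v. length v = ?N \<longrightarrow> act A ?e v = qalg_scal c * ?e v)" for A c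
  have one: "P 1 1"
    by (simp add: P_def act_def entry_one qalg_scal_hom if_distrib[of "\<lambda>x. x * _"] cong: if_cong)
  have mult: "P (A * B) (c * d)" if "P A c" "P B d" for A B c d
    unfolding P_def
  proof (intro allI impI)
    fix v :: "'n list" assume v: "length v = ?N"
    have "act (A * B) ?e v = act A (\<lambda>v. qalg_scal d * ?e v) v"
      unfolding act_mult using that(2) v by (intro act_cong) (simp add: P_def)
    then show "act (A * B) ?e v = qalg_scal (c * d) * ?e v"
      using that(1) v by (simp add: act_scal_left P_def qalg_scal_hom mult.commute[of c] mult.assoc)
  qed
  have R: "P (qalg_hom.Rop j) (- (qq ^ 2))" if "Suc j < ?N" for j
    unfolding P_def
  proof (intro allI impI)
    fix v :: "'n list" assume "length v = ?N"
    then have "act (id_hom.Rop j) eps_u v = - (qq ^ 2) * eps_u v"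
      using act_Rop_eps_u[of j v "\<lambda>_. 1"] that by simp
    then show "act (qalg_hom.Rop j) ?e v = qalg_scal (- (qq ^ 2)) * ?e v"
      unfolding qalg_hom.Rop_eq_map act_map_scal by (simp only: qalg_scal_hom(4))
  qed
  have "P (qalg_braid.Rs 0 m) ((- (qq ^ 2)) ^ m)"
    using assms(1)
  proof (induction m)
    case (Suc m)
    then have "P (qalg_braid.Rs 0 m * qalg_hom.Rop m) ((- (qq ^ 2)) ^ m * - (qq ^ 2))"
      by (intro mult R) simp_all
    then show ?case by (simp add: qalg_braid.Rs_Suc mult.commute)
  qed (simp add: one)
  then have "P (qalg_braid.Rs 0 m ^ k) (((- (qq ^ 2)) ^ m) ^ k)"
    by (induction k) (simp_all add: one mult)
  then show ?thesis using assms(2) by (simp add: P_def)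
qed

text \<open>
  The power of \<open>q\<close> is \<open>q\<^bsup>-i(i-1)\<^esup>\<close> from the definition times \<open>q\<^bsup>2i(i-1)\<^esup>\<close> from the braid
  word; the factors \<open>[i]!\<close> and \<open>[N-i]!\<close>, which arise from \<open>v\<^sub>K u\<^sub>K\<close> and from the legs split off,
  cancel against \<open>alpha i\<close>.
\<close>

lemma sigma_qQ_eq:
  assumes i: "Suc m \<le> CARD('n)"
  shows "(sigma_qQ (Suc m) :: 'n::{finite,linorder} qalg) =
    (\<Sum>J\<in>subsets_of_card (Suc m). qalg_scal (\<Prod>a\<in>J. D_entry a ^ 2) *
      (\<Sum>K\<in>subsets_of_card (Suc m). X_minor J K * qalg_star (X_minor J K)))"
proof -
  let ?N = "CARD('n)" and ?i = "Suc m"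
  let ?Z = "X_lmat * Y_lmat :: ('n, 'n qalg) lmat"
  let ?A = "on_legs 0 1 X_lmat * on_legs 0 1 Y_lmat * qalg_braid.Rs 0 m :: ('n, 'n qalg) lmat"
  let ?t = "((- (qq ^ 2)) ^ m) ^ ?i :: 'n ratfun"
  let ?S = "\<lambda>J :: 'n set. \<Sum>K\<in>subsets_of_card ?i. X_minor J K * qalg_star (X_minor J K)"
  let ?e = "\<lambda>b :: 'n list. qalg_scal (eps_u b)"
  have pow: "?A ^ ?i = on_legs 0 ?i ?Z * qalg_braid.Rs 0 m ^ ?i"
  proof -
    have "qalg_braid.Rs 0 m ^ ?i * qalg_braid.Ys 0 ?i = (qalg_braid.Ys 0 ?i :: ('n, 'n qalg) lmat) * qalg_braid.Rs 0 m ^ ?i"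
      by (rule power_commuting_commutes) (rule qalg_braid.Rs_Ys; simp)
    then show ?thesis
      unfolding qalg_braid.power_factorization on_legs_mult
      using Xs_eq_on_legs[of 0 m, where 'n = 'n] Ys_eq_on_legs[of 0 m, where 'n = 'n] by (simp add: mult.assoc)
  qed
  have "(\<Sum>a | length a = ?N. \<Sum>b | length b = ?N.
      qalg_scal (v_row a) * tpow ?N ?i (sigma_factor ?i) a b * qalg_scal (u_col b)) =
    (\<Sum>a | length a = ?N. \<Sum>b | length b = ?N. qalg_scal (eps_v a) * entry (?A ^ ?i) a b * qalg_scal (eps_u b))"
  proof (intro sum.cong refl)
    fix a b :: "'n list" assume "a \<in> {a. length a = ?N}" "b \<in> {b. length b = ?N}"
    then have len: "length a = ?N" "length b = ?N" by simp_all
    have "tpow ?N ?i (sigma_factor ?i) a b = tpow ?N ?i (entry ?A) a b"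
      using sigma_factor_eq[OF i] len by (intro tpow_cong) auto
    then show "qalg_scal (v_row a) * tpow ?N ?i (sigma_factor ?i) a b * qalg_scal (u_col b) =
        qalg_scal (eps_v a) * entry (?A ^ ?i) a b * qalg_scal (eps_u b)"
      unfolding v_row_eq[OF len(1)] u_col_eq[OF len(2)] entry_power[OF len(1)] by simp
  qed
  also have "\<dots> = (\<Sum>a | length a = ?N. qalg_scal (eps_v a) * act (?A ^ ?i) ?e a)"
    unfolding act_def sum_distrib_left by (intro sum.cong refl) (simp_all add: mult.assoc)
  also have "\<dots> = (\<Sum>a | length a = ?N. qalg_scal (eps_v a) * (qalg_scal ?t * act (on_legs 0 ?i ?Z) ?e a))"
  proof (intro sum.cong refl)
    fix a :: "'n list" assume a: "a \<in> {a. length a = ?N}"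
    have "act (?A ^ ?i) ?e a = act (on_legs 0 ?i ?Z) (\<lambda>b. qalg_scal ?t * ?e b) a"
      unfolding pow act_mult using a i by (intro act_cong act_Rs_power_eps_u) auto
    then show "qalg_scal (eps_v a) * act (?A ^ ?i) ?e a =
        qalg_scal (eps_v a) * (qalg_scal ?t * act (on_legs 0 ?i ?Z) ?e a)"
      unfolding act_scal_left by simp
  qed
  also have "\<dots> = qalg_scal ?t * (\<Sum>a | length a = ?N. \<Sum>b | length b = ?N.
      qalg_scal (eps_v a) * entry (on_legs 0 ?i ?Z) a b * ?e b)"
    unfolding sum_distrib_left qalg_scal_left_commute[of "eps_v _" ?t] act_def
    by (intro sum.cong refl) (simp_all add: sum_distrib_left mult.assoc)
  also have "\<dots> = qalg_scal ?t * (qalg_scal (q_fact (?N - ?i)) * (\<Sum>J\<in>subsets_of_card ?i.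
      qalg_scal (cross_weight J) * (qalg_scal (q_fact ?i) * ?S J)))"
    using i by (subst laplace_expansion[of ?i "?N - ?i"])
      (auto simp: eps_v_XY_eps_u subsets_of_card_def intro!: sum.cong arg_cong2[where f = "(*)"])
  finally have main: "(\<Sum>a | length a = ?N. \<Sum>b | length b = ?N.
      qalg_scal (v_row a) * tpow ?N ?i (sigma_factor ?i) a b * qalg_scal (u_col b)) =
    qalg_scal ?t * (qalg_scal (q_fact (?N - ?i)) * (\<Sum>J\<in>subsets_of_card ?i.
      qalg_scal (cross_weight J) * (qalg_scal (q_fact ?i) * ?S J)))" .
  have coeff: "qq powi (- ((int ?i - 1) * int ?i)) * alpha ?i * ?t * q_fact (?N - ?i) * cross_weight J * q_fact ?i =
      (\<Prod>a\<in>J. D_entry a ^ 2)" if "J \<in> subsets_of_card ?i" for J :: "'n set"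
  proof -
    have J: "card J = ?i" using that by (simp add: subsets_of_card_def)
    have al: "(alpha ?i :: 'n ratfun) * q_fact (?N - ?i) * q_fact ?i = 1"
      by (simp add: alpha_def field_simps)
    have e: "(int ?i - 1) * int ?i = int (m * ?i)" by (simp add: algebra_simps)
    have "even (m * ?i)" by simp
    then have "?t = (qq ^ 2) ^ (m * ?i)"
      unfolding power_mult[symmetric, of "- (qq ^ 2)"] by (rule power_minus_even)
    then have t: "?t = qq ^ (m * ?i) * qq ^ (m * ?i)"
      by (simp only: power_mult[symmetric] mult_2 power_add)
    have "qq powi (- ((int ?i - 1) * int ?i)) * ?t = (qq ^ (m * ?i) :: 'n ratfun)"
      unfolding e t by (simp only: power_int_minus power_int_of_nat) (simp add: field_simps)
    then have "qq powi (- ((int ?i - 1) * int ?i)) * ?t * (alpha ?i * q_fact (?N - ?i) * q_fact ?i) * cross_weight J =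
        qq ^ (m * ?i) * cross_weight J"
      unfolding al by simp
    then show ?thesis unfolding prod_D_entry[OF J] by (simp only: mult_ac)
  qed
  have "(sigma_qQ ?i :: 'n qalg) = (\<Sum>J\<in>subsets_of_card ?i.
      qalg_scal (qq powi (- ((int ?i - 1) * int ?i)) * alpha ?i * ?t * q_fact (?N - ?i) * cross_weight J * q_fact ?i) * ?S J)"
    unfolding sigma_qQ_def main by (simp only: sum_distrib_left qalg_scal_hom(4) mult.assoc nat.distinct if_False)
  then show ?thesis by (simp only: coeff cong: sum.cong)
qed

lemma rf_star_prod_D: "rf_star (\<Prod>a\<in>J. D_entry a) = (\<Prod>a\<in>J. D_entry a)"
  "rf_star (\<Prod>a\<in>J. D'_entry a) = (\<Prod>a\<in>J. D'_entry a)"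
proof -
  have power: "rf_star (x ^ n) = rf_star x ^ n" for x :: "'a ratfun" and n
    by (induction n) (simp_all add: rf_star_mult)
  have prod: "rf_star (prod f A) = (\<Prod>x\<in>A. rf_star (f x))" for f :: "'b \<Rightarrow> 'a ratfun" and A
    by (induction A rule: infinite_finite_induct) (simp_all add: rf_star_mult)
  show "rf_star (\<Prod>a\<in>J. D_entry a) = (\<Prod>a\<in>J. D_entry a)"
    "rf_star (\<Prod>a\<in>J. D'_entry a) = (\<Prod>a\<in>J. D'_entry a)"
    by (simp_all add: prod D_entry_def D'_entry_def power)
qed

lemma sum_minor_DX_YD:
  "(\<Sum>J\<in>subsets_of_card i. \<Sum>K\<in>subsets_of_card i.
      minor_DX qalg_scal qalg_X J K * minor_YD qalg_scal qalg_X qalg_star K J) =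
   (\<Sum>J\<in>subsets_of_card i. qalg_scal (\<Prod>a\<in>J. D_entry a ^ 2) *
      (\<Sum>K\<in>subsets_of_card i. X_minor J K * qalg_star (X_minor J K :: 'n::{finite,linorder} qalg)))"
  unfolding sum_distrib_left
proof (intro sum.cong refl)
  fix J K :: "'n set"
  assume "J \<in> subsets_of_card i" "K \<in> subsets_of_card i"
  then have card: "card J = card K" by (simp add: subsets_of_card_def)
  let ?d = "\<Prod>a\<in>J. D_entry a"
  have "minor_DX qalg_scal qalg_X J K * minor_YD qalg_scal qalg_X qalg_star K J =
      qalg_scal ?d * ((X_minor J K * qalg_star (X_minor J K)) * qalg_scal ?d)"
    by (simp add: minor_YD_def minor_DX_def qalg_hom.qminor_scaled_rows[OF card] qalg_star_mult qalg_star_scal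
        rf_star_prod_D mult.assoc)
  also have "\<dots> = qalg_scal (?d * ?d) * (X_minor J K * qalg_star (X_minor J K))"
    unfolding qalg_scal_commute[of ?d "X_minor J K * _", symmetric] by (simp only: qalg_scal_hom(4) mult.assoc)
  finally show "minor_DX qalg_scal qalg_X J K * minor_YD qalg_scal qalg_X qalg_star K J =
      qalg_scal (\<Prod>a\<in>J. D_entry a ^ 2) * (X_minor J K * qalg_star (X_minor J K))"
    by (simp only: power2_eq_square prod.distrib)
qed

lemma sum_minor_D'Y_XD':
  "(\<Sum>J\<in>subsets_of_card i. \<Sum>K\<in>subsets_of_card i.
      minor_D'Y qalg_scal qalg_X qalg_star J K * minor_XD' qalg_scal qalg_X K J) =
   (\<Sum>J\<in>subsets_of_card i. qalg_scal (\<Prod>a\<in>J. D'_entry a ^ 2) *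
      (\<Sum>K\<in>subsets_of_card i. qalg_star (X_minor K J) * (X_minor K J :: 'n::{finite,linorder} qalg)))"
  unfolding sum_distrib_left
proof (intro sum.cong refl)
  fix J K :: "'n set"
  assume "J \<in> subsets_of_card i" "K \<in> subsets_of_card i"
  then have card: "card K = card J" by (simp add: subsets_of_card_def)
  let ?d = "\<Prod>a\<in>J. D'_entry a"
  have "minor_D'Y qalg_scal qalg_X qalg_star J K * minor_XD' qalg_scal qalg_X K J =
      qalg_scal ?d * ((qalg_star (X_minor K J) * X_minor K J) * qalg_scal ?d)"
    by (simp add: minor_D'Y_def minor_XD'_def qalg_hom.qminor_scaled_columns[OF card] qalg_star_mult qalg_star_scal
        rf_star_prod_D mult.assoc)
  also have "\<dots> = qalg_scal (?d * ?d) * (qalg_star (X_minor K J) * X_minor K J)"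
    unfolding qalg_scal_commute[of ?d "qalg_star (X_minor K J) * _", symmetric] by (simp only: qalg_scal_hom(4) mult.assoc)
  finally show "minor_D'Y qalg_scal qalg_X qalg_star J K * minor_XD' qalg_scal qalg_X K J =
      qalg_scal (\<Prod>a\<in>J. D'_entry a ^ 2) * (qalg_star (X_minor K J) * X_minor K J)"
    by (simp only: power2_eq_square prod.distrib)
qed

lemma sigma_qQ_eq_minors:
  assumes "i \<le> CARD('n)"
  shows "(sigma_qQ i :: 'n::{finite,linorder} qalg) = (\<Sum>J\<in>subsets_of_card i. \<Sum>K\<in>subsets_of_card i.
      minor_DX qalg_scal qalg_X J K * minor_YD qalg_scal qalg_X qalg_star K J)"
proof (cases i)
  case 0
  have "subsets_of_card 0 = {{} :: 'n set}" by (auto simp: subsets_of_card_def)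
  then show ?thesis
    unfolding sum_minor_DX_YD by (simp add: 0 sigma_qQ_def qalg_hom.qminor_eq qalg_scal_hom)
next
  case (Suc m)
  then show ?thesis unfolding sum_minor_DX_YD using assms sigma_qQ_eq by simp
qed

section \<open>Signed monomials\<close>

lemma signed_monomial_mult:
  assumes "signed_monomial c" "signed_monomial d"
  shows "signed_monomial (c * d :: 'n::{finite,linorder} ratfun)"
proof -
  obtain s m and e :: "'n \<Rightarrow> 'n \<Rightarrow> int" where c: "s \<in> {1, - 1}"
      "c = s * qq powi m * (\<Prod>a\<in>UNIV. \<Prod>b\<in>UNIV. qij a b powi e a b)"
    using assms(1) unfolding signed_monomial_def by blast
  obtain s' m' and e' :: "'n \<Rightarrow> 'n \<Rightarrow> int" where d: "s' \<in> {1, - 1}"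
      "d = s' * qq powi m' * (\<Prod>a\<in>UNIV. \<Prod>b\<in>UNIV. qij a b powi e' a b)"
    using assms(2) unfolding signed_monomial_def by blast
  have "c * d = (s * s') * qq powi (m + m') * (\<Prod>a\<in>UNIV. \<Prod>b\<in>UNIV. qij a b powi (e a b + e' a b))"
    unfolding c d by (simp add: power_int_add prod.distrib mult_ac)
  moreover have "s * s' \<in> {1, - 1}" using c(1) d(1) by auto
  ultimately show ?thesis
    unfolding signed_monomial_def
    by (intro bexI[of _ "s * s'"] exI[of _ "m + m'"] exI[of _ "\<lambda>a b. e a b + e' a b"])
qed

lemma signed_monomial_1: "signed_monomial 1"
  unfolding signed_monomial_def
  by (intro bexI[of _ 1] exI[of _ 0] exI[of _ "\<lambda>_ _. 0"]) simp_all

lemma signed_monomial_qq: "signed_monomial qq"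
  unfolding signed_monomial_def
  by (intro bexI[of _ 1] exI[of _ 1] exI[of _ "\<lambda>_ _. 0"]) simp_all

lemma signed_monomial_minus_qij: "signed_monomial (- qij x y)"
  unfolding signed_monomial_def
proof (intro bexI[of _ "- 1"] exI[of _ 0] exI[of _ "\<lambda>a b. if a = x \<and> b = y then 1 else 0"])
  have "(\<Prod>b\<in>UNIV. qij a b powi (if a = x \<and> b = y then 1 else 0)) = (if a = x then qij x y else 1)" for a
  proof -
    have "(\<Prod>b\<in>UNIV. qij a b powi (if a = x \<and> b = y then 1 else 0)) =
        (\<Prod>b\<in>UNIV. if b = y then (if a = x then qij x y else 1) else 1)"
      by (intro prod.cong refl) auto
    then show ?thesis by simp
  qed
  then show "- qij x y = - 1 * qq powi 0 *
      (\<Prod>a\<in>UNIV. \<Prod>b\<in>UNIV. qij a b powi (if a = x \<and> b = y then 1 else 0))"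
    by simp
qed simp

lemma signed_monomial_power: "signed_monomial c \<Longrightarrow> signed_monomial (c ^ n)"
  by (induction n) (simp_all add: signed_monomial_1 signed_monomial_mult)

lemma signed_monomial_prod: "(\<And>x. x \<in> A \<Longrightarrow> signed_monomial (f x)) \<Longrightarrow> signed_monomial (prod f A)"
  by (induction A rule: infinite_finite_induct) (simp_all add: signed_monomial_1 signed_monomial_mult)

lemma signed_monomial_eps:
  "distinct u \<Longrightarrow> (\<And>x y. signed_monomial (- Q x y)) \<Longrightarrow> signed_monomial (eps Q u)"
  by (induction u) (simp_all add: signed_monomial_1 signed_monomial_mult signed_monomial_prod)

lemma rf_var_monomial: "rf_var x = monomial_frac (frag_of x) 1"
  by (simp add: rf_var_def monomial_frac_def)

text \<open>
  The fractions of the form \<open>m / 1\<close> with a monic Laurent monomial \<open>m\<close> form a group that contains all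
  \<open>q\<^sub>a\<^sub>b\<close>.
\<close>

lemma signed_monomial_imp_monomial_frac:
  assumes "signed_monomial (c :: 'n::{finite,linorder} ratfun)"
  obtains m s where "s \<in> {1, - 1}" "c = monomial_frac m s"
proof -
  define U :: "'n ratfun set" where "U = {c. \<exists>m. c = monomial_frac m 1}"
  have one: "1 \<in> U" unfolding U_def using monomial_frac_0_1 by (metis (mono_tags) mem_Collect_eq)
  have mult: "c * d \<in> U" if "c \<in> U" "d \<in> U" for c d
    using that by (auto simp: U_def monomial_frac_mult)
  have inverse: "inverse c \<in> U" if "c \<in> U" for c
    using that by (auto simp: U_def monomial_frac_inverse)
  have power: "c ^ n \<in> U" if "c \<in> U" for c n
    using that by (induction n) (simp_all add: one mult)
  have power_int: "c powi k \<in> U" if "c \<in> U" for c k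
    using that by (simp add: power_int_def power inverse)
  have prod: "(\<And>x. x \<in> A \<Longrightarrow> f x \<in> U) \<Longrightarrow> prod f A \<in> U" for f :: "'n \<Rightarrow> 'n ratfun" and A
    by (induction A rule: infinite_finite_induct) (simp_all add: one mult)
  have var: "rf_var x \<in> U" for x by (auto simp: U_def rf_var_monomial)
  have qij: "qij a b \<in> U" for a b
    by (simp add: qij_def one var qq_def divide_inverse mult inverse power)
  obtain s m and e :: "'n \<Rightarrow> 'n \<Rightarrow> int" where s: "s \<in> {1, - 1}"
    and c: "c = s * qq powi m * (\<Prod>a\<in>UNIV. \<Prod>b\<in>UNIV. qij a b powi e a b)"
    using assms unfolding signed_monomial_def by blast
  have "qq powi m * (\<Prod>a\<in>UNIV. \<Prod>b\<in>UNIV. qij a b powi e a b) \<in> U"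
    by (intro mult prod power_int qij) (simp add: qq_def var)
  then obtain k where k: "qq powi m * (\<Prod>a\<in>UNIV. \<Prod>b\<in>UNIV. qij a b powi e a b) = monomial_frac k 1"
    by (auto simp: U_def)
  have "- monomial_frac k 1 = monomial_frac k (- 1)"
    by (simp add: monomial_frac_def single_uminus)
  then show ?thesis
    using that[of 1 k] that[of "- 1" k] s unfolding c mult.assoc k by auto
qed

lemma rf_subst_monomial_frac:
  assumes h: "h 0 = 0" "\<And>a b. h (a + b) = h a + h b" "\<And>a b. h (a * b) = h a * h b" "h 1 = 1"
    and \<rho>: "\<And>x. \<rho> x \<noteq> 0"
  shows "rf_subst h \<rho> (monomial_frac m c) = h c * (\<Prod>x\<in>UNIV. \<rho> x powi Poly_Mapping.lookup m x)"
proof -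
  have single: "laurent_eval h \<rho> (Poly_Mapping.single m c) = h c * (\<Prod>x\<in>UNIV. \<rho> x powi Poly_Mapping.lookup m x)" for m c
    unfolding laurent_eval_def by (rule lin_ext_single) (simp add: h)
  have one: "laurent_eval h \<rho> 1 = 1"
    using single[of 0 1] by (simp add: h(4))
  show ?thesis
    unfolding monomial_frac_def by (subst rf_subst_Fract) (simp_all add: h \<rho> one single)
qed

lemma one_parameter_signed_monomial:
  assumes "signed_monomial (c :: 'n::{finite,linorder} ratfun)"
  shows "\<exists>s\<in>{1, - 1}. \<exists>k :: int. one_parameter c = s * qq powi k"
proof -
  obtain m s where s: "s \<in> {1, - 1}" "c = monomial_frac m s"
    using assms by (rule signed_monomial_imp_monomial_frac)
  have const: "rf_const 0 = (0 :: 'n ratfun)" "rf_const (a + b) = rf_const a + (rf_const b :: 'n ratfun)"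
    "rf_const (a * b) = rf_const a * (rf_const b :: 'n ratfun)" "rf_const 1 = (1 :: 'n ratfun)"
    "rf_const (- 1) = (- 1 :: 'n ratfun)" for a b
    by (simp_all add: rf_const_def Zero_fract_def One_fract_def single_add mult_single single_uminus)
  have "(\<Prod>x\<in>A. qq powi Poly_Mapping.lookup m x) = (qq :: 'n ratfun) powi (\<Sum>x\<in>A. Poly_Mapping.lookup m x)" for A
    by (induction A rule: infinite_finite_induct) (simp_all add: power_int_add)
  then have "one_parameter c = rf_const s * qq powi (\<Sum>x\<in>UNIV. Poly_Mapping.lookup m x)"
    unfolding one_parameter_def s(2) by (subst rf_subst_monomial_frac) (simp_all add: const)
  moreover have "(rf_const s :: 'n ratfun) \<in> {1, - 1}" using s(1) const by auto
  ultimately show ?thesis by blast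
qed

text \<open>
  Near \<open>1\<close> all indeterminates take nonzero values, and there the substitution is the evaluation
  of a monomial, which is continuous.
\<close>

lemma nonvanishing_signed_monomial:
  assumes "signed_monomial (c :: 'n::{finite,linorder} ratfun)"
  shows "nonvanishing_at_q_1 c"
  unfolding nonvanishing_at_q_1_def
proof (intro allI impI)
  fix \<rho> :: "complex \<Rightarrow> 'n qvar \<Rightarrow> complex" and t
  assume *: "(\<forall>z. \<rho> z qvar_q = z) \<and> (\<forall>x. ((\<lambda>z. \<rho> z x) \<longlongrightarrow> t x) (at 1) \<and> t x \<noteq> 0)"
  obtain m s where s: "s \<in> {1, - 1}" "c = monomial_frac m s"
    using assms by (rule signed_monomial_imp_monomial_frac)
  have "\<forall>\<^sub>F z in at 1. \<forall>x. \<rho> z x \<noteq> 0"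
  proof (rule eventually_all_finite)
    fix x
    show "\<forall>\<^sub>F z in at 1. \<rho> z x \<noteq> 0"
      using * by (intro tendsto_imp_eventually_ne[of _ "t x"]) auto
  qed
  then have ev: "\<forall>\<^sub>F z in at 1. s * (\<Prod>x\<in>UNIV. \<rho> z x powi Poly_Mapping.lookup m x) = rf_subst (\<lambda>a. a) (\<rho> z) c"
    by eventually_elim (simp add: s(2) rf_subst_monomial_frac)
  have "((\<lambda>z. s * (\<Prod>x\<in>UNIV. \<rho> z x powi Poly_Mapping.lookup m x)) \<longlongrightarrow>
      s * (\<Prod>x\<in>UNIV. t x powi Poly_Mapping.lookup m x)) (at 1)"
    using * by (intro tendsto_intros) auto
  then have "((\<lambda>z. rf_subst (\<lambda>a. a) (\<rho> z) c) \<longlongrightarrow> s * (\<Prod>x\<in>UNIV. t x powi Poly_Mapping.lookup m x)) (at 1)"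
    using ev by (rule Lim_transform_eventually)
  moreover have "s * (\<Prod>x\<in>UNIV. t x powi Poly_Mapping.lookup m x) \<noteq> 0"
    using s(1) * by auto
  ultimately show "\<exists>L. L \<noteq> 0 \<and> ((\<lambda>z. rf_subst (\<lambda>a. a) (\<rho> z) c) \<longlongrightarrow> L) (at 1)" by blast
qed

section \<open>Expansion into words\<close>

interpretation free_hom: scalar_hom "free_scal :: 'n::{finite,linorder} ratfun \<Rightarrow> 'n free"
  by unfold_locales (rule free_scal_hom free_scal_commute)+

text \<open>
  Distinct words are never collected into one coefficient.
\<close>

lemma keys_sum_singles:
  assumes "finite I" "inj_on w I" "v \<in> Poly_Mapping.keys (\<Sum>p\<in>I. Poly_Mapping.single (w p) (c p))"
  shows "\<exists>p\<in>I. Poly_Mapping.lookup (\<Sum>p\<in>I. Poly_Mapping.single (w p) (c p)) v = c p"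
proof -
  have eq: "Poly_Mapping.lookup (\<Sum>p\<in>I. Poly_Mapping.single (w p) (c p)) v = (\<Sum>p\<in>I. if w p = v then c p else 0)"
    by (simp add: lookup_sum lookup_single when_def)
  have "\<exists>p\<in>I. w p = v"
  proof (rule ccontr)
    assume "\<not> (\<exists>p\<in>I. w p = v)"
    then have "(\<Sum>p\<in>I. if w p = v then c p else 0) = 0" by (intro sum.neutral) auto
    then show False using assms(3) by (simp add: in_keys_iff eq)
  qed
  then obtain p where p: "p \<in> I" "w p = v" by blast
  have "w p' = v \<longleftrightarrow> p' = p" if "p' \<in> I" for p'
    using inj_onD[OF assms(2) _ that p(1)] p(2) by auto
  then have "(\<Sum>p'\<in>I. if w p' = v then c p' else 0) = (\<Sum>p'\<in>I. if p' = p then c p else 0)"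
    by (intro sum.cong refl) simp
  then have "(\<Sum>p'\<in>I. if w p' = v then c p' else 0) = c p"
    using assms(1) p(1) by simp
  then show ?thesis unfolding eq using p(1) by (intro bexI[of _ p])
qed

abbreviation X_word :: "'n list \<Rightarrow> 'n list \<Rightarrow> 'n gen list" where
  "X_word s u \<equiv> map2 GX s u"

lemma X_word_inject:
  "length s = length u \<Longrightarrow> length s' = length u' \<Longrightarrow> X_word s u = X_word s' u' \<longleftrightarrow> s = s' \<and> u = u'"
proof (induction s u arbitrary: s' u' rule: list_induct2)
  case Nil
  then show ?case by auto
next
  case (Cons a s b u)
  show ?case using Cons by (cases s'; cases u') auto
qed

lemma prod_list_free_X: "prod_list (map2 free_X s u) = Poly_Mapping.single (FMon (X_word s u)) 1"
proof (induction s u rule: list_induct2')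
  case (4 a s b u)
  then show ?case by (simp add: free_X_def mult_single plus_fmon_def)
qed (simp_all add: zero_fmon_def[symmetric])

lemma free_minor_DX:
  fixes J K :: "'n::{finite,linorder} set"
  assumes "card J = card K"
  shows "minor_DX free_scal free_X J K = (\<Sum>u\<in>arrangements K.
    Poly_Mapping.single (FMon (X_word (sorted_list_of_set J) u)) ((\<Prod>a\<in>J. D_entry a) * eps_u u))"
  unfolding minor_DX_def free_hom.qminor_scaled_rows[OF assms] free_hom.qminor_eq[OF assms]
    sum_distrib_left prod_list_free_X
  by (intro sum.cong refl) (simp add: free_scal_def mult_single)

lemma free_minor_XD':
  fixes J K :: "'n::{finite,linorder} set"
  assumes "card K = card J"
  shows "minor_XD' free_scal free_X K J = (\<Sum>u\<in>arrangements J.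
    Poly_Mapping.single (FMon (X_word (sorted_list_of_set K) u)) (eps_u u * (\<Prod>a\<in>J. D'_entry a)))"
  unfolding minor_XD'_def free_hom.qminor_scaled_columns[OF assms] free_hom.qminor_eq[OF assms]
    sum_distrib_right prod_list_free_X
  by (intro sum.cong refl) (simp add: free_scal_def mult_single)

text \<open>
  The index set of the full expansion: a set \<open>J\<close> of rows and a set \<open>K\<close> of columns of the minor of \<open>X\<close>, and
  an arrangement of the columns for each of the two minors of the product.
\<close>

definition minor_indices :: "nat \<Rightarrow> ('n::{finite,linorder} set \<times> 'n set \<times> 'n list \<times> 'n list) set" where
  "minor_indices i = (SIGMA J:subsets_of_card i. SIGMA K:subsets_of_card i. arrangements K \<times> arrangements K)"

lemma sum_minor_indices:
  fixes g :: "'n::{finite,linorder} set \<Rightarrow> 'n set \<Rightarrow> 'n list \<Rightarrow> 'n list \<Rightarrow> 'b::comm_monoid_add"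
  shows "(\<Sum>J\<in>subsets_of_card i. \<Sum>K\<in>subsets_of_card i. \<Sum>u\<in>arrangements K. \<Sum>w\<in>arrangements K. g J K u w) =
    (\<Sum>(J, K, u, w)\<in>minor_indices i. g J K u w)"
  by (simp add: minor_indices_def sum.cartesian_product sum.Sigma split_def)

lemma finite_minor_indices [simp]: "finite (minor_indices i)"
  by (auto simp: minor_indices_def intro!: finite_SigmaI)

lemma minor_indices_D:
  assumes "(J, K, u, w) \<in> minor_indices i"
  shows "card J = i" "card K = i" "u \<in> arrangements K" "w \<in> arrangements K"
    "length (sorted_list_of_set J) = i" "length u = i" "length w = i"
  using assms by (auto simp: minor_indices_def subsets_of_card_def length_arrangements)

lemma letters_star_inject: "map gen_star xs = map gen_star ys \<longleftrightarrow> xs = ys"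
  by (rule inj_map_eq_map) (metis gen_star_gen_star injI)

text \<open>
  The involution reverses the word of the second minor and turns its letters \<open>GX\<close> into
  \<open>GY\<close>; the two definitions belong to the two orders of the factors.
\<close>

definition word_XY :: "'n::{finite,linorder} set \<times> 'n set \<times> 'n list \<times> 'n list \<Rightarrow> 'n gen fmon" where
  "word_XY = (\<lambda>(J, K, u, w). FMon (X_word (sorted_list_of_set J) u @
    rev (map gen_star (X_word (sorted_list_of_set J) w))))"

definition word_YX :: "'n::{finite,linorder} set \<times> 'n set \<times> 'n list \<times> 'n list \<Rightarrow> 'n gen fmon" where
  "word_YX = (\<lambda>(J, K, u, w). FMon (rev (map gen_star (X_word (sorted_list_of_set J) w)) @
    X_word (sorted_list_of_set J) u))"

text \<open>
  The letters \<open>GX\<close> list the rows in increasing order together with the first arrangement, and the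
  letters \<open>GY\<close> list the second arrangement.
\<close>

lemma inj_on_words: "inj_on word_XY (minor_indices i)" "inj_on word_YX (minor_indices i)"
proof -
  have key: "(J, K, u, w) = (J', K', u', w')"
    if p: "(J, K, u, w) \<in> minor_indices i" "(J', K', u', w') \<in> minor_indices i"
      and X: "X_word (sorted_list_of_set J) u = X_word (sorted_list_of_set J') u'"
      and Y: "map gen_star (X_word (sorted_list_of_set J) w) = map gen_star (X_word (sorted_list_of_set J') w')"
    for J K J' K' :: "'n::{finite,linorder} set" and u w u' w'
  proof -
    note l = minor_indices_D[OF p(1)] minor_indices_D[OF p(2)]
    have "sorted_list_of_set J = sorted_list_of_set J'" "u = u'"
      using X_word_inject[of "sorted_list_of_set J" u "sorted_list_of_set J'" u'] X l by simp_all
    moreover have "w = w'"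
      using X_word_inject[of "sorted_list_of_set J" w "sorted_list_of_set J'" w'] Y[unfolded letters_star_inject] l
      by simp
    ultimately show ?thesis
      using l by (auto simp: arrangements_def dest: sorted_list_of_set_inject)
  qed
  show "inj_on word_XY (minor_indices i)"
  proof (rule inj_onI)
    fix p p' :: "'n::{finite,linorder} set \<times> 'n set \<times> 'n list \<times> 'n list"
    assume p: "p \<in> minor_indices i" "p' \<in> minor_indices i" "word_XY p = word_XY p'"
    obtain J K u w J' K' u' w' where pp: "p = (J, K, u, w)" "p' = (J', K', u', w')"
      by (metis prod.exhaust)
    have len: "length (X_word (sorted_list_of_set J) u) = length (X_word (sorted_list_of_set J') u')"
      using p minor_indices_D unfolding pp by (metis length_map length_zip)
    show "p = p'" unfolding pp
      by (rule key) (use p len in \<open>simp_all add: pp word_XY_def\<close>)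
  qed
  show "inj_on word_YX (minor_indices i)"
  proof (rule inj_onI)
    fix p p' :: "'n::{finite,linorder} set \<times> 'n set \<times> 'n list \<times> 'n list"
    assume p: "p \<in> minor_indices i" "p' \<in> minor_indices i" "word_YX p = word_YX p'"
    obtain J K u w J' K' u' w' where pp: "p = (J, K, u, w)" "p' = (J', K', u', w')"
      by (metis prod.exhaust)
    have len: "length (X_word (sorted_list_of_set J) w) = length (X_word (sorted_list_of_set J') w')"
      using p minor_indices_D unfolding pp by (metis length_map length_zip)
    show "p = p'" unfolding pp
      by (rule key) (use p len in \<open>simp_all add: pp word_YX_def\<close>)
  qed
qed

lemma free_sum_DX_YD:
  "(\<Sum>J\<in>subsets_of_card i. \<Sum>K\<in>subsets_of_card i.
      minor_DX free_scal free_X J K * minor_YD free_scal free_X free_star K J) =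
    (\<Sum>p\<in>minor_indices i. Poly_Mapping.single (word_XY p)
      (case p of (J, K, u, w) \<Rightarrow> ((\<Prod>a\<in>J. D_entry a) * eps_u u) * rf_star ((\<Prod>a\<in>J. D_entry a) * eps_u w)))"
proof -
  have "(\<Sum>J\<in>subsets_of_card i. \<Sum>K\<in>subsets_of_card i.
      minor_DX free_scal free_X J K * minor_YD free_scal free_X free_star K J) =
    (\<Sum>J\<in>subsets_of_card i. \<Sum>K\<in>subsets_of_card i. \<Sum>u\<in>arrangements K. \<Sum>w\<in>arrangements K.
      Poly_Mapping.single (word_XY (J, K, u, w))
        (((\<Prod>a\<in>J. D_entry a) * eps_u u) * rf_star ((\<Prod>a\<in>J. D_entry a) * eps_u w)))"
    by (intro sum.cong refl)
      (simp add: subsets_of_card_def minor_YD_def free_minor_DX free_star_sum sum_product mult_single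
        plus_fmon_def word_XY_def)
  then show ?thesis unfolding sum_minor_indices by (simp add: split_def)
qed

lemma free_sum_D'Y_XD':
  "(\<Sum>J\<in>subsets_of_card i. \<Sum>K\<in>subsets_of_card i.
      minor_D'Y free_scal free_X free_star J K * minor_XD' free_scal free_X K J) =
    (\<Sum>p\<in>minor_indices i. Poly_Mapping.single (word_YX p)
      (case p of (K, J, u, w) \<Rightarrow> rf_star (eps_u w * (\<Prod>a\<in>J. D'_entry a)) * (eps_u u * (\<Prod>a\<in>J. D'_entry a))))"
proof -
  have "(\<Sum>J\<in>subsets_of_card i. \<Sum>K\<in>subsets_of_card i.
      minor_D'Y free_scal free_X free_star J K * minor_XD' free_scal free_X K J) =
    (\<Sum>K\<in>subsets_of_card i. \<Sum>J\<in>subsets_of_card i.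
      minor_D'Y free_scal free_X free_star J K * minor_XD' free_scal free_X K J)"
    by (rule sum.swap)
  also have "\<dots> = (\<Sum>K\<in>subsets_of_card i. \<Sum>J\<in>subsets_of_card i. \<Sum>w\<in>arrangements J. \<Sum>u\<in>arrangements J.
      Poly_Mapping.single (word_YX (K, J, u, w))
        (rf_star (eps_u w * (\<Prod>a\<in>J. D'_entry a)) * (eps_u u * (\<Prod>a\<in>J. D'_entry a))))"
    by (intro sum.cong refl)
      (simp add: subsets_of_card_def minor_D'Y_def free_minor_XD' free_star_sum sum_product mult_single
        plus_fmon_def word_YX_def)
  also have "\<dots> = (\<Sum>K\<in>subsets_of_card i. \<Sum>J\<in>subsets_of_card i. \<Sum>u\<in>arrangements J. \<Sum>w\<in>arrangements J.
      Poly_Mapping.single (word_YX (K, J, u, w))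
        (rf_star (eps_u w * (\<Prod>a\<in>J. D'_entry a)) * (eps_u u * (\<Prod>a\<in>J. D'_entry a))))"
    by (rule sum.cong[OF refl], rule sum.cong[OF refl], rule sum.swap)
  finally show ?thesis unfolding sum_minor_indices by (simp add: split_def)
qed

section \<open>The elements sigma as sums of products of minors\<close>

lemma signed_monomial_coefficients:
  fixes J :: "'n::{finite,linorder} set"
  assumes "u \<in> arrangements K" "w \<in> arrangements K"
  shows "signed_monomial (((\<Prod>a\<in>J. D_entry a) * eps_u u) * rf_star ((\<Prod>a\<in>J. D_entry a) * eps_u w))"
    and "signed_monomial (rf_star (eps_u w * (\<Prod>a\<in>J. D'_entry a)) * (eps_u u * (\<Prod>a\<in>J. D'_entry a)))"
proof -
  have D: "signed_monomial (\<Prod>a\<in>J. D_entry a)" "signed_monomial (\<Prod>a\<in>J. D'_entry a)"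
    by (simp_all add: D_entry_def D'_entry_def signed_monomial_prod signed_monomial_power signed_monomial_qq)
  have eps: "signed_monomial (eps_u u)" "signed_monomial (eps_v w)"
    using assms by (auto simp: arrangements_def intro!: signed_monomial_eps signed_monomial_minus_qij)
  show "signed_monomial (((\<Prod>a\<in>J. D_entry a) * eps_u u) * rf_star ((\<Prod>a\<in>J. D_entry a) * eps_u w))"
    and "signed_monomial (rf_star (eps_u w * (\<Prod>a\<in>J. D'_entry a)) * (eps_u u * (\<Prod>a\<in>J. D'_entry a)))"
    using D eps by (simp_all add: rf_star_mult rf_star_prod_D signed_monomial_mult)
qed

theorem theorem1p1:
  fixes i :: nat
  assumes "CARD('n::{finite,linorder}) \<ge> 2" and "i \<le> CARD('n)"
  shows "(sigma_qQ i :: 'n qalg) =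
      (\<Sum>J\<in>subsets_of_card i. \<Sum>K\<in>subsets_of_card i.
        minor_DX qalg_scal qalg_X J K * minor_YD qalg_scal qalg_X qalg_star K J)
    \<and> (sigma_qQ i :: 'n qalg) =
      (\<Sum>J\<in>subsets_of_card i. \<Sum>K\<in>subsets_of_card i.
        minor_D'Y qalg_scal qalg_X qalg_star J K * minor_XD' qalg_scal qalg_X K J)
    \<and> (\<forall>E \<in> {\<Sum>J\<in>subsets_of_card i. \<Sum>K\<in>subsets_of_card i.
            minor_DX free_scal free_X J K * minor_YD free_scal free_X free_star K J,
          \<Sum>J\<in>subsets_of_card i. \<Sum>K\<in>subsets_of_card i.
            minor_D'Y free_scal free_X free_star J K * minor_XD' free_scal free_X K J :: 'n free}.
        \<forall>w \<in> Poly_Mapping.keys E.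
          signed_monomial (Poly_Mapping.lookup E w)
          \<and> (\<exists>s\<in>{1, - 1}. \<exists>k :: int. one_parameter (Poly_Mapping.lookup E w) = s * qq powi k)
          \<and> nonvanishing_at_q_1 (Poly_Mapping.lookup E w))"
proof (intro conjI ballI)
  show "(sigma_qQ i :: 'n qalg) = (\<Sum>J\<in>subsets_of_card i. \<Sum>K\<in>subsets_of_card i.
      minor_DX qalg_scal qalg_X J K * minor_YD qalg_scal qalg_X qalg_star K J)"
    by (rule sigma_qQ_eq_minors[OF assms(2)])
  then show "(sigma_qQ i :: 'n qalg) = (\<Sum>J\<in>subsets_of_card i. \<Sum>K\<in>subsets_of_card i.
      minor_D'Y qalg_scal qalg_X qalg_star J K * minor_XD' qalg_scal qalg_X K J)"
    unfolding sum_minor_DX_YD sum_minor_D'Y_XD' sum_minors_eq .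
next
  fix E :: "'n free" and w
  assume E: "E \<in> {\<Sum>J\<in>subsets_of_card i. \<Sum>K\<in>subsets_of_card i.
      minor_DX free_scal free_X J K * minor_YD free_scal free_X free_star K J,
    \<Sum>J\<in>subsets_of_card i. \<Sum>K\<in>subsets_of_card i.
      minor_D'Y free_scal free_X free_star J K * minor_XD' free_scal free_X K J}"
    and w: "w \<in> Poly_Mapping.keys E"
  show sm: "signed_monomial (Poly_Mapping.lookup E w)"
    using E
  proof (elim insertE emptyE)
    assume "E = (\<Sum>J\<in>subsets_of_card i. \<Sum>K\<in>subsets_of_card i.
        minor_DX free_scal free_X J K * minor_YD free_scal free_X free_star K J)"
    then have E': "E = (\<Sum>p\<in>minor_indices i. Poly_Mapping.single (word_XY p)
        (case p of (J, K, u, w) \<Rightarrow> ((\<Prod>a\<in>J. D_entry a) * eps_u u) * rf_star ((\<Prod>a\<in>J. D_entry a) * eps_u w)))"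
      unfolding free_sum_DX_YD .
    obtain p where p: "p \<in> minor_indices i" "Poly_Mapping.lookup E w =
        (case p of (J, K, u, w) \<Rightarrow> ((\<Prod>a\<in>J. D_entry a) * eps_u u) * rf_star ((\<Prod>a\<in>J. D_entry a) * eps_u w))"
      using keys_sum_singles[OF finite_minor_indices inj_on_words(1) w[unfolded E']] unfolding E' by (elim bexE)
    obtain J K u v where "p = (J, K, u, v)" by (rule prod_cases4)
    with p show ?thesis using signed_monomial_coefficients(1)[OF minor_indices_D(3,4)] by simp
  next
    assume "E = (\<Sum>J\<in>subsets_of_card i. \<Sum>K\<in>subsets_of_card i.
        minor_D'Y free_scal free_X free_star J K * minor_XD' free_scal free_X K J)"
    then have E': "E = (\<Sum>p\<in>minor_indices i. Poly_Mapping.single (word_YX p)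
        (case p of (K, J, u, w) \<Rightarrow> rf_star (eps_u w * (\<Prod>a\<in>J. D'_entry a)) * (eps_u u * (\<Prod>a\<in>J. D'_entry a))))"
      unfolding free_sum_D'Y_XD' .
    obtain p where p: "p \<in> minor_indices i" "Poly_Mapping.lookup E w =
        (case p of (K, J, u, w) \<Rightarrow> rf_star (eps_u w * (\<Prod>a\<in>J. D'_entry a)) * (eps_u u * (\<Prod>a\<in>J. D'_entry a)))"
      using keys_sum_singles[OF finite_minor_indices inj_on_words(2) w[unfolded E']] unfolding E' by (elim bexE)
    obtain K J u v where "p = (K, J, u, v)" by (rule prod_cases4)
    with p show ?thesis using signed_monomial_coefficients(2)[OF minor_indices_D(3,4)] by simp
  qed
  show "\<exists>s\<in>{1, - 1}. \<exists>k :: int. one_parameter (Poly_Mapping.lookup E w) = s * qq powi k"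
    by (rule one_parameter_signed_monomial[OF sm])
  show "nonvanishing_at_q_1 (Poly_Mapping.lookup E w)"
    by (rule nonvanishing_signed_monomial[OF sm])
qed

end
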